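(* Let $D \subset \mathbb{R}^2$ be an open set whose boundary $\partial D$ is piecewise $C^1$, with $0 \in \partial D$. Suppose that $u \in H^1_{\mathrm{loc}}(B_2)$ solves $$\Delta u = f \chi_D \text{ in } B_2, \qquad u = 0 \text{ outside } D,$$ where $f = H + R \in C^{\alpha}_{\mathrm{loc}}(B_2)$, $\alpha\in(0,1)$, with $H \not\equiv 0$ a harmonic homogeneous polynomial of degree $m \ge 0$ and $|R(x)| \leq C|x|^{m+\alpha}$. Then $\partial D$ is $C^1$ near $0$. Moreover, let $D \subset \mathbb{R}^2$ be an open set with $0 \in \partial D$ which is assumed to be convex instead of having piecewise $C^1$ boundary. Suppose that $u \in H^1_{\mathrm{loc}}(B_2)$ solves $$\Delta u = f \chi_D \text{ in } B_2, \qquad u = 0 \text{ outside } D,$$ where $f = H + R \in C^{\alpha}_{\mathrm{loc}}(B_2)$, $\alpha\in(0,1)$, with $H \not\equiv 0$ a harmonic homogeneous polynomial of degree $m \ge 0$ and $|R(x)| \leq C|x|^{m+\alpha}$. If for all points $z \in \partial D$ near $0$ one has decompositions $f(z + x) = H_z(x) + R_z(x)$ with $H_z \not\equiv 0$ a harmonic homogeneous polynomial of some degree $m_z \geq 0$ and $|R_z(x)| \leq C_z |x|^{m_z + \alpha}$, then $\partial D$ is $C^1$ near $0$.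
   Context: $B_r = B_r(0)$ is the open ball of radius $r$ and $\chi_D$ is the characteristic function of $D$. "$u=0$ outside $D$" means $u = 0$ in $B_2 \setminus \overline{D}$. Piecewise $C^1$: $D \subset \mathbb{R}^2$ has piecewise $C^1$ boundary if for any $x_0 \in \partial D$, after a rotation and translation taking $x_0$ to $0$, and for some $r>0$, one has $D \cap B_r(0) = \{x_2 > \eta(x_1)\} \cap B_r(0)$ where $\eta \in C([-r,r])$ and both $\eta|_{[-r,0]}$ and $\eta|_{[0,r]}$ are $C^1$ functions up to the endpoints of the respective closed intervals. $\partial D$ is $C^1$ near $0$ if for some $r>0$, after a rotation, $D \cap B_r(0) = \{x_2 > \eta(x_1)\} \cap B_r(0)$ with $\eta$ a $C^1$ function. *)

theory Defs
  imports "HOL-Analysis.Analysis"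
begin

section \<open>Classical derivatives, harmonic homogeneous polynomials\<close>

definition partial_deriv :: "'n \<Rightarrow> (real^'n \<Rightarrow> real) \<Rightarrow> real^'n \<Rightarrow> real" where
  "partial_deriv i h x = frechet_derivative h (at x) (axis i 1)"

definition grad :: "(real^'n \<Rightarrow> real) \<Rightarrow> real^'n \<Rightarrow> real^'n" where
  "grad h x = (\<chi> i. partial_deriv i h x)"

definition laplacian :: "(real^'n \<Rightarrow> real) \<Rightarrow> real^'n \<Rightarrow> real" where
  "laplacian h x = (\<Sum>i\<in>UNIV. partial_deriv i (partial_deriv i h) x)"

primrec C_k :: "nat \<Rightarrow> (real^'n \<Rightarrow> real) \<Rightarrow> bool" where
  "C_k 0 h \<longleftrightarrow> continuous_on UNIV h"
| "C_k (Suc k) h \<longleftrightarrow> (\<forall>x. h differentiable (at x)) \<and> (\<forall>i. C_k k (partial_deriv i h))"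

definition harmonic :: "(real^'n \<Rightarrow> real) \<Rightarrow> bool" where
  "harmonic h \<longleftrightarrow> C_k 2 h \<and> (\<forall>x. laplacian h x = 0)"

text \<open>As usual, the zero polynomial counts as homogeneous of every degree.\<close>

definition homogeneous_polynomial :: "nat \<Rightarrow> (real^2 \<Rightarrow> real) \<Rightarrow> bool" where
  "homogeneous_polynomial m h \<longleftrightarrow>
     (\<exists>c :: nat \<Rightarrow> real. \<forall>x. h x = (\<Sum>k\<le>m. c k * (x $ 1) ^ k * (x $ 2) ^ (m - k)))"


section \<open>Function spaces and weak solutions\<close>

text \<open>
  Functions on an open set \<open>U\<close> are total functions of which only the values on \<open>U\<close> matter.
\<close>

definition Hoelder_loc :: "real \<Rightarrow> (real^'n) set \<Rightarrow> (real^'n \<Rightarrow> real) \<Rightarrow> bool" where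
  "Hoelder_loc \<alpha> U f \<longleftrightarrow>
     (\<forall>K. compact K \<and> K \<subseteq> U \<longrightarrow>
        (\<exists>L. \<forall>x\<in>K. \<forall>y\<in>K. \<bar>f x - f y\<bar> \<le> L * norm (x - y) powr \<alpha>))"

definition L1_loc :: "(real^'n) set \<Rightarrow> (real^'n \<Rightarrow> real) \<Rightarrow> bool" where
  "L1_loc U f \<longleftrightarrow> f \<in> borel_measurable (lebesgue_on U) \<and>
     (\<forall>K. compact K \<and> K \<subseteq> U \<longrightarrow> integrable (lebesgue_on K) f)"

definition L2_loc :: "(real^'n) set \<Rightarrow> (real^'n \<Rightarrow> real) \<Rightarrow> bool" where
  "L2_loc U f \<longleftrightarrow> f \<in> borel_measurable (lebesgue_on U) \<and>
     (\<forall>K. compact K \<and> K \<subseteq> U \<longrightarrow> integrable (lebesgue_on K) (\<lambda>x. (f x)\<^sup>2))"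

definition test_function :: "(real^'n) set \<Rightarrow> (real^'n \<Rightarrow> real) \<Rightarrow> bool" where
  "test_function U \<phi> \<longleftrightarrow> (\<forall>k. C_k k \<phi>) \<and>
     compact (closure {x. \<phi> x \<noteq> 0}) \<and> closure {x. \<phi> x \<noteq> 0} \<subseteq> U"

definition weak_gradient ::
  "(real^'n) set \<Rightarrow> (real^'n \<Rightarrow> real) \<Rightarrow> (real^'n \<Rightarrow> real^'n) \<Rightarrow> bool" where
  "weak_gradient U u G \<longleftrightarrow> L1_loc U u \<and> (\<forall>i. L1_loc U (\<lambda>x. G x $ i)) \<and>
     (\<forall>\<phi> i. test_function U \<phi> \<longrightarrow>
        (\<integral>x. u x * partial_deriv i \<phi> x \<partial>lebesgue_on U)
        = - (\<integral>x. G x $ i * \<phi> x \<partial>lebesgue_on U))"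

definition H1_loc :: "(real^'n) set \<Rightarrow> (real^'n \<Rightarrow> real) \<Rightarrow> bool" where
  "H1_loc U u \<longleftrightarrow> L2_loc U u \<and>
     (\<exists>G. weak_gradient U u G \<and> (\<forall>i. L2_loc U (\<lambda>x. G x $ i)))"

text \<open>
  \<open>u\<close> solves \<open>\<Delta>u = F\<close> in \<open>U\<close> in the weak sense. The weak gradient is unique up to null sets,
  so the choice of \<open>G\<close> is immaterial.
\<close>

definition weak_poisson :: "(real^'n) set \<Rightarrow> (real^'n \<Rightarrow> real) \<Rightarrow> (real^'n \<Rightarrow> real) \<Rightarrow> bool" where
  "weak_poisson U u F \<longleftrightarrow> L1_loc U F \<and>
     (\<exists>G. weak_gradient U u G \<and>
        (\<forall>\<phi>. test_function U \<phi> \<longrightarrow>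
           (\<integral>x. G x \<bullet> grad \<phi> x \<partial>lebesgue_on U) = - (\<integral>x. F x * \<phi> x \<partial>lebesgue_on U)))"


section \<open>Regularity of the boundary\<close>

text \<open>
  \<open>C\<^sup>1\<close> on a closed interval, up to the end points: the derivatives there are one-sided. (The library's
  \<open>C1_differentiable_on\<close> asks for two-sided derivatives, so it does not fit.)
\<close>

definition C1_on :: "real set \<Rightarrow> (real \<Rightarrow> real) \<Rightarrow> bool" where
  "C1_on S \<eta> \<longleftrightarrow>
     (\<exists>\<eta>'. continuous_on S \<eta>' \<and> (\<forall>t\<in>S. (\<eta> has_real_derivative \<eta>' t) (at t within S)))"

text \<open>
  In \<open>ball x0 r\<close>, after the rigid motion \<open>x \<mapsto> A (x - x0)\<close>, the set \<open>D\<close> is the region above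
  the graph of \<open>\<eta>\<close>.
\<close>

definition epigraph_near :: "(real^2) set \<Rightarrow> real^2 \<Rightarrow> real \<Rightarrow> (real \<Rightarrow> real) \<Rightarrow> bool" where
  "epigraph_near D x0 r \<eta> \<longleftrightarrow>
     (\<exists>A :: real^2^2. rotation_matrix A \<and>
        ((\<lambda>x. A *v (x - x0)) ` D) \<inter> ball 0 r = {y. y $ 2 > \<eta> (y $ 1)} \<inter> ball 0 r)"

definition piecewise_C1_boundary :: "(real^2) set \<Rightarrow> bool" where
  "piecewise_C1_boundary D \<longleftrightarrow>
     (\<forall>x0\<in>frontier D. \<exists>r>0. \<exists>\<eta>. continuous_on {-r..r} \<eta> \<and>
        C1_on {-r..0} \<eta> \<and> C1_on {0..r} \<eta> \<and> epigraph_near D x0 r \<eta>)"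

definition C1_boundary_near :: "(real^2) set \<Rightarrow> real^2 \<Rightarrow> bool" where
  "C1_boundary_near D x0 \<longleftrightarrow>
     (\<exists>r>0. \<exists>\<eta>. C1_on {-r..r} \<eta> \<and> epigraph_near D x0 r \<eta>)"

end

theory Submission
  imports Defs "HOL-Probability.Sinc_Integral"
begin

text \<open>
  Near a boundary point the domain is the region above a graph which has one-sided slopes \<open>a\<close> (left)
  and \<open>b\<close> (right), so it looks like a sector \<open>S\<close>. Both parts of the theorem reduce to
  \<open>a = b\<close>: a piecewise \<open>C\<^sup>1\<close> graph without corner is \<open>C\<^sup>1\<close>, and a differentiable convex function
  has a continuous derivative.

  Integrating by parts twice, \<open>\<integral> u \<Delta>\<phi> = \<integral>\<^sub>D f \<phi>\<close> for every test function \<open>\<phi>\<close>. In complex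
  coordinates \<open>z\<close> that are centred at the corner and rotated so that \<open>D\<close> lies above the graph, take
  \[ \phi_\epsilon = \psi\, \mathrm{Re} (\kappa \epsilon^2 (z + i \epsilon)^{-(m + 4)}) \]
  on the closure of \<open>D\<close>, with a fixed cutoff \<open>\<psi>\<close> that is \<open>1\<close> near the corner. The pole
  \<open>- i \<epsilon>\<close> lies below the graph, where \<open>u\<close> and the right-hand side vanish, so the kernel may be
  changed there to make \<open>\<phi>\<^sub>\<epsilon>\<close> smooth. On the closure of \<open>D\<close> the kernel is
  harmonic; hence \<open>\<Delta>\<phi>\<^sub>\<epsilon>\<close> lives where \<open>\<psi>\<close> is not constant, is \<open>O(\<epsilon>\<^sup>2)\<close> there, and the left-hand
  side tends to \<open>0\<close> (\<open>laplacian_pairing_tendsto_0\<close>).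
  The substitution \<open>z = \<epsilon> y\<close> turns the right-hand side into an integral with a fixed integrable
  majorant, and dominated convergence gives
  \[ \int_S H(y)\, (y + i)^{-(m + 4)}\, dy = 0 \]
  (\<open>sector_integral_orthogonal\<close>).

  This integral can be computed. A harmonic homogeneous polynomial is \<open>H = Re (c z\<^sup>m)\<close>
  (\<open>harmonic_homogeneous_polynomial_eq\<close>). Integrating along the rays \<open>y = s (1 + i t)\<close> first and over
  the slope \<open>t\<close> afterwards leaves, up to a nonzero constant, \<open>E (q a) - E (q b)\<close> with
  \<open>E q = c q + cnj c q\<^bsup>m+1\<^esup> / (m + 1)\<close> and the unimodular number \<open>q t = (1 - i t) / (1 + i t)\<close>
  (\<open>sector_integral\<close>). If \<open>E p = E q\<close> for distinct unimodular \<open>p\<close>, \<open>q\<close>, then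
  \<open>\<bar>p\<^sup>m + p\<^bsup>m-1\<^esup> q + \<dots> + q\<^sup>m\<bar> = m + 1\<close>, which for \<open>m \<ge> 1\<close> is impossible by the strict triangle
  inequality, and for \<open>m = 0\<close> forces \<open>Re c = 0\<close> (\<open>slope_primitive_inj\<close>). As \<open>t\<close> is determined by
  \<open>q t\<close>, the slopes agree.
\<close>

section \<open>Elementary smooth functions\<close>

text \<open>
  The functions \<open>t\<^bsup>-k\<^esup> exp (- 1 / t)\<close>, extended by \<open>0\<close>, are closed under differentiation up to linear
  combinations; so all derivatives of the standard flat function are available without an explicit
  formula.
\<close>

definition flat :: "nat \<Rightarrow> real \<Rightarrow> real" where
  "flat k t = (if 0 < t then exp (- (1 / t)) / t ^ k else 0)"

lemma flat_nonneg: "0 \<le> flat k t"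
  by (simp add: flat_def)

lemma flat_pos: "0 < t \<Longrightarrow> 0 < flat k t"
  by (simp add: flat_def)

lemma flat_eq_0: "t \<le> 0 \<Longrightarrow> flat k t = 0"
  by (simp add: flat_def)

lemma flat_tendsto_0: "(flat k \<longlongrightarrow> 0) (at_right 0)"
proof -
  have "((\<lambda>t::real. inverse t ^ k / exp (inverse t)) \<longlongrightarrow> 0) (at_right 0)"
    by (rule filterlim_compose[OF tendsto_power_div_exp_0 filterlim_inverse_at_top_right])
  moreover have "eventually (\<lambda>t. inverse t ^ k / exp (inverse t) = flat k t) (at_right (0::real))"
    using eventually_at_right_less[of "0::real"]
    by eventually_elim (simp add: flat_def exp_minus field_simps)
  ultimately show ?thesis
    by (rule Lim_transform_eventually)
qed

lemma flat_has_derivative: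
  "(flat k has_real_derivative flat (k + 2) t - k * flat (k + 1) t) (at t)"
proof -
  consider "0 < t" | "t < 0" | "t = 0" by linarith
  then show ?thesis
  proof cases
    case 1
    have "k = 0 \<or> t ^ k = t * t ^ (k - Suc 0)"
      by (cases k) auto
    then have "((\<lambda>s. exp (- (1 / s)) / s ^ k) has_real_derivative
        flat (k + 2) t - k * flat (k + 1) t) (at t)"
      using 1 by (auto intro!: derivative_eq_intros simp: flat_def field_simps power2_eq_square)
    then show ?thesis
      by (rule has_field_derivative_transform_within_open[of _ _ _ "{0<..}"])
        (use 1 in \<open>auto simp: flat_def\<close>)
  next
    case 2
    have "((\<lambda>s. 0) has_real_derivative flat (k + 2) t - k * flat (k + 1) t) (at t)"
      using 2 by (simp add: flat_def)
    then show ?thesis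
      by (rule has_field_derivative_transform_within_open[of _ _ _ "{..<0}"])
        (use 2 in \<open>auto simp: flat_def\<close>)
  next
    case 3
    have "((\<lambda>h. (flat k (0 + h) - flat k 0) / h) \<longlongrightarrow> 0) (at 0)"
    proof (rule filterlim_split_at_real)
      show "((\<lambda>h. (flat k (0 + h) - flat k 0) / h) \<longlongrightarrow> 0) (at_left 0)"
        by (rule tendsto_eventually, rule eventually_mono[OF eventually_at_left_real[of "-1" 0]])
          (auto simp: flat_def)
      have "eventually (\<lambda>h. flat (k + 1) h = (flat k (0 + h) - flat k 0) / h) (at_right 0)"
        using eventually_at_right_less[of "0::real"]
        by eventually_elim (simp add: flat_def field_simps)
      then show "((\<lambda>h. (flat k (0 + h) - flat k 0) / h) \<longlongrightarrow> 0) (at_right 0)"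
        by (rule Lim_transform_eventually[OF flat_tendsto_0])
    qed
    then show ?thesis
      using 3 by (simp add: DERIV_def flat_eq_0)
  qed
qed

text \<open>
  This class contains every test function that is needed and is closed under partial derivatives;
  membership therefore gives \<open>C\<^sup>k\<close> for all \<open>k\<close> by a single induction.
\<close>

inductive elem_smooth :: "(real^'n::finite \<Rightarrow> real) \<Rightarrow> bool" where
  const: "elem_smooth (\<lambda>x. c)"
| coord: "elem_smooth (\<lambda>x. x $ i)"
| add: "elem_smooth g \<Longrightarrow> elem_smooth h \<Longrightarrow> elem_smooth (\<lambda>x. g x + h x)"
| mult: "elem_smooth g \<Longrightarrow> elem_smooth h \<Longrightarrow> elem_smooth (\<lambda>x. g x * h x)"
| inverse: "elem_smooth g \<Longrightarrow> (\<And>x. g x \<noteq> 0) \<Longrightarrow> elem_smooth (\<lambda>x. inverse (g x))"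
| flat: "elem_smooth g \<Longrightarrow> elem_smooth (\<lambda>x. flat k (g x))"

lemma partial_derivI:
  assumes "(h has_derivative h') (at x)"
  shows "partial_deriv i h x = h' (axis i 1)"
  using frechet_derivative_at[OF assms] by (simp add: partial_deriv_def)

lemma has_derivative_partial:
  assumes "h differentiable (at x)"
  shows "(h has_derivative frechet_derivative h (at x)) (at x)"
  using assms frechet_derivative_works by blast

text \<open>
  Each formation rule has a differentiation rule (product, quotient, chain rule) whose result is again
  built by the formation rules.
\<close>

lemma elem_smooth_partial_deriv:
  fixes h :: "real^'n::finite \<Rightarrow> real"
  assumes "elem_smooth h"
  shows "(\<forall>x. h differentiable (at x)) \<and> (\<forall>i. elem_smooth (partial_deriv i h))"
  using assms
proof induction
  case (const c)
  have "partial_deriv i (\<lambda>x. c) = (\<lambda>x. 0)" for i :: 'n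
    by (auto intro!: partial_derivI[THEN trans] derivative_eq_intros)
  then show ?case
    by (auto intro: elem_smooth.const)
next
  case (coord j)
  have d: "((\<lambda>x::real^'n. x $ j) has_derivative (\<lambda>x. x $ j)) (at x)" for x
    by (simp add: bounded_linear_imp_has_derivative bounded_linear_vec_nth)
  have "partial_deriv i (\<lambda>x. x $ j) = (\<lambda>x. axis i 1 $ j)" for i :: 'n
    by (auto intro!: partial_derivI[THEN trans] d)
  then show ?case
    using d by (auto intro: elem_smooth.const simp: differentiable_def)
next
  case (add g h)
  have d: "((\<lambda>x. g x + h x) has_derivative
      (\<lambda>v. frechet_derivative g (at x) v + frechet_derivative h (at x) v)) (at x)" for x
    using add.IH by (auto intro!: has_derivative_add has_derivative_partial)
  have "partial_deriv i (\<lambda>x. g x + h x) = (\<lambda>x. partial_deriv i g x + partial_deriv i h x)" for i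
    by (rule ext, subst partial_derivI[OF d]) (simp add: partial_deriv_def)
  then show ?case
    using d add.IH by (auto intro: elem_smooth.add simp: differentiable_def)
next
  case (mult g h)
  have d: "((\<lambda>x. g x * h x) has_derivative
      (\<lambda>v. g x * frechet_derivative h (at x) v + frechet_derivative g (at x) v * h x)) (at x)" for x
    using mult.IH by (auto intro!: has_derivative_mult has_derivative_partial)
  have "partial_deriv i (\<lambda>x. g x * h x)
      = (\<lambda>x. g x * partial_deriv i h x + partial_deriv i g x * h x)" for i
    by (rule ext, subst partial_derivI[OF d]) (simp add: partial_deriv_def)
  then show ?case
    using d mult.IH mult.hyps by (auto intro!: elem_smooth.add elem_smooth.mult simp: differentiable_def)
next
  case (inverse g)
  have d: "((\<lambda>x. inverse (g x)) has_derivative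
      (\<lambda>v. - (inverse (g x) * frechet_derivative g (at x) v * inverse (g x)))) (at x)" for x
    using inverse by (auto intro!: Deriv.has_derivative_inverse has_derivative_partial)
  have "partial_deriv i (\<lambda>x. inverse (g x))
      = (\<lambda>x. (- 1) * (inverse (g x) * partial_deriv i g x * inverse (g x)))" for i
    by (rule ext, subst partial_derivI[OF d]) (simp add: partial_deriv_def)
  then have "elem_smooth (partial_deriv i (\<lambda>x. inverse (g x)))" for i
    by (simp only:) (intro elem_smooth.mult elem_smooth.inverse elem_smooth.const; use inverse in auto)
  then show ?case
    using d by (auto simp: differentiable_def)
next
  case (flat g k)
  have d: "((\<lambda>x. flat k (g x)) has_derivative
      (\<lambda>v. frechet_derivative g (at x) v * (flat (k + 2) (g x) - k * flat (k + 1) (g x)))) (at x)" for x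
    by (rule has_derivative_compose[OF has_derivative_partial
        flat_has_derivative[unfolded has_field_derivative_def], THEN has_derivative_eq_rhs])
      (use flat.IH in \<open>auto simp: mult_ac\<close>)
  have "partial_deriv i (\<lambda>x. flat k (g x))
      = (\<lambda>x. partial_deriv i g x * (flat (k + 2) (g x) + (- k) * flat (k + 1) (g x)))" for i
    by (rule ext, subst partial_derivI[OF d]) (simp add: partial_deriv_def)
  then have "elem_smooth (partial_deriv i (\<lambda>x. flat k (g x)))" for i
    by (simp only:) (intro elem_smooth.mult elem_smooth.add elem_smooth.flat elem_smooth.const; use flat in auto)
  then show ?case
    using d by (auto simp: differentiable_def)
qed

lemma elem_smooth_differentiable: "elem_smooth h \<Longrightarrow> h differentiable (at x)"
  and elem_smooth_partial: "elem_smooth h \<Longrightarrow> elem_smooth (partial_deriv i h)"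
  using elem_smooth_partial_deriv by blast+

lemma elem_smooth_continuous: "elem_smooth h \<Longrightarrow> continuous_on S h"
  by (meson continuous_at_imp_continuous_on differentiable_imp_continuous_within elem_smooth_differentiable)

lemma elem_smooth_C_k: "elem_smooth h \<Longrightarrow> C_k k h"
  by (induction k arbitrary: h)
    (auto simp: elem_smooth_continuous elem_smooth_differentiable elem_smooth_partial)

lemma elem_smooth_diff: "elem_smooth g \<Longrightarrow> elem_smooth h \<Longrightarrow> elem_smooth (\<lambda>x. g x - h x)"
  using elem_smooth.add[of g "\<lambda>x. (- 1) * h x"] elem_smooth.mult[OF elem_smooth.const, of h "- 1"] by simp

lemma elem_smooth_uminus: "elem_smooth h \<Longrightarrow> elem_smooth (\<lambda>x. - h x)"
  using elem_smooth_diff[OF elem_smooth.const, of h 0] by simp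

text \<open>
  Complex-valued companions, so that the kernel can be assembled with complex arithmetic.
\<close>

definition celem_smooth :: "(real^'n::finite \<Rightarrow> complex) \<Rightarrow> bool" where
  "celem_smooth g \<longleftrightarrow> elem_smooth (\<lambda>x. Re (g x)) \<and> elem_smooth (\<lambda>x. Im (g x))"

lemma celem_smooth_mult: "celem_smooth g \<Longrightarrow> celem_smooth h \<Longrightarrow> celem_smooth (\<lambda>x. g x * h x)"
  by (auto simp: celem_smooth_def intro!: elem_smooth_diff elem_smooth.add elem_smooth.mult)

lemma celem_smooth_add: "celem_smooth g \<Longrightarrow> celem_smooth h \<Longrightarrow> celem_smooth (\<lambda>x. g x + h x)"
  by (auto simp: celem_smooth_def intro!: elem_smooth.add)

lemma celem_smooth_diff: "celem_smooth g \<Longrightarrow> celem_smooth h \<Longrightarrow> celem_smooth (\<lambda>x. g x - h x)"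
  by (auto simp: celem_smooth_def intro!: elem_smooth_diff)

lemma celem_smooth_const: "celem_smooth (\<lambda>x. c)"
  by (auto simp: celem_smooth_def intro!: elem_smooth.const)

lemma celem_smooth_of_real: "elem_smooth g \<Longrightarrow> celem_smooth (\<lambda>x. of_real (g x))"
  by (auto simp: celem_smooth_def intro!: elem_smooth.const)

lemma celem_smooth_cnj: "celem_smooth g \<Longrightarrow> celem_smooth (\<lambda>x. cnj (g x))"
  by (auto simp: celem_smooth_def intro!: elem_smooth_uminus)

lemma celem_smooth_power: "celem_smooth g \<Longrightarrow> celem_smooth (\<lambda>x. g x ^ n)"
  by (induction n) (auto intro!: celem_smooth_mult celem_smooth_const)

lemma elem_smooth_cmod_sq: "celem_smooth g \<Longrightarrow> elem_smooth (\<lambda>x. (cmod (g x))\<^sup>2)"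
  by (subst cmod_power2, unfold power2_eq_square)
 (auto simp: celem_smooth_def intro!: elem_smooth.add elem_smooth.mult)

section \<open>The distributional identity\<close>

lemma partial_deriv_local:
  assumes "open U" "x \<in> U" "\<And>y. y \<in> U \<Longrightarrow> g y = h y"
  shows "partial_deriv i g x = partial_deriv i h x"
proof -
  have "(g has_derivative D) (at x) \<longleftrightarrow> (h has_derivative D) (at x)" for D
  proof
    show "(h has_derivative D) (at x)" if "(g has_derivative D) (at x)"
      by (rule has_derivative_transform_within_open[OF that assms])
    show "(g has_derivative D) (at x)" if "(h has_derivative D) (at x)"
      by (rule has_derivative_transform_within_open[OF that assms(1,2)]) (simp add: assms(3))
  qed
  then show ?thesis
    by (simp add: partial_deriv_def frechet_derivative_def)
qed

lemma laplacian_local: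
  fixes g :: "real^'a \<Rightarrow> real"
  assumes "open U" "x \<in> U" "\<And>y. y \<in> U \<Longrightarrow> g y = h y"
  shows "laplacian g x = laplacian h x"
  unfolding laplacian_def
proof (rule sum.cong[OF refl])
  fix i :: 'a
  have "partial_deriv i g y = partial_deriv i h y" if "y \<in> U" for y
    by (rule partial_deriv_local[OF assms(1) that assms(3)])
  then show "partial_deriv i (partial_deriv i g) x = partial_deriv i (partial_deriv i h) x"
    by (rule partial_deriv_local[OF assms(1,2)])
qed

lemma partial_deriv_zero: "partial_deriv i (\<lambda>x. 0) x = 0"
  by (subst partial_derivI[of _ "\<lambda>x. 0"]) auto

lemma laplacian_zero: "laplacian (\<lambda>x. 0) x = 0"
proof -
  have *: "partial_deriv i (\<lambda>x. 0) = (\<lambda>x. 0)" for i :: 'a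
    by (rule ext) (rule partial_deriv_zero)
  show ?thesis by (simp add: laplacian_def *)
qed

lemma partial_deriv_outside_support:
  assumes "x \<notin> closure {x. \<phi> x \<noteq> 0}"
  shows "partial_deriv i \<phi> x = 0"
proof -
  have "partial_deriv i \<phi> x = partial_deriv i (\<lambda>x. 0) x"
    by (rule partial_deriv_local[of "- closure {x. \<phi> x \<noteq> 0}"])
      (use assms closure_subset[of "{x. \<phi> x \<noteq> 0}"] in auto)
  then show ?thesis by (simp add: partial_deriv_zero)
qed

lemma test_function_partial_deriv:
  assumes "test_function U \<phi>"
  shows "test_function U (partial_deriv i \<phi>)"
proof -
  have "{x. partial_deriv i \<phi> x \<noteq> 0} \<subseteq> closure {x. \<phi> x \<noteq> 0}"
    using partial_deriv_outside_support by blast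
  then have sub: "closure {x. partial_deriv i \<phi> x \<noteq> 0} \<subseteq> closure {x. \<phi> x \<noteq> 0}"
    by (rule closure_minimal) simp
  have "C_k k (partial_deriv i \<phi>)" for k
    using assms by (metis C_k.simps(2) test_function_def)
  moreover have "compact (closure {x. partial_deriv i \<phi> x \<noteq> 0})"
    using compact_Int_closed[of "closure {x. \<phi> x \<noteq> 0}" "closure {x. partial_deriv i \<phi> x \<noteq> 0}"] sub assms
    by (simp add: test_function_def inf.absorb2)
  ultimately show ?thesis
    using sub assms by (auto simp: test_function_def)
qed

lemma test_function_continuous: "test_function U \<phi> \<Longrightarrow> continuous_on S \<phi>"
  unfolding test_function_def by (metis C_k.simps(1) continuous_on_subset subset_UNIV)

text \<open>
  A test function is bounded and vanishes off a compact subset of \<open>U\<close>, on which \<open>g\<close> is integrable.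
\<close>

lemma L1_loc_mult_test_integrable:
  assumes g: "L1_loc U g" and U: "open U" and \<phi>: "test_function U \<phi>"
  shows "integrable (lebesgue_on U) (\<lambda>x. g x * \<phi> x)"
proof -
  let ?K = "closure {x. \<phi> x \<noteq> 0}"
  have K: "compact ?K" "?K \<subseteq> U" using \<phi> by (auto simp: test_function_def)
  have meas: "(\<lambda>x. \<phi> x) \<in> borel_measurable (lebesgue_on ?K)"
    by (rule continuous_imp_measurable_on_sets_lebesgue[OF test_function_continuous[OF \<phi>]]) simp
  have "bounded (\<phi> ` ?K)"
    using K compact_continuous_image compact_imp_bounded test_function_continuous[OF \<phi>] by blast
  then obtain B where B: "\<And>x. x \<in> ?K \<Longrightarrow> \<bar>\<phi> x\<bar> \<le> B"
    by (auto simp: bounded_iff)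
  have gi: "integrable (lebesgue_on ?K) g" using g K by (auto simp: L1_loc_def)
  have "integrable (lebesgue_on ?K) (\<lambda>x. g x * \<phi> x)"
  proof (rule Bochner_Integration.integrable_bound)
    show "integrable (lebesgue_on ?K) (\<lambda>x. B * g x)" using gi by simp
    show "(\<lambda>x. g x * \<phi> x) \<in> borel_measurable (lebesgue_on ?K)"
      by (rule borel_measurable_times[OF borel_measurable_integrable[OF gi] meas])
    show "AE x in lebesgue_on ?K. norm (g x * \<phi> x) \<le> norm (B * g x)"
    proof (rule AE_I2)
      fix x assume "x \<in> space (lebesgue_on ?K)"
      then have "\<bar>\<phi> x\<bar> \<le> \<bar>B\<bar>" using B[of x] by simp
      then have "\<bar>\<phi> x\<bar> * \<bar>g x\<bar> \<le> \<bar>B\<bar> * \<bar>g x\<bar>" by (rule mult_right_mono) simp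
      moreover have "norm (g x * \<phi> x) = \<bar>\<phi> x\<bar> * \<bar>g x\<bar>" by (simp only: real_norm_def abs_mult mult.commute)
      moreover have "norm (B * g x) = \<bar>B\<bar> * \<bar>g x\<bar>" by (simp only: real_norm_def abs_mult)
      ultimately show "norm (g x * \<phi> x) \<le> norm (B * g x)" by simp
    qed
  qed
  then have "integrable lebesgue (\<lambda>x. indicator ?K x *\<^sub>R (g x * \<phi> x))"
    by (subst (asm) integrable_restrict_space) simp_all
  moreover have "indicator ?K x *\<^sub>R (g x * \<phi> x) = indicator U x *\<^sub>R (g x * \<phi> x)" for x
  proof (cases "\<phi> x = 0")
    case False
    then have "x \<in> ?K" using closure_subset[of "{x. \<phi> x \<noteq> 0}"] by blast
    moreover have "x \<in> U" using K(2) \<open>x \<in> ?K\<close> by (rule subsetD)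
    ultimately show ?thesis by (simp only: indicator_simps)
  qed simp
  ultimately have "integrable lebesgue (\<lambda>x. indicator U x *\<^sub>R (g x * \<phi> x))"
    by (simp only:)
  then show ?thesis
    using U by (subst integrable_restrict_space) simp_all
qed

text \<open>
  Partial derivatives of a test function are test functions, so the definition of the weak gradient
  applies to them and moves the second derivative from \<open>u\<close> to \<open>\<phi>\<close>.
\<close>

lemma weak_poisson_laplacian:
  assumes U: "open U" and w: "weak_poisson U u F" and \<phi>: "test_function U \<phi>"
  shows "(\<integral>x. u x * laplacian \<phi> x \<partial>lebesgue_on U) = (\<integral>x. F x * \<phi> x \<partial>lebesgue_on U)"
proof -
  obtain G where G: "weak_gradient U u G"
    and eq: "(\<integral>x. G x \<bullet> grad \<phi> x \<partial>lebesgue_on U) = - (\<integral>x. F x * \<phi> x \<partial>lebesgue_on U)"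
    using w \<phi> by (auto simp: weak_poisson_def)
  have u: "L1_loc U u" and Gi: "\<And>i. L1_loc U (\<lambda>x. G x $ i)"
    using G by (auto simp: weak_gradient_def)
  note t1 = test_function_partial_deriv[OF \<phi>]
  have i1: "integrable (lebesgue_on U) (\<lambda>x. G x $ i * partial_deriv i \<phi> x)" for i
    by (rule L1_loc_mult_test_integrable[OF Gi U t1])
  have i2: "integrable (lebesgue_on U) (\<lambda>x. u x * partial_deriv i (partial_deriv i \<phi>) x)" for i
    by (rule L1_loc_mult_test_integrable[OF u U test_function_partial_deriv[OF t1]])
  have "(\<integral>x. u x * laplacian \<phi> x \<partial>lebesgue_on U)
      = (\<Sum>i\<in>UNIV. \<integral>x. u x * partial_deriv i (partial_deriv i \<phi>) x \<partial>lebesgue_on U)"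
    unfolding laplacian_def sum_distrib_left
    by (rule Bochner_Integration.integral_sum[OF i2])
  also have "\<dots> = (\<Sum>i\<in>UNIV. - (\<integral>x. G x $ i * partial_deriv i \<phi> x \<partial>lebesgue_on U))"
    using G t1 by (intro sum.cong) (auto simp: weak_gradient_def)
  also have "\<dots> = - (\<integral>x. (\<Sum>i\<in>UNIV. G x $ i * partial_deriv i \<phi> x) \<partial>lebesgue_on U)"
    by (simp only: Bochner_Integration.integral_sum[OF i1] sum_negf)
  also have "\<dots> = - (\<integral>x. G x \<bullet> grad \<phi> x \<partial>lebesgue_on U)"
    by (simp add: inner_vec_def grad_def)
  finally show ?thesis using eq by simp
qed

section \<open>Truncated holomorphic functions\<close>

definition cplx :: "real^2 \<Rightarrow> complex" where
  "cplx x = Complex (x $ 1) (x $ 2)"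

lemma Re_cplx [simp]: "Re (cplx x) = x $ 1" and Im_cplx [simp]: "Im (cplx x) = x $ 2"
  by (auto simp: cplx_def)

lemma linear_cplx: "linear cplx"
  by (rule linearI) (auto simp: complex_eq_iff)

lemma bounded_linear_cplx: "bounded_linear cplx"
  by (rule linear_conv_bounded_linear[THEN iffD1, OF linear_cplx])

lemma cplx_diff: "cplx (x - y) = cplx x - cplx y" and cplx_add: "cplx (x + y) = cplx x + cplx y"
  and cplx_scaleR: "cplx (r *\<^sub>R x) = of_real r * cplx x" and cplx_0 [simp]: "cplx 0 = 0"
  by (auto simp: complex_eq_iff)

lemma norm_cplx [simp]: "cmod (cplx x) = norm x"
  by (simp add: cmod_def norm_vec_def L2_set_def sum_2)

lemma Re_of_real_times: "Re (of_real t * z) = t * Re z"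
  by simp

lemma orthogonal_matrix_norm:
  fixes A :: "real^'n^'n"
  assumes "orthogonal_matrix A"
  shows "norm (A *v v) = norm v"
  using assms by (metis matrix_of_matrix_vector_mul matrix_vector_mul_linear orthogonal_transformation_matrix orthogonal_transformation_norm)

text \<open>
  For an orthogonal matrix with entries \<open>a b / c d\<close> and determinant \<open>1\<close>, the sum of squares
  \<open>(a - d)\<^sup>2 + (b + c)\<^sup>2\<close> equals \<open>2 - 2 det = 0\<close>, so a rotation is multiplication by \<open>a + i c\<close>.
\<close>

lemma rotation_matrix_cplx:
  assumes "rotation_matrix A"
  obtains \<omega> where "cmod \<omega> = 1" "\<And>v. cplx (A *v v) = \<omega> * cplx v"
proof -
  let ?a = "A $ 1 $ 1" and ?b = "A $ 1 $ 2" and ?c = "A $ 2 $ 1" and ?d = "A $ 2 $ 2"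
  have o: "transpose A ** A = mat 1" and o2: "A ** transpose A = mat 1" and d: "?a * ?d - ?b * ?c = 1"
    using assms by (auto simp: rotation_matrix_def orthogonal_matrix_def det_2)
  have 1: "?a * ?a + ?c * ?c = 1" "?b * ?b + ?d * ?d = 1"
    using arg_cong[OF o, of "\<lambda>M. M $ 1 $ 1"] arg_cong[OF o, of "\<lambda>M. M $ 2 $ 2"]
    by (auto simp: matrix_matrix_mult_def transpose_def mat_def sum_2)
  have "(?a - ?d)\<^sup>2 + (?b + ?c)\<^sup>2 = (?a * ?a + ?c * ?c) + (?b * ?b + ?d * ?d) - 2 * (?a * ?d - ?b * ?c)"
    by (simp add: power2_eq_square algebra_simps)
  also have "\<dots> = 0" using 1 d by simp
  finally have eq: "?a = ?d" "?b = - ?c"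
    unfolding sum_power2_eq_zero_iff by auto
  show thesis
  proof (rule that[of "Complex ?a ?c"])
    show "cmod (Complex ?a ?c) = 1" using 1 by (simp add: cmod_def power2_eq_square)
    show "cplx (A *v v) = Complex ?a ?c * cplx v" for v
      using eq by (simp add: complex_eq_iff matrix_vector_mult_def sum_2)
  qed
qed

lemma celem_smooth_cplx: "celem_smooth cplx"
  by (auto simp: celem_smooth_def intro: elem_smooth.coord)

lemma partial_deriv_Re_holomorphic:
  assumes g: "(g has_field_derivative g') (at (\<omega> * (cplx x - c)))"
  shows "((\<lambda>y. Re (g (\<omega> * (cplx y - c)))) has_derivative (\<lambda>v. Re (g' * (\<omega> * cplx v)))) (at x)"
proof -
  have Z: "((\<lambda>y. \<omega> * (cplx y - c)) has_derivative (\<lambda>v. \<omega> * cplx v)) (at x)"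
    by (auto intro!: derivative_eq_intros bounded_linear_imp_has_derivative bounded_linear_cplx)
  have "((\<lambda>y. g (\<omega> * (cplx y - c))) has_derivative (\<lambda>v. g' * (\<omega> * cplx v))) (at x)"
    using has_derivative_compose[OF Z g[unfolded has_field_derivative_def]] by simp
  then show ?thesis
    by (rule bounded_linear.has_derivative[OF bounded_linear_Re])
qed

text \<open>
  Leibniz rule for \<open>\<Delta>(\<psi> Re (g \<circ> Z))\<close> with \<open>Z\<close> a rotated coordinate; the term
  with \<open>\<psi>\<close> undifferentiated drops out because \<open>Re (g \<circ> Z)\<close> is harmonic. All hypotheses are local,
  so \<open>\<phi>\<close> may differ from the product elsewhere.
\<close>

lemma laplacian_cutoff_holomorphic:
  fixes \<psi> :: "real^2 \<Rightarrow> real"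
  assumes \<psi>: "elem_smooth \<psi>" and U: "open U" "x \<in> U"
    and g: "\<And>y. y \<in> U \<Longrightarrow> (g has_field_derivative g1 (\<omega> * (cplx y - c))) (at (\<omega> * (cplx y - c)))"
    and g1: "\<And>y. y \<in> U \<Longrightarrow> (g1 has_field_derivative g2 (\<omega> * (cplx y - c))) (at (\<omega> * (cplx y - c)))"
    and \<phi>: "\<And>y. y \<in> U \<Longrightarrow> \<phi> y = \<psi> y * Re (g (\<omega> * (cplx y - c)))"
  shows "laplacian \<phi> x = laplacian \<psi> x * Re (g (\<omega> * (cplx x - c)))
     + 2 * (\<Sum>i\<in>UNIV. partial_deriv i \<psi> x * Re (g1 (\<omega> * (cplx x - c)) * (\<omega> * cplx (axis i 1))))"
proof -
  let ?Z = "\<lambda>y. \<omega> * (cplx y - c)"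
  let ?e = "\<lambda>i. \<omega> * cplx (axis i 1)"
  have d\<psi>: "(h has_derivative frechet_derivative h (at y)) (at y)" if "elem_smooth h" for h :: "real^2 \<Rightarrow> real" and y
    by (rule has_derivative_partial[OF elem_smooth_differentiable[OF that]])
  have p1: "partial_deriv i \<phi> y = partial_deriv i \<psi> y * Re (g (?Z y)) + \<psi> y * Re (g1 (?Z y) * ?e i)"
    if y: "y \<in> U" for i y
  proof -
    have "partial_deriv i \<phi> y = partial_deriv i (\<lambda>y. \<psi> y * Re (g (?Z y))) y"
      using U y \<phi> by (intro partial_deriv_local[of U]) auto
    also have "\<dots> = \<psi> y * Re (g1 (?Z y) * ?e i) + frechet_derivative \<psi> (at y) (axis i 1) * Re (g (?Z y))"
      by (rule partial_derivI[OF has_derivative_mult[OF d\<psi>[OF \<psi>] partial_deriv_Re_holomorphic[OF g[OF y]]]])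
    finally show ?thesis by (simp add: partial_deriv_def)
  qed
  have p2: "partial_deriv i (partial_deriv i \<phi>) x =
      partial_deriv i (partial_deriv i \<psi>) x * Re (g (?Z x))
      + 2 * (partial_deriv i \<psi> x * Re (g1 (?Z x) * ?e i)) + \<psi> x * Re (g2 (?Z x) * (?e i)\<^sup>2)" for i
  proof -
    have d1: "((\<lambda>y. g1 y * ?e i) has_field_derivative g2 (?Z x) * ?e i) (at (?Z x))"
      using g1[OF U(2)] by (auto intro!: derivative_eq_intros)
    have "partial_deriv i (partial_deriv i \<phi>) x
      = partial_deriv i (\<lambda>y. partial_deriv i \<psi> y * Re (g (?Z y)) + \<psi> y * Re (g1 (?Z y) * ?e i)) x"
      using U p1 by (intro partial_deriv_local[of U]) auto
    also have "\<dots> = (partial_deriv i \<psi> x * Re (g1 (?Z x) * ?e i)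
        + frechet_derivative (partial_deriv i \<psi>) (at x) (axis i 1) * Re (g (?Z x)))
        + (\<psi> x * Re (g2 (?Z x) * ?e i * ?e i) + frechet_derivative \<psi> (at x) (axis i 1) * Re (g1 (?Z x) * ?e i))"
      by (rule partial_derivI[OF has_derivative_add[OF
         has_derivative_mult[OF d\<psi>[OF elem_smooth_partial[OF \<psi>]] partial_deriv_Re_holomorphic[OF g[OF U(2)]]]
         has_derivative_mult[OF d\<psi>[OF \<psi>] partial_deriv_Re_holomorphic[OF d1]]]])
    finally show ?thesis
      by (simp add: partial_deriv_def[symmetric] power2_eq_square mult_ac)
  qed
  have "(\<Sum>i\<in>UNIV. g2 (?Z x) * (?e i)\<^sup>2) = 0"
  proof -
    have "cplx (axis 1 1) = 1" "cplx (axis 2 1) = \<i>"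
      by (auto simp: complex_eq_iff axis_def)
    then show ?thesis by (simp add: sum_2 power_mult_distrib)
  qed
  then have "(\<Sum>i\<in>UNIV. \<psi> x * Re (g2 (?Z x) * (?e i)\<^sup>2)) = 0"
    by (simp only: sum_distrib_left[symmetric] Re_sum[symmetric]) simp
  then show ?thesis
    unfolding laplacian_def p2 sum.distrib by (simp add: sum_distrib_left sum_distrib_right)
qed

section \<open>Harmonic homogeneous polynomials\<close>

lemma axis_1_2 [simp]: "axis (1::2) (1::real) $ 1 = 1" "axis (1::2) (1::real) $ 2 = 0"
  "axis (2::2) (1::real) $ 1 = 0" "axis (2::2) (1::real) $ 2 = 1"
  by (auto simp: axis_def)

lemma partial_deriv_monomial_sum:
  fixes c :: "nat \<Rightarrow> real" and p q :: "nat \<Rightarrow> nat"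
  shows "partial_deriv 1 (\<lambda>x::real^2. \<Sum>k\<le>m. c k * x $ 1 ^ p k * x $ 2 ^ q k)
      = (\<lambda>x. \<Sum>k\<le>m. (c k * p k) * x $ 1 ^ (p k - 1) * x $ 2 ^ q k)"
    and "partial_deriv 2 (\<lambda>x::real^2. \<Sum>k\<le>m. c k * x $ 1 ^ p k * x $ 2 ^ q k)
      = (\<lambda>x. \<Sum>k\<le>m. (c k * q k) * x $ 1 ^ p k * x $ 2 ^ (q k - 1))"
proof -
  have d: "((\<lambda>x::real^2. \<Sum>k\<le>m. c k * x $ 1 ^ p k * x $ 2 ^ q k) has_derivative
     (\<lambda>v. \<Sum>k\<le>m. c k * (p k * (x $ 1 ^ (p k - 1) * v $ 1)) * x $ 2 ^ q k
        + c k * x $ 1 ^ p k * (q k * (x $ 2 ^ (q k - 1) * v $ 2)))) (at x)" for x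
  proof (rule has_derivative_sum)
    fix k
    note v = bounded_linear_imp_has_derivative[OF bounded_linear_vec_nth]
    show "((\<lambda>x::real^2. c k * x $ 1 ^ p k * x $ 2 ^ q k) has_derivative
      (\<lambda>v. c k * (p k * (x $ 1 ^ (p k - 1) * v $ 1)) * x $ 2 ^ q k
        + c k * x $ 1 ^ p k * (q k * (x $ 2 ^ (q k - 1) * v $ 2)))) (at x)"
      by (rule has_derivative_eq_rhs[OF has_derivative_mult[OF has_derivative_mult[OF has_derivative_const
          has_derivative_power[OF v]] has_derivative_power[OF v]]]) (simp add: fun_eq_iff algebra_simps)
  qed
  show "partial_deriv 1 (\<lambda>x::real^2. \<Sum>k\<le>m. c k * x $ 1 ^ p k * x $ 2 ^ q k)
      = (\<lambda>x. \<Sum>k\<le>m. (c k * p k) * x $ 1 ^ (p k - 1) * x $ 2 ^ q k)"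
    by (rule ext, subst partial_derivI[OF d]) (auto intro!: sum.cong simp: mult_ac)
  show "partial_deriv 2 (\<lambda>x::real^2. \<Sum>k\<le>m. c k * x $ 1 ^ p k * x $ 2 ^ q k)
      = (\<lambda>x. \<Sum>k\<le>m. (c k * q k) * x $ 1 ^ p k * x $ 2 ^ (q k - 1))"
    by (rule ext, subst partial_derivI[OF d]) (auto intro!: sum.cong simp: mult_ac)
qed

text \<open>
  Restricting the Laplacian to the line \<open>x\<^sub>2 = 1\<close> gives a polynomial in \<open>x\<^sub>1\<close> that vanishes identically;
  the recursion equates its coefficients to \<open>0\<close>.
\<close>

lemma harmonic_coefficient_recursion:
  fixes c :: "nat \<Rightarrow> real" and H :: "real^2 \<Rightarrow> real"
  assumes H: "\<And>x. H x = (\<Sum>k\<le>m. c k * (x $ 1) ^ k * (x $ 2) ^ (m - k))"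
    and lap: "\<And>x. laplacian H x = 0" and j: "j + 2 \<le> m"
  shows "c (j + 2) * (real (j + 2) * real (j + 1)) + c j * (real (m - j) * real (m - j - 1)) = 0"
proof -
  define d where "d k = (if k \<le> m then c k else 0)" for k
  let ?r = "\<lambda>k. d (k + 2) * (real (k + 2) * real (k + 1)) + d k * (real (m - k) * real (m - k - 1))"
  have Heq: "H = (\<lambda>x. \<Sum>k\<le>m. c k * x $ 1 ^ k * x $ 2 ^ (m - k))"
    using H by auto
  have "(\<Sum>k\<le>m. ?r k * t ^ k) = 0" for t
  proof -
    have "laplacian H (vector [t, 1]) =
      (\<Sum>k\<le>m. c k * real k * real (k - 1) * t ^ (k - 1 - 1))
      + (\<Sum>k\<le>m. c k * real (m - k) * real (m - k - 1) * t ^ k)"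
      unfolding laplacian_def sum_2 Heq partial_deriv_monomial_sum by (simp add: vector_2(1,2))
    moreover have "(\<Sum>k\<le>m. c k * real k * real (k - 1) * t ^ (k - 1 - 1)) = (\<Sum>k\<le>m. d (k + 2) * (real (k + 2) * real (k + 1)) * t ^ k)"
    proof -
      have "(\<Sum>k\<le>m. c k * real k * real (k - 1) * t ^ (k - 1 - 1)) = (\<Sum>k\<le>m + 2. d k * real k * real (k - 1) * t ^ (k - 1 - 1))"
        by (rule sum.mono_neutral_cong_left) (auto simp: d_def)
      also have "\<dots> = (\<Sum>k\<le>Suc (Suc m). d k * real k * real (k - 1) * t ^ (k - 1 - 1))" by simp
      also have "\<dots> = (\<Sum>k\<le>m. d (k + 2) * (real (k + 2) * real (k + 1)) * t ^ k)"
        by (subst sum.atMost_Suc_shift, subst sum.atMost_Suc_shift) (simp add: algebra_simps)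
      finally show ?thesis .
    qed
    moreover have "(\<Sum>k\<le>m. c k * real (m - k) * real (m - k - 1) * t ^ k) = (\<Sum>k\<le>m. d k * (real (m - k) * real (m - k - 1)) * t ^ k)"
      by (rule sum.cong) (auto simp: d_def)
    ultimately show ?thesis
      using lap by (simp add: distrib_right sum.distrib)
  qed
  then have "\<forall>k\<le>m. ?r k = 0"
    using polyfun_eq_coeffs[of ?r m "\<lambda>_. 0"] by (simp only: mult_zero_left sum.neutral_const) simp
  moreover have "j \<le> m" using j by simp
  ultimately have "?r j = 0" by blast
  then show ?thesis using j by (simp add: d_def)
qed

lemma binomial_two_steps:
  "real (m choose (j + 2)) * (real (j + 2) * real (j + 1)) = real (m choose j) * (real (m - j) * real (m - j - 1))"
proof -
  have step: "Suc k * (m choose Suc k) = (m - k) * (m choose k)" for k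
    by (rule trans[OF binomial_absorption binomial_absorb_comp[symmetric]])
  have "(m choose (j + 2)) * ((j + 2) * (j + 1)) = (j + 1) * (Suc (Suc j) * (m choose Suc (Suc j)))"
    by (simp only: add_2_eq_Suc' mult_ac)
  also have "\<dots> = (Suc j * (m choose Suc j)) * (m - j - 1)"
    unfolding step[of "Suc j"] by (simp only: Suc_eq_plus1 diff_diff_left mult_ac)
  also have "\<dots> = (m choose j) * ((m - j) * (m - j - 1))"
    unfolding step[of j] by simp
  finally have "real ((m choose (j + 2)) * ((j + 2) * (j + 1))) = real ((m choose j) * ((m - j) * (m - j - 1)))"
    by (rule arg_cong)
  then show ?thesis
    by (simp only: of_nat_mult)
qed

text \<open>
  The recursion determines all coefficients from the two top ones, and the coefficients of
  \<open>Re (C z\<^sup>m)\<close>, read off from the binomial formula, satisfy the same recursion.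
\<close>

lemma harmonic_homogeneous_polynomial_eq:
  assumes "homogeneous_polynomial m H" "harmonic H"
  obtains C where "\<And>x. H x = Re (C * cplx x ^ m)"
proof -
  obtain c where c: "\<And>x. H x = (\<Sum>k\<le>m. c k * (x $ 1) ^ k * (x $ 2) ^ (m - k))"
    using assms by (auto simp: homogeneous_polynomial_def)
  have lap: "\<And>x. laplacian H x = 0" using assms by (simp add: harmonic_def)
  \<comment> \<open>matches the coefficients of \<open>x\<^sub>1\<^sup>m\<close> and \<open>x\<^sub>1\<^bsup>m-1\<^esup> x\<^sub>2\<close>; for \<open>m = 0\<close> the imaginary part is \<open>0\<close> by division by zero\<close>
  define C where "C = Complex (c m) (- c (m - 1) / m)"
  have cf: "c (m - i) = Re (C * (of_nat (m choose (m - i)) * \<i> ^ i))" if "i \<le> m" for i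
    using that
  proof (induction i rule: less_induct)
    case (less i)
    have "i = 0 \<or> i = 1 \<or> (\<exists>j. i = j + 2)" by presburger
    then consider "i = 0" | "i = 1" | j where "i = j + 2"
      by blast
    then show ?case
    proof cases
      case 1 then show ?thesis by (simp add: C_def)
    next
      case 2
      have "m choose (m - Suc 0) = m" using less.prems 2 binomial_symmetric[of 1 m] by simp
      then show ?thesis using 2 less.prems by (simp add: C_def)
    next
      case 3
      let ?k = "m - i"
      have k: "?k + 2 \<le> m" "?k + 2 = m - j" "m - ?k = j + 2" using less.prems 3 by auto
      have R: "Re (C * (of_nat n * w)) = Re (C * w) * real n" for n w
        by (simp add: algebra_simps)
      have ipow: "\<i> ^ i = - (\<i> ^ j)" using 3 by (simp add: power_add)
      have pos: "real (j + 2) * real (j + 1) \<noteq> 0" by simp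
      have jk: "j + 2 - 1 = j + 1" by simp
      have "c ?k * (real (j + 2) * real (j + 1)) = - (c (m - j) * (real (?k + 2) * real (?k + 1)))"
        using harmonic_coefficient_recursion[OF c lap k(1)] unfolding k(2) k(3) jk by linarith
      also have "\<dots> = - (Re (C * (of_nat (m choose (m - j)) * \<i> ^ j)) * (real (?k + 2) * real (?k + 1)))"
        using less.IH[of j] 3 less.prems by simp
      also have "\<dots> = Re (C * \<i> ^ i) * (real (m choose (?k + 2)) * (real (?k + 2) * real (?k + 1)))"
        unfolding k(2)[symmetric] ipow R mult_minus_right uminus_complex.sel by (simp only: mult_ac mult_minus_left mult_minus_right)
      also have "\<dots> = Re (C * \<i> ^ i) * (real (m choose ?k) * (real (j + 2) * real (j + 1)))"
        unfolding binomial_two_steps k(3) by (simp only: jk)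
      also have "\<dots> = Re (C * (of_nat (m choose ?k) * \<i> ^ i)) * (real (j + 2) * real (j + 1))"
        unfolding R by (simp only: mult_ac)
      finally show ?thesis by (simp only: mult_right_cancel[OF pos])
    qed
  qed
  have "H x = Re (C * cplx x ^ m)" for x
  proof -
    have z: "cplx x = of_real (x $ 1) + \<i> * of_real (x $ 2)"
      by (simp add: complex_eq_iff)
    have "H x = (\<Sum>k\<le>m. Re (C * (of_nat (m choose k) * \<i> ^ (m - k))) * (x $ 1) ^ k * (x $ 2) ^ (m - k))"
    proof (unfold c, intro sum.cong refl)
      fix k assume "k \<in> {..m}"
      then have "c k = Re (C * (of_nat (m choose k) * \<i> ^ (m - k)))"
        using cf[of "m - k"] by simp
      then show "c k * (x $ 1) ^ k * (x $ 2) ^ (m - k)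
        = Re (C * (of_nat (m choose k) * \<i> ^ (m - k))) * (x $ 1) ^ k * (x $ 2) ^ (m - k)"
        by simp
    qed
    also have "\<dots> = (\<Sum>k\<le>m. Re (C * (of_nat (m choose k) * of_real (x $ 1) ^ k * (\<i> * of_real (x $ 2)) ^ (m - k))))"
    proof (intro sum.cong refl)
      fix k
      have "C * (of_nat (m choose k) * of_real (x $ 1) ^ k * (\<i> * of_real (x $ 2)) ^ (m - k))
        = (C * (of_nat (m choose k) * \<i> ^ (m - k))) * of_real ((x $ 1) ^ k * (x $ 2) ^ (m - k))"
        by (simp add: power_mult_distrib mult_ac)
      moreover have R: "Re (w * of_real r) = Re w * r" for w r by simp
      ultimately show "Re (C * (of_nat (m choose k) * \<i> ^ (m - k))) * (x $ 1) ^ k * (x $ 2) ^ (m - k)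
         = Re (C * (of_nat (m choose k) * of_real (x $ 1) ^ k * (\<i> * of_real (x $ 2)) ^ (m - k)))"
        unfolding mult.assoc[of _ "(x $ 1) ^ k"] by (simp only: R)
    qed
    also have "\<dots> = Re (C * cplx x ^ m)"
      by (simp only: z binomial_ring sum_distrib_left Re_sum)
    finally show ?thesis .
  qed
  then show thesis by (rule that)
qed

section \<open>Integration over the plane\<close>

lemma measurable_vector2: "(\<lambda>z::real\<times>real. vector [fst z, snd z] :: real^2) \<in> borel_measurable borel"
proof (rule borel_measurable_continuous_onI)
  have *: "(\<lambda>z::real\<times>real. vector [fst z, snd z] :: real^2) = (\<lambda>z. \<chi> i. if i = 1 then fst z else snd z)"
    by (auto simp: vec_eq_iff forall_2 vector_2)
  show "continuous_on UNIV (\<lambda>z::real\<times>real. vector [fst z, snd z] :: real^2)"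
    unfolding *
  proof (rule continuous_on_vec_lambda)
    show "continuous_on UNIV (\<lambda>z::real\<times>real. if i = 1 then fst z else snd z)" for i :: 2
      by (cases "i = 1") (auto intro!: continuous_intros)
  qed
qed

lemma lborel_real2_eq_distr:
  "lborel = distr (lborel :: (real \<times> real) measure) borel (\<lambda>z. vector [fst z, snd z] :: real^2)"
proof (rule lborel_eqI)
  note meas = measurable_vector2
  fix l u :: "real^2"
  assume le: "\<And>b. b \<in> Basis \<Longrightarrow> l \<bullet> b \<le> u \<bullet> b"
  have le': "l $ i \<le> u $ i" for i
    using le[of "axis i 1"] by (simp add: inner_axis axis_in_Basis_iff)
  have "(\<lambda>z. vector [fst z, snd z] :: real^2) -` box l u = box (l $ 1, l $ 2) (u $ 1, u $ 2)"
    by (auto simp: mem_box_cart mem_box forall_2 vector_2 Basis_prod_def ball_Un)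
  then have "emeasure (distr (lborel :: (real \<times> real) measure) borel (\<lambda>z. vector [fst z, snd z] :: real^2)) (box l u)
     = emeasure lborel (box (l $ 1, l $ 2) (u $ 1, u $ 2))"
    using meas by (subst emeasure_distr) auto
  also have "\<dots> = ennreal ((u $ 1 - l $ 1) * (u $ 2 - l $ 2))"
    using le' by (subst emeasure_lborel_box)
      (auto simp: Basis_prod_def sum.union_disjoint prod.union_disjoint image_iff prod.insert ball_Un)
  also have "(u $ 1 - l $ 1) * (u $ 2 - l $ 2) = (\<Prod>b\<in>Basis. (u - l) \<bullet> b)"
    by (simp add: Basis_vec_def UNIV_2 axis_eq_axis inner_axis)
  finally show "emeasure (distr (lborel :: (real \<times> real) measure) borel (\<lambda>z. vector [fst z, snd z] :: real^2)) (box l u)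
     = (\<Prod>b\<in>Basis. (u - l) \<bullet> b)" .
qed simp

lemma integral_real2_eq_pair:
  fixes g :: "real^2 \<Rightarrow> 'b::{banach, second_countable_topology}"
  assumes "g \<in> borel_measurable borel"
  shows "(\<integral>x. g x \<partial>lborel) = (\<integral>z. g (vector [fst z, snd z]) \<partial>lborel)"
  by (subst lborel_real2_eq_distr, subst integral_distr) (use assms measurable_vector2 in auto)

text \<open>
  Orthogonal maps preserve the measure of boxes, which determines Lebesgue measure.
\<close>

lemma lborel_eq_distr_orthogonal:
  fixes f :: "real^'n::{finite,wellorder} \<Rightarrow> real^'n::_"
  assumes f: "orthogonal_transformation f"
  shows "lborel = distr lborel borel f"
proof (rule lborel_eqI)
  have meas: "f \<in> borel_measurable borel"
    using f by (intro borel_measurable_continuous_onI linear_continuous_on)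
      (simp add: linear_conv_bounded_linear[symmetric] orthogonal_transformation_linear)
  fix l u :: "real^'n::{finite,wellorder}"
  assume le: "\<And>b. b \<in> Basis \<Longrightarrow> l \<bullet> b \<le> u \<bullet> b"
  have inv: "orthogonal_transformation (inv f)"
    using f by (rule orthogonal_transformation_inv)
  have img: "f -` box l u = inv f ` box l u"
    using orthogonal_transformation_bij[OF f] by (simp add: bij_vimage_eq_inv_image)
  have m: "inv f ` box l u \<in> lmeasurable" "measure lebesgue (inv f ` box l u) = measure lebesgue (box l u)"
    using measurable_orthogonal_image[OF inv] measure_orthogonal_image[OF inv] by auto
  have meas2: "f -` box l u \<in> sets borel"
    using measurable_sets[OF meas, of "box l u"] by simp
  have "emeasure (distr lborel borel f) (box l u) = emeasure lborel (f -` box l u)"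
    using meas by (subst emeasure_distr) auto
  also have "\<dots> = emeasure lebesgue (inv f ` box l u)"
    using meas2 by (simp add: img[symmetric])
  also have "\<dots> = emeasure lebesgue (box l u)"
    using m by (simp add: emeasure_eq_measure2)
  also have "\<dots> = (\<Prod>b\<in>Basis. (u - l) \<bullet> b)"
    using le by simp
  finally show "emeasure (distr lborel borel f) (box l u) = (\<Prod>b\<in>Basis. (u - l) \<bullet> b)" .
qed simp

lemma integral_similarity:
  fixes g :: "real^2 \<Rightarrow> real"
  assumes g: "g \<in> borel_measurable borel" and B: "orthogonal_matrix B" and \<epsilon>: "0 < \<epsilon>"
  shows "(\<integral>x. g x \<partial>lborel) = \<epsilon>\<^sup>2 * (\<integral>y. g (x0 + \<epsilon> *\<^sub>R (B *v y)) \<partial>lborel)"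
proof -
  have ot: "orthogonal_transformation ((*v) B)"
    using B by (simp add: orthogonal_transformation_matrix matrix_vector_mul_linear)
  have m1: "(\<lambda>x. x0 + \<epsilon> *\<^sub>R x) \<in> borel_measurable borel" by simp
  have m2: "(*v) B \<in> borel_measurable borel"
    by (intro borel_measurable_continuous_onI linear_continuous_on matrix_vector_mul_bounded_linear)
  have "(\<integral>x. g x \<partial>lborel) = (\<integral>x. \<epsilon>\<^sup>2 *\<^sub>R g x \<partial>distr lborel borel (\<lambda>x. x0 + \<epsilon> *\<^sub>R x))"
    using \<epsilon> g by (subst lborel_affine[of \<epsilon> x0]) (auto simp: integral_density)
  also have "\<dots> = (\<integral>x. \<epsilon>\<^sup>2 * g (x0 + \<epsilon> *\<^sub>R x) \<partial>lborel)"
    using g by (subst integral_distr) auto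
  also have "\<dots> = (\<integral>x. \<epsilon>\<^sup>2 * g (x0 + \<epsilon> *\<^sub>R x) \<partial>distr lborel borel ((*v) B))"
    by (simp only: lborel_eq_distr_orthogonal[OF ot, symmetric])
  also have "\<dots> = (\<integral>y. \<epsilon>\<^sup>2 * g (x0 + \<epsilon> *\<^sub>R (B *v y)) \<partial>lborel)"
    using g m2 by (subst integral_distr) auto
  finally show ?thesis by simp
qed

section \<open>Integrals along rays\<close>

lemma integrable_inverse_1_plus_sq: "integrable lborel (\<lambda>x::real. inverse (1 + x\<^sup>2))"
  using integrable_inverse_1_plus_square by (simp add: set_integrable_def einterval_eq_UNIV)

abbreviation plane :: "(real \<times> real) measure" where
  "plane \<equiv> lborel \<Otimes>\<^sub>M lborel"

text \<open>
  The majorant for all dominated convergence and Fubini arguments in the plane. It is the reason for the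
  exponent \<open>m + 4\<close> in the kernel: with \<open>m + 4\<close> the integrand decays like \<open>\<bar>y\<bar>\<^bsup>-4\<^esup>\<close>, which a product of two
  integrable functions of one variable dominates.
\<close>

lemma integrable_product_dominator:
  "integrable plane (\<lambda>z::real\<times>real. inverse (1 + (fst z)\<^sup>2) * inverse (1 + (snd z)\<^sup>2))"
proof (rule lborel_pair.Fubini_integrable)
  have "(\<integral>y. norm (inverse (1 + (fst (x, y))\<^sup>2) * inverse (1 + (snd (x, y))\<^sup>2)) \<partial>(lborel::real measure))
     = inverse (1 + x\<^sup>2) * (\<integral>y. inverse (1 + y\<^sup>2) \<partial>lborel)" for x :: real
    by (simp add: abs_mult)
  then show "integrable lborel (\<lambda>x. \<integral>y. norm (inverse (1 + (fst (x, y))\<^sup>2) * inverse (1 + (snd (x, y))\<^sup>2)) \<partial>(lborel::real measure))"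
    using integrable_inverse_1_plus_sq by (simp only: integrable_mult_left)
  show "AE x in lborel. integrable lborel (\<lambda>y. inverse (1 + (fst (x::real, y::real))\<^sup>2) * inverse (1 + (snd (x, y))\<^sup>2))"
    by (simp only: fst_conv snd_conv) (rule AE_I2, rule Bochner_Integration.integrable_mult_right, rule integrable_inverse_1_plus_sq)
qed measurable

lemma integral_half_line_right:
  fixes f F :: "real \<Rightarrow> complex"
  assumes F: "\<And>x. b < x \<Longrightarrow> (F has_vector_derivative f x) (at x)"
    and f: "\<And>x. b < x \<Longrightarrow> isCont f x" "set_integrable lborel {b<..} f"
    and lim: "(F \<longlongrightarrow> A) (at_right b)" "(F \<longlongrightarrow> B) at_top"
  shows "(LINT x:{b<..}|lborel. f x) = B - A"
proof -
  have "(LBINT x=ereal b..\<infinity>. f x) = B - A"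
    by (rule interval_integral_FTC_integrable[where F = F])
      (use F f lim in \<open>auto simp: ereal_tendsto_simps\<close>)
  then show ?thesis
    by (simp add: interval_lebesgue_integral_def)
qed

lemma integral_half_line_left:
  fixes f F :: "real \<Rightarrow> complex"
  assumes F: "\<And>x. x < a \<Longrightarrow> (F has_vector_derivative f x) (at x)"
    and f: "\<And>x. x < a \<Longrightarrow> isCont f x" "set_integrable lborel {..<a} f"
    and lim: "(F \<longlongrightarrow> A) at_bot" "(F \<longlongrightarrow> B) (at_left a)"
  shows "(LINT x:{..<a}|lborel. f x) = B - A"
proof -
  have "(LBINT x=-\<infinity>..ereal a. f x) = B - A"
    by (rule interval_integral_FTC_integrable[where F = F])
      (use F f lim in \<open>auto simp: ereal_tendsto_simps\<close>)
  then show ?thesis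
    by (simp add: interval_lebesgue_integral_def)
qed

lemma norm_ge_of_Im_nonzero:
  assumes "Im q \<noteq> 0"
  obtains c where "0 < c" "\<And>s. 0 < s \<Longrightarrow> c * (1 + s) \<le> cmod (of_real s + q)"
proof
  let ?K = "(1 + cmod q) / \<bar>Im q\<bar> + 1"
  have K: "?K > 0" using assms by (intro add_nonneg_pos) auto
  then show "0 < inverse ?K" by simp
  fix s :: real assume s: "0 < s"
  have 1: "\<bar>Im q\<bar> \<le> cmod (of_real s + q)"
    using abs_Im_le_cmod[of "of_real s + q"] by simp
  have "1 + s \<le> 1 + cmod q + cmod (of_real s + q)"
    using norm_triangle_ineq4[of "of_real s + q" q] s by simp
  also have "1 + cmod q = (1 + cmod q) / \<bar>Im q\<bar> * \<bar>Im q\<bar>" using assms by simp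
  also have "\<dots> \<le> (1 + cmod q) / \<bar>Im q\<bar> * cmod (of_real s + q)"
    by (rule mult_left_mono[OF 1]) simp
  finally have "1 + s \<le> ?K * cmod (of_real s + q)" by (simp add: distrib_right)
  then show "inverse ?K * (1 + s) \<le> cmod (of_real s + q)"
    using K by (simp add: field_simps)
qed

lemma tendsto_mobius_at_top:
  fixes q :: complex
  shows "((\<lambda>s. of_real s / (of_real s + q)) \<longlongrightarrow> 1) at_top"
proof -
  have inf: "filterlim (\<lambda>s. of_real s + q) at_infinity (at_top :: real filter)"
    by (rule tendsto_add_filterlim_at_infinity'[OF _ tendsto_const])
      (rule filterlim_of_real_at_infinity)
  have "((\<lambda>s. 1 - q / (of_real s + q)) \<longlongrightarrow> 1 - 0) (at_top :: real filter)"
    by (intro tendsto_intros tendsto_divide_0[OF tendsto_const inf])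
  moreover have "eventually (\<lambda>s. 1 - q / (of_real s + q) = of_real s / (of_real s + q)) (at_top :: real filter)"
    using eventually_gt_at_top[of "cmod q"]
  proof eventually_elim
    fix s assume s: "cmod q < s"
    have "of_real s + q \<noteq> 0"
    proof
      assume "of_real s + q = 0"
      then have "q = - of_real s" by (simp add: eq_neg_iff_add_eq_0 add.commute)
      then show False using s by simp
    qed
    then show "1 - q / (of_real s + q) = of_real s / (of_real s + q)"
      by (simp add: field_simps)
  qed
  ultimately show ?thesis by (auto intro: Lim_transform_eventually)
qed

text \<open>
  With \<open>v = s / (s + q)\<close> one has \<open>dv = q / (s + q)\<^sup>2 ds\<close> and \<open>1 - v = q / (s + q)\<close>, so the integrand is
  \<open>v\<^bsup>m+1\<^esup> (1 - v) dv / q\<^sup>2\<close>, and \<open>v\<close> runs from \<open>0\<close> to \<open>1\<close>. The value is the beta integral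
  \<open>B(m + 2, 2) / q\<^sup>2\<close>.
\<close>

lemma radial_integral:
  fixes q :: complex
  assumes q: "Im q \<noteq> 0"
  shows "set_integrable lborel {0<..} (\<lambda>s. of_real s ^ (m + 1) / (of_real s + q) ^ (m + 4))" (is ?int)
    and "(LINT s:{0<..}|lborel. of_real s ^ (m + 1) / (of_real s + q) ^ (m + 4)) = (1 / (of_nat (m + 2) * of_nat (m + 3))) / q\<^sup>2" (is "?I = _")
proof -
  let ?f = "\<lambda>s. of_real s ^ (m + 1) / (of_real s + q) ^ (m + 4)"
  define v where "v s = of_real s / (of_real s + q)" for s
  have nz: "of_real s + q \<noteq> 0" for s
    using q by (auto simp: complex_eq_iff)
  have q0: "q \<noteq> 0" using q by auto
  obtain c where c: "0 < c" "\<And>s. 0 < s \<Longrightarrow> c * (1 + s) \<le> cmod (of_real s + q)"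
    using norm_ge_of_Im_nonzero[OF q] by blast
  have cont: "continuous_on UNIV ?f"
    using nz by (intro continuous_intros) auto
  have bound: "norm (?f s) \<le> inverse (c ^ (m + 4)) * inverse (1 + s\<^sup>2)" if "0 < s" for s
  proof -
    have "norm (?f s) = s ^ (m + 1) / cmod (of_real s + q) ^ (m + 4)"
      using that by (simp add: norm_divide norm_power norm_mult)
    also have "\<dots> \<le> (1 + s) ^ (m + 1) / (c * (1 + s)) ^ (m + 4)"
      using that c by (intro frac_le power_mono) auto
    also have "\<dots> = inverse (c ^ (m + 4)) * inverse ((1 + s) ^ 3)"
    proof -
      have "(1 + s) ^ (m + 4) = (1 + s) ^ (m + 1) * (1 + s) ^ 3"
        by (simp only: power_add[symmetric] add.assoc) simp
      then show ?thesis using that c by (simp add: power_mult_distrib divide_simps)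
    qed
    also have "\<dots> \<le> inverse (c ^ (m + 4)) * inverse (1 + s\<^sup>2)"
    proof (rule mult_left_mono[OF le_imp_inverse_le])
      have "1 + s\<^sup>2 \<le> 1 + 3 * s + 3 * s\<^sup>2 + s ^ 3" using that by simp
      also have "\<dots> = (1 + s) ^ 3" by (simp add: power3_eq_cube power2_eq_square algebra_simps)
      finally show "1 + s\<^sup>2 \<le> (1 + s) ^ 3" .
    qed (use c in \<open>auto simp: add_pos_nonneg\<close>)
    finally show ?thesis .
  qed
  show int: ?int
    unfolding set_integrable_def
  proof (rule Bochner_Integration.integrable_bound)
    show "integrable lborel (\<lambda>s. inverse (c ^ (m + 4)) * inverse (1 + s\<^sup>2))"
      using integrable_inverse_1_plus_sq by simp
    show "(\<lambda>s. indicator {0<..} s *\<^sub>R ?f s) \<in> borel_measurable lborel"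
      using borel_measurable_continuous_onI[OF cont] by measurable
    show "AE s in lborel. norm (indicator {0<..} s *\<^sub>R ?f s) \<le> norm (inverse (c ^ (m + 4)) * inverse (1 + s\<^sup>2))"
    proof (rule AE_I2)
      fix s :: real
      show "norm (indicator {0<..} s *\<^sub>R ?f s) \<le> norm (inverse (c ^ (m + 4)) * inverse (1 + s\<^sup>2))"
      proof (cases "0 < s")
        case True
        have "norm (indicator {0<..} s *\<^sub>R ?f s) = norm (?f s)" using True by simp
        also note bound[OF True]
        finally show ?thesis by (rule order_trans) simp
      qed simp
    qed
  qed
  let ?F = "\<lambda>s. (v s ^ (m + 2) / of_nat (m + 2) - v s ^ (m + 3) / of_nat (m + 3)) / q\<^sup>2"
  have dv: "(v has_vector_derivative q / (of_real s + q)\<^sup>2) (at s)" for s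
    unfolding v_def
    by (rule has_vector_derivative_real_field[of "\<lambda>z. z / (z + q)"])
      (use nz in \<open>auto intro!: derivative_eq_intros simp: power2_eq_square\<close>)
  have dF: "(?F has_vector_derivative ?f s) (at s)" for s
  proof -
    have 2: "m + 2 = Suc (m + 1)" and 3: "m + 3 = Suc (m + 2)" by simp_all
    have pow: "((\<lambda>z. z ^ Suc n / of_nat (Suc n)) has_field_derivative v s ^ n) (at (v s))" for n
      using DERIV_cdivide[OF DERIV_power_Suc[OF DERIV_ident, of n "v s" UNIV], of "of_nat (Suc n)"]
      by (simp del: power_Suc add: Suc_eq_plus1[symmetric] of_nat_Suc[symmetric] del: of_nat_Suc)
    have "((\<lambda>z. (z ^ (m + 2) / of_nat (m + 2) - z ^ (m + 3) / of_nat (m + 3)) / q\<^sup>2)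
        has_field_derivative (v s ^ (m + 1) - v s ^ (m + 2)) / q\<^sup>2) (at (v s))"
      by (rule DERIV_cdivide[OF DERIV_diff[OF
          pow[of "m + 1", folded 2] pow[of "m + 2", folded 3]]])
    then have "((\<lambda>z. (z ^ (m + 2) / of_nat (m + 2) - z ^ (m + 3) / of_nat (m + 3)) / q\<^sup>2) \<circ> v
        has_vector_derivative (q / (of_real s + q)\<^sup>2) * ((v s ^ (m + 1) - v s ^ (m + 2)) / q\<^sup>2)) (at s)"
      by (rule field_vector_diff_chain_at[OF dv])
    moreover have "(q / (of_real s + q)\<^sup>2) * ((v s ^ (m + 1) - v s ^ (m + 2)) / q\<^sup>2) = ?f s"
    proof -
      have "1 - v s = q / (of_real s + q)" using nz[of s] by (simp add: v_def field_simps)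
      then have v: "v s ^ (m + 1) - v s ^ (m + 2) = v s ^ (m + 1) * (q / (of_real s + q))"
        unfolding 2 power_Suc2 by (metis mult.right_neutral right_diff_distrib)
      have gen: "(q / X\<^sup>2) * (((P / Y) * (q / X)) / q\<^sup>2) = P / (Y * X ^ 3)" if "X \<noteq> 0" for X P Y
        using that q0 by (simp add: power2_eq_square power3_eq_cube)
      have "(of_real s + q) ^ (m + 4) = (of_real s + q) ^ (m + 1) * (of_real s + q) ^ 3"
        by (simp only: power_add[symmetric] add.assoc) simp
      then show ?thesis
        unfolding v by (simp only: v_def power_divide gen[OF nz])
    qed
    ultimately show ?thesis by (simp add: o_def)
  qed
  have "?I = (1 ^ (m + 2) / of_nat (m + 2) - 1 ^ (m + 3) / of_nat (m + 3)) / q\<^sup>2 - ?F 0"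
  proof (rule integral_half_line_right[OF dF _ int])
    show "isCont ?f x" for x
      using cont by (simp add: continuous_on_eq_continuous_at)
    have "isCont ?F 0"
      using dF by (rule has_vector_derivative_continuous)
    then show "(?F \<longlongrightarrow> ?F 0) (at_right 0)"
      by (simp add: isCont_def filterlim_at_split)
    show "(?F \<longlongrightarrow> (1 ^ (m + 2) / of_nat (m + 2) - 1 ^ (m + 3) / of_nat (m + 3)) / q\<^sup>2) at_top"
      using q0 unfolding v_def
      by (intro tendsto_intros tendsto_mobius_at_top) (simp_all only: of_nat_eq_0_iff power_eq_0_iff, simp_all)
  qed
  also have "?F 0 = 0" by (simp add: v_def)
  also have "(1 ^ (m + 2) / of_nat (m + 2) - 1 ^ (m + 3) / of_nat (m + 3)) / q\<^sup>2 - 0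
      = (1 / (of_nat (m + 2) * of_nat (m + 3))) / q\<^sup>2"
  proof -
    have "1 / x - 1 / (x + 1) = 1 / (x * (x + 1))" if "x \<noteq> 0" "x + 1 \<noteq> 0" for x :: complex
      using that by (simp add: field_simps)
    moreover have "(of_nat (m + 2) :: complex) \<noteq> 0"
      using of_nat_neq_0[of "m + 1"] by (simp only: add_2_eq_Suc' Suc_eq_plus1[symmetric] not_False_eq_True)
    moreover have "(of_nat (m + 2) :: complex) + 1 \<noteq> 0"
      using of_nat_neq_0[of "m + 2", where 'a = complex] by (simp only: of_nat_Suc add.commute[of 1] not_False_eq_True)
    ultimately have "1 / (of_nat (m + 2) :: complex) - 1 / (of_nat (m + 2) + 1) = 1 / (of_nat (m + 2) * (of_nat (m + 2) + 1))"
      by blast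
    moreover have "of_nat (m + 3) = (of_nat (m + 2) :: complex) + 1" by simp
    ultimately show ?thesis by (simp only: power_one diff_zero)
  qed
  finally show "?I = (1 / (of_nat (m + 2) * of_nat (m + 3))) / q\<^sup>2" .
qed

section \<open>Integrals over slopes\<close>

text \<open>
  The Cayley transform: \<open>cayley t = exp (- 2 i \<theta>)\<close> when \<open>t = tan \<theta>\<close>.
\<close>

definition cayley :: "real \<Rightarrow> complex" where
  "cayley t = (1 - \<i> * of_real t) / (1 + \<i> * of_real t)"

text \<open>
  As a function of \<open>cayley t\<close>, a primitive of the slope density below, up to the factor \<open>i / 4\<close>.
\<close>

definition slope_primitive :: "complex \<Rightarrow> nat \<Rightarrow> complex \<Rightarrow> complex" where
  "slope_primitive c m q = c * q + cnj c * q ^ (m + 1) / of_nat (m + 1)"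

text \<open>
  What remains of the kernel integral after integration along the ray of slope \<open>t\<close>, up to a constant
  that does not depend on \<open>t\<close>.
\<close>

definition slope_density :: "complex \<Rightarrow> nat \<Rightarrow> real \<Rightarrow> complex" where
  "slope_density c m t = of_real (Re (c * (1 + \<i> * of_real t) ^ m)) / (1 + \<i> * of_real t) ^ (m + 2)"

lemma one_plus_i_nz: "1 + \<i> * of_real t \<noteq> (0::complex)"
  by (simp add: complex_eq_iff)

lemma cmod_one_plus_i_sq: "(cmod (1 + \<i> * of_real t))\<^sup>2 = 1 + t\<^sup>2"
  by (simp add: cmod_power2)

lemma norm_cayley: "cmod (cayley t) = 1"
proof -
  have "cmod (1 - \<i> * of_real t) = cmod (cnj (1 + \<i> * of_real t))" by simp
  then show ?thesis
    using one_plus_i_nz[of t] by (simp only: cayley_def norm_divide complex_mod_cnj) simp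
qed

lemma cayley_eq: "cayley t = 2 / (1 + \<i> * of_real t) - 1"
  using one_plus_i_nz[of t] by (simp add: cayley_def field_simps)

lemma cayley_inj: "cayley s = cayley t \<Longrightarrow> s = t"
  using one_plus_i_nz[of s] one_plus_i_nz[of t] by (simp add: cayley_eq frac_eq_eq)

lemma cayley_has_derivative:
  "(cayley has_vector_derivative - 2 * \<i> / (1 + \<i> * of_real t)\<^sup>2) (at t)"
proof -
  have "((\<lambda>z. 2 / (1 + \<i> * z) - 1) has_field_derivative - 2 * \<i> / (1 + \<i> * of_real t)\<^sup>2) (at (of_real t))"
    using one_plus_i_nz[of t] by (auto intro!: derivative_eq_intros simp: power2_eq_square)
  from has_vector_derivative_real_field[OF this] show ?thesis
    by (simp add: cayley_eq[abs_def])
qed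

text \<open>
  Writing \<open>w = 1 + i t\<close> and \<open>q = cnj w / w\<close>, the density is \<open>(c + cnj c q\<^sup>m) / (2 w\<^sup>2)\<close>, and
  \<open>q' = - 2 i / w\<^sup>2\<close>.
\<close>

lemma slope_primitive_has_derivative:
  "((\<lambda>t. (\<i> / 4) * slope_primitive c m (cayley t)) has_vector_derivative slope_density c m t) (at t)"
proof -
  let ?w = "1 + \<i> * of_real t"
  note nz = one_plus_i_nz[of t]
  have pow: "((\<lambda>z. z ^ (m + 1) / of_nat (m + 1)) has_field_derivative cayley t ^ m) (at (cayley t))"
    using DERIV_cdivide[OF DERIV_power_Suc[OF DERIV_ident, of m "cayley t" UNIV], of "of_nat (Suc m)"]
    by (simp del: power_Suc add: Suc_eq_plus1[symmetric] of_nat_Suc[symmetric] del: of_nat_Suc)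
  have "((\<lambda>q. (\<i> / 4) * slope_primitive c m q) has_field_derivative
      (\<i> / 4) * (c * 1 + cnj c * cayley t ^ m)) (at (cayley t))"
    unfolding slope_primitive_def times_divide_eq_right[symmetric]
    by (intro DERIV_cmult DERIV_add pow) (simp_all add: DERIV_ident)
  then have "((\<lambda>q. (\<i> / 4) * slope_primitive c m q) \<circ> cayley has_vector_derivative
      (- 2 * \<i> / ?w\<^sup>2) * ((\<i> / 4) * (c * 1 + cnj c * cayley t ^ m))) (at t)"
    by (rule field_vector_diff_chain_at[OF cayley_has_derivative])
  moreover have "(- 2 * \<i> / ?w\<^sup>2) * ((\<i> / 4) * (c * 1 + cnj c * cayley t ^ m)) = slope_density c m t"
  proof -
    have re: "of_real (Re (c * ?w ^ m)) = (c * ?w ^ m + cnj c * cnj ?w ^ m) / 2"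
      using complex_add_cnj[of "c * ?w ^ m"] by simp
    have "cayley t = cnj ?w / ?w" by (simp add: cayley_def)
    then have mp: "cayley t ^ m = cnj ?w ^ m / ?w ^ m" by (simp only: power_divide)
    have gen: "(- 2 * \<i> / W) * ((\<i> / 4) * (c * 1 + cnj c * (P / Q)))
       = ((c * Q + cnj c * P) / 2) / (Q * W)" if "W \<noteq> 0" "Q \<noteq> 0" for W P Q
      using that by (simp add: field_simps)
    have "(- 2 * \<i> / ?w\<^sup>2) * ((\<i> / 4) * (c * 1 + cnj c * cayley t ^ m))
       = ((c * ?w ^ m + cnj c * cnj ?w ^ m) / 2) / (?w ^ m * ?w\<^sup>2)"
      unfolding mp by (rule gen) (use nz in simp_all)
    also have "\<dots> = slope_density c m t"
      unfolding slope_density_def re power_add ..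
    finally show ?thesis .
  qed
  ultimately show ?thesis by (simp add: o_def)
qed

lemma slope_density_continuous: "continuous_on UNIV (slope_density c m)"
  unfolding slope_density_def using one_plus_i_nz by (intro continuous_intros) auto

lemma slope_density_integrable: "integrable lborel (slope_density c m)"
proof (rule Bochner_Integration.integrable_bound)
  show "integrable lborel (\<lambda>t::real. cmod c * inverse (1 + t\<^sup>2))"
    by (rule Bochner_Integration.integrable_mult_right, rule integrable_inverse_1_plus_sq)
  show "slope_density c m \<in> borel_measurable lborel"
    using borel_measurable_continuous_onI[OF slope_density_continuous] by simp
  show "AE t in lborel. norm (slope_density c m t) \<le> norm (cmod c * inverse (1 + t\<^sup>2))"
  proof (rule AE_I2)
    fix t :: real
    let ?w = "1 + \<i> * of_real t"
    have w: "0 < cmod ?w" using one_plus_i_nz[of t] by simp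
    have "norm (slope_density c m t) = \<bar>Re (c * ?w ^ m)\<bar> / cmod ?w ^ (m + 2)"
      unfolding slope_density_def norm_divide norm_power norm_of_real ..
    also have "\<dots> \<le> cmod (c * ?w ^ m) / cmod ?w ^ (m + 2)"
      by (rule divide_right_mono[OF abs_Re_le_cmod]) simp
    also have "\<dots> = cmod c * inverse ((cmod ?w)\<^sup>2)"
      unfolding norm_mult norm_power power_add using w by (simp add: divide_inverse)
    also have "\<dots> \<le> norm (cmod c * inverse (1 + t\<^sup>2))"
      unfolding cmod_one_plus_i_sq by simp
    finally show "norm (slope_density c m t) \<le> norm (cmod c * inverse (1 + t\<^sup>2))" .
  qed
qed

lemma cayley_tendsto: "(cayley \<longlongrightarrow> - 1) at_top" "(cayley \<longlongrightarrow> - 1) at_bot"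
proof -
  have "filterlim (\<lambda>t. 1 + \<i> * of_real t) at_infinity F"
    if "filterlim (\<lambda>t. of_real t :: complex) at_infinity F" for F :: "real filter"
    by (intro tendsto_add_filterlim_at_infinity[OF tendsto_const] tendsto_mult_filterlim_at_infinity[OF tendsto_const] that) simp
  then have *: "(cayley \<longlongrightarrow> 0 - 1) F" if "filterlim (\<lambda>t. of_real t :: complex) at_infinity F" for F :: "real filter"
    unfolding cayley_eq[abs_def] using that
    by (intro tendsto_diff tendsto_const tendsto_divide_0[OF tendsto_const])
  have "filterlim (\<lambda>t. of_real t :: complex) at_infinity (at_top :: real filter)"
    by (rule filterlim_of_real_at_infinity)
  moreover have "filterlim (\<lambda>t. of_real t :: complex) at_infinity (at_bot :: real filter)"
  proof -
    have "filterlim (\<lambda>t::real. t) at_infinity at_bot"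
      by (simp add: filterlim_def at_bot_le_at_infinity)
    then show ?thesis by (simp add: filterlim_at_infinity_conv_norm_at_top)
  qed
  ultimately show "(cayley \<longlongrightarrow> - 1) at_top" "(cayley \<longlongrightarrow> - 1) at_bot"
    using *[of at_top] *[of at_bot] by simp_all
qed

text \<open>
  Both ends \<open>t \<rightarrow> \<plusminus>\<infinity>\<close> correspond to the same point \<open>- 1\<close> of the circle, the vertical direction, so
  the boundary terms at infinity cancel.
\<close>

lemma slope_integral:
  "(LINT t:{b<..}|lborel. slope_density c m t) + (LINT t:{..<a}|lborel. slope_density c m t)
    = (\<i> / 4) * (slope_primitive c m (cayley a) - slope_primitive c m (cayley b))"
proof -
  let ?G = "\<lambda>t. (\<i> / 4) * slope_primitive c m (cayley t)"
  have cont: "isCont (slope_density c m) t" for t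
    using slope_density_continuous by (simp add: continuous_on_eq_continuous_at)
  have int: "set_integrable lborel S (slope_density c m)" if "S \<in> sets borel" for S
    unfolding set_integrable_def using that slope_density_integrable by (intro integrable_mult_indicator) auto
  have "isCont ?G t" for t
    by (rule has_vector_derivative_continuous[OF slope_primitive_has_derivative])
  then have lim: "(?G \<longlongrightarrow> ?G t) (at_left t)" "(?G \<longlongrightarrow> ?G t) (at_right t)" for t
    by (simp_all add: isCont_def filterlim_at_split)
  have inf: "(?G \<longlongrightarrow> (\<i> / 4) * slope_primitive c m (- 1)) F" if "(cayley \<longlongrightarrow> - 1) F" for F
    unfolding slope_primitive_def using that of_nat_neq_0[of m, where 'a = complex]
    by (intro tendsto_intros) (auto simp del: of_nat_Suc)
  have "(LINT t:{b<..}|lborel. slope_density c m t) = (\<i> / 4) * slope_primitive c m (- 1) - ?G b"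
    by (rule integral_half_line_right[OF slope_primitive_has_derivative cont int lim(2) inf[OF cayley_tendsto(1)]]) simp
  moreover have "(LINT t:{..<a}|lborel. slope_density c m t) = ?G a - (\<i> / 4) * slope_primitive c m (- 1)"
    by (rule integral_half_line_left[OF slope_primitive_has_derivative cont int inf[OF cayley_tendsto(2)] lim(1)]) simp
  ultimately show ?thesis by (simp only: right_diff_distrib) simp
qed

text \<open>
  Dividing \<open>E p - E q = 0\<close> by \<open>p - q\<close> shows that \<open>cnj c (p\<^sup>m + \<dots> + q\<^sup>m) = - (m + 1) c\<close>. For \<open>m \<ge> 1\<close> the
  sum of \<open>m + 1\<close> unimodular terms then has modulus \<open>m + 1\<close>, so its two terms of lowest degree in \<open>p\<close>
  must be equal, that is \<open>p = q\<close>. For \<open>m = 0\<close> the equation says that \<open>c\<close> is imaginary,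
  which the last hypothesis excludes.
\<close>

lemma slope_primitive_inj:
  assumes eq: "slope_primitive c m p = slope_primitive c m q" and norm: "cmod p = 1" "cmod q = 1"
    and x: "Re (c * x ^ m) \<noteq> 0"
  shows "p = q"
proof (rule ccontr)
  assume pq: "p \<noteq> q"
  have c0: "c \<noteq> 0" using x by auto
  let ?S = "\<Sum>i<Suc m. p ^ i * q ^ (m - i)"
  have "p ^ (m + 1) - q ^ (m + 1) = (p - q) * ?S"
    using diff_power_eq_sum[of p m q] by simp
  moreover have "c * (p - q) + cnj c * (p ^ (m + 1) - q ^ (m + 1)) / of_nat (m + 1)
      = slope_primitive c m p - slope_primitive c m q"
    by (simp only: slope_primitive_def right_diff_distrib diff_divide_distrib) simp
  ultimately have "c * (p - q) + cnj c * ((p - q) * ?S) / of_nat (m + 1) = 0"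
    using eq by simp
  moreover have "c * (p - q) + cnj c * ((p - q) * ?S) / of_nat (m + 1)
      = (p - q) * (c + cnj c * ?S / of_nat (m + 1))"
    by (simp only: distrib_left times_divide_eq_right mult_ac)
  ultimately have "c + cnj c * ?S / of_nat (m + 1) = 0"
    using pq by (simp only: mult_eq_0_iff) simp
  then have "c = - (cnj c * ?S / of_nat (m + 1))"
    by (rule eq_neg_iff_add_eq_0[THEN iffD2])
  then have cS: "of_nat (m + 1) * c = - (cnj c * ?S)"
    using of_nat_neq_0[of m, where 'a = complex] by (metis Suc_eq_plus1 mult_minus_right nonzero_mult_div_cancel_left times_divide_eq_right)
  show False
  proof (cases m)
    case 0
    then have "c = - cnj c" using cS by simp
    then have "Re c = 0" by (simp add: complex_eq_iff)
    then show False using x 0 by simp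
  next
    case (Suc k)
    have "real (m + 1) * cmod c = cmod c * cmod ?S"
      using arg_cong[OF cS, of cmod] unfolding norm_minus_cancel norm_mult norm_of_nat complex_mod_cnj .
    then have "real (m + 1) = cmod ?S"
      using c0 by simp
    \<comment> \<open>the two terms with the lowest powers of \<open>p\<close> are split off\<close>
    also have "?S = (p + q) * q ^ k + (\<Sum>i<k. p ^ (i + 2) * q ^ (m - (i + 2)))"
      unfolding Suc by (subst sum.lessThan_Suc_shift, subst sum.lessThan_Suc_shift) (simp add: algebra_simps)
    also have "cmod \<dots> \<le> cmod ((p + q) * q ^ k) + (\<Sum>i<k. cmod (p ^ (i + 2) * q ^ (m - (i + 2))))"
      by (intro norm_triangle_mono order_refl norm_sum)
    also have "\<dots> = cmod (p + q) + real k"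
      by (simp only: norm_mult norm_power norm power_one mult_1_right sum_constant card_lessThan)
    finally have "2 \<le> cmod (p + q)" using Suc by simp
    then have "2\<^sup>2 \<le> (cmod (p + q))\<^sup>2" by (rule power_mono) simp
    moreover have "(cmod (p + q))\<^sup>2 + (cmod (p - q))\<^sup>2 = 2 * (cmod p)\<^sup>2 + 2 * (cmod q)\<^sup>2"
      by (simp only: cmod_power2 plus_complex.sel minus_complex.sel) (simp add: power2_eq_square algebra_simps)
    ultimately have "(cmod (p - q))\<^sup>2 \<le> 0"
      by (simp only: norm one_power2 power2_eq_square[of "2::real"])
    then show False using pq by simp
  qed
qed

section \<open>Integrals over a sector\<close>

text \<open>
  The pole \<open>- i e\<close> lies in the complementary cone, at a distance comparable to \<open>\<bar>z\<bar> + e\<close>: for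
  \<open>y \<ge> 0\<close> the shift by \<open>i e\<close> moves \<open>z\<close> away from \<open>0\<close>, and for \<open>y < 0\<close> the horizontal distance controls
  \<open>\<bar>z\<bar>\<close>.
\<close>

lemma cone_norm_bound:
  assumes y: "- L * \<bar>s\<bar> \<le> y" and L: "0 \<le> L" and e: "0 < e"
  shows "cmod (Complex s y) + e \<le> (2 * L + 4) * cmod (Complex s y + e * \<i>)"
proof -
  let ?z = "Complex s y" and ?n = "cmod (Complex s y + e * \<i>)"
  have s: "\<bar>s\<bar> \<le> ?n" using abs_Re_le_cmod[of "?z + e * \<i>"] by simp
  have tri: "e \<le> ?n + cmod ?z"
    using norm_triangle_ineq4[of "?z + e * \<i>" ?z] e by (simp add: norm_mult)
  show ?thesis
  proof (cases "0 \<le> y")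
    case True
    have "(cmod ?z)\<^sup>2 \<le> ?n\<^sup>2"
      using True e by (simp add: cmod_power2 power_mono)
    then have 1: "cmod ?z \<le> ?n" by (rule power2_le_imp_le) simp
    have "e \<le> ?n" using abs_Im_le_cmod[of "?z + e * \<i>"] True by simp
    with 1 have "cmod ?z + e \<le> 2 * ?n" by simp
    also have "\<dots> \<le> (2 * L + 4) * ?n" using L by (intro mult_right_mono) auto
    finally show ?thesis .
  next
    case False
    have "cmod ?z \<le> \<bar>s\<bar> + \<bar>y\<bar>" using cmod_le[of ?z] by simp
    also have "\<dots> \<le> (1 + L) * \<bar>s\<bar>" using False y by (simp add: algebra_simps)
    also have "\<dots> \<le> (1 + L) * ?n" using s L by (intro mult_left_mono) auto
    finally have "cmod ?z + e \<le> (2 * L + 3) * ?n" using tri by (simp add: algebra_simps)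
    also have "\<dots> \<le> (2 * L + 4) * ?n" by (intro mult_right_mono) auto
    finally show ?thesis .
  qed
qed

lemma cone_kernel_bound:
  assumes y: "- L * \<bar>s\<bar> \<le> y" and L: "0 \<le> L"
  shows "cmod (Complex s y) ^ m / cmod (Complex s y + \<i>) ^ (m + 4)
    \<le> (2 * L + 4) ^ (m + 4) * (inverse (1 + s\<^sup>2) * inverse (1 + y\<^sup>2))"
proof -
  let ?r = "cmod (Complex s y)" and ?n = "cmod (Complex s y + \<i>)" and ?K = "2 * L + 4"
  have b: "1 + ?r \<le> ?K * ?n" using cone_norm_bound[OF y L, of 1] by simp
  have K: "0 < ?K" using L by simp
  have n: "0 < ?n"
  proof (rule ccontr)
    assume "\<not> 0 < ?n"
    then have "?K * ?n = 0" by simp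
    then show False using b norm_ge_zero[of "Complex s y"] by linarith
  qed
  have "(1 + s\<^sup>2) * (1 + y\<^sup>2) \<le> (1 + ?r\<^sup>2) * (1 + ?r\<^sup>2)"
    by (intro mult_mono) (simp_all add: cmod_power2)
  also have "\<dots> \<le> (1 + ?r)\<^sup>2 * (1 + ?r)\<^sup>2"
    by (intro mult_mono) (simp_all add: power2_sum)
  also have "\<dots> = (1 + ?r) ^ 4" by (simp flip: power_add)
  finally have 4: "(1 + s\<^sup>2) * (1 + y\<^sup>2) \<le> (1 + ?r) ^ 4" .
  have "?r ^ m * ((1 + s\<^sup>2) * (1 + y\<^sup>2)) \<le> (1 + ?r) ^ m * (1 + ?r) ^ 4"
    by (intro mult_mono power_mono 4) simp_all
  also have "\<dots> = (1 + ?r) ^ (m + 4)" by (simp only: power_add)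
  also have "\<dots> \<le> (?K * ?n) ^ (m + 4)" by (rule power_mono[OF b]) simp
  also have "\<dots> = ?K ^ (m + 4) * ?n ^ (m + 4)" by (rule power_mult_distrib)
  finally have main: "?r ^ m * ((1 + s\<^sup>2) * (1 + y\<^sup>2)) \<le> ?K ^ (m + 4) * ?n ^ (m + 4)" .
  have P: "0 < ?n ^ (m + 4)" "0 < (1 + s\<^sup>2) * (1 + y\<^sup>2)"
    using n by (auto intro!: mult_pos_pos add_pos_nonneg)
  have "?r ^ m / ?n ^ (m + 4) \<le> ?K ^ (m + 4) / ((1 + s\<^sup>2) * (1 + y\<^sup>2))"
    using main P by (simp only: pos_divide_le_eq[OF P(1)] pos_le_divide_eq[OF P(2)] times_divide_eq_left)
  then show ?thesis by (simp add: divide_inverse)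
qed

text \<open>
  The sector is given in slope form: above the line of slope \<open>a\<close> on the left half plane, and above the
  line of slope \<open>b\<close> on the right one. Its opening angle may exceed \<open>\<pi>\<close>.
\<close>

definition sector_integrand :: "real \<Rightarrow> real \<Rightarrow> complex \<Rightarrow> nat \<Rightarrow> real \<times> real \<Rightarrow> complex" where
  "sector_integrand a b c m = (\<lambda>(s, y).
     if (if s < 0 then a else b) * s < y
     then of_real (Re (c * Complex s y ^ m)) / (Complex s y + \<i>) ^ (m + 4) else 0)"

lemma measurable_Complex [measurable]:
  "(\<lambda>z. Complex (fst z) (snd z)) \<in> borel_measurable plane"
proof -
  have "(\<lambda>z. Complex (fst z) (snd z)) = (\<lambda>z. of_real (fst z) + \<i> * of_real (snd z))"
    by (simp add: fun_eq_iff complex_eq_iff)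
  then show ?thesis by simp
qed

lemma sector_integrand_measurable [measurable]:
  "sector_integrand a b c m \<in> borel_measurable plane"
  unfolding sector_integrand_def case_prod_beta by measurable

lemma sector_integrand_integrable:
  "integrable plane (sector_integrand a b c m)"
proof (rule Bochner_Integration.integrable_bound)
  let ?L = "\<bar>a\<bar> + \<bar>b\<bar>"
  let ?g = "\<lambda>z::real\<times>real. (cmod c * (2 * ?L + 4) ^ (m + 4)) * (inverse (1 + (fst z)\<^sup>2) * inverse (1 + (snd z)\<^sup>2))"
  show "integrable plane ?g"
    by (rule Bochner_Integration.integrable_mult_right, rule integrable_product_dominator)
  show "sector_integrand a b c m \<in> borel_measurable plane"
    by (rule sector_integrand_measurable)
  have norm_ge_self_real: "?g z \<le> norm (?g z)" for z by simp
  have bnd: "norm (sector_integrand a b c m (s, y)) \<le> ?g (s, y)" for s y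
  proof (cases "(if s < 0 then a else b) * s < y")
    case True
    have "\<bar>(if s < 0 then a else b) * s\<bar> \<le> ?L * \<bar>s\<bar>"
      unfolding abs_mult by (intro mult_right_mono) auto
    then have y: "- ?L * \<bar>s\<bar> \<le> y" using True by linarith
    have "norm (sector_integrand a b c m (s, y)) = \<bar>Re (c * Complex s y ^ m)\<bar> / cmod (Complex s y + \<i>) ^ (m + 4)"
      using True by (simp only: sector_integrand_def split if_True norm_divide norm_power norm_of_real)
    also have "\<dots> \<le> cmod (c * Complex s y ^ m) / cmod (Complex s y + \<i>) ^ (m + 4)"
      by (rule divide_right_mono[OF abs_Re_le_cmod]) simp
    also have "\<dots> = cmod c * (cmod (Complex s y) ^ m / cmod (Complex s y + \<i>) ^ (m + 4))"
      by (simp only: norm_mult norm_power times_divide_eq_right)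
    also have "\<dots> \<le> cmod c * ((2 * ?L + 4) ^ (m + 4) * (inverse (1 + s\<^sup>2) * inverse (1 + y\<^sup>2)))"
      by (rule mult_left_mono[OF cone_kernel_bound[OF y]]) simp_all
    finally show ?thesis by (simp only: fst_conv snd_conv mult.assoc)
  next
    case False
    have "0 \<le> ?g (s, y)" by (intro mult_nonneg_nonneg) simp_all
    then show ?thesis using False by (simp only: sector_integrand_def split if_False norm_zero)
  qed
  have "norm (sector_integrand a b c m z) \<le> norm (?g z)" for z
    using bnd[of "fst z" "snd z"] norm_ge_self_real[of z] unfolding prod.collapse by (rule order_trans)
  then show "AE z in plane. norm (sector_integrand a b c m z) \<le> norm (?g z)"
    by (rule AE_I2)
qed

text \<open>
  The case \<open>\<sigma> = i\<close> is the ray pointing to the right, \<open>\<sigma> = - i\<close> its opposite after reflection in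
  the origin. The sign of \<open>\<sigma>\<close> disappears because only \<open>\<sigma>\<^sup>2\<close> enters.
\<close>

lemma sector_radial_integral:
  fixes c :: complex and t :: real
  defines "w \<equiv> 1 + \<i> * of_real t"
  assumes \<sigma>: "\<sigma> = \<i> \<or> \<sigma> = - \<i>"
  shows "(LINT s:{0<..}|lborel. of_real s * of_real (Re (c * (of_real s * w) ^ m)) / (of_real s * w + \<sigma>) ^ (m + 4))
     = - slope_density c m t / (of_nat (m + 2) * of_nat (m + 3))"
    and "set_integrable lborel {0<..} (\<lambda>s. of_real s * of_real (Re (c * (of_real s * w) ^ m)) / (of_real s * w + \<sigma>) ^ (m + 4))"
proof -
  have w: "w \<noteq> 0" unfolding w_def by (rule one_plus_i_nz)
  define q where "q = \<sigma> / w"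
  have "1 + t\<^sup>2 \<noteq> 0" using zero_le_power2[of t] by linarith
  then have q: "Im q \<noteq> 0"
    using \<sigma> w unfolding q_def w_def by (auto simp: Im_divide)
  have q2: "q\<^sup>2 = - (1 / w\<^sup>2)" using \<sigma> by (auto simp: q_def power_divide)
  let ?A = "of_real (Re (c * w ^ m)) / w ^ (m + 4)"
  have eq: "of_real s * of_real (Re (c * (of_real s * w) ^ m)) / (of_real s * w + \<sigma>) ^ (m + 4)
    = ?A * (of_real s ^ (m + 1) / (of_real s + q) ^ (m + 4))" for s :: real
  proof -
    have Rr: "Re (of_real r * z) = r * Re z" for r z by simp
    have "c * (of_real s * w) ^ m = of_real (s ^ m) * (c * w ^ m)" by (simp add: power_mult_distrib)
    then have "Re (c * (of_real s * w) ^ m) = s ^ m * Re (c * w ^ m)" by (simp only: Rr)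
    moreover have "of_real s * w + \<sigma> = w * (of_real s + q)" using w by (simp add: q_def field_simps)
    ultimately show ?thesis by (simp add: power_mult_distrib)
  qed
  show "set_integrable lborel {0<..} (\<lambda>s. of_real s * of_real (Re (c * (of_real s * w) ^ m)) / (of_real s * w + \<sigma>) ^ (m + 4))"
    unfolding eq by (rule set_integrable_mult_right) (rule radial_integral(1)[OF q])
  have "(LINT s:{0<..}|lborel. of_real s * of_real (Re (c * (of_real s * w) ^ m)) / (of_real s * w + \<sigma>) ^ (m + 4))
    = ?A * ((1 / (of_nat (m + 2) * of_nat (m + 3))) / q\<^sup>2)"
    unfolding eq set_integral_mult_right radial_integral(2)[OF q] ..
  also have "\<dots> = - (?A * w\<^sup>2) / (of_nat (m + 2) * of_nat (m + 3))"
    unfolding q2 by simp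
  also have "?A * w\<^sup>2 = slope_density c m t"
  proof -
    have "w ^ (m + 4) = w ^ (m + 2) * w\<^sup>2" by (simp only: power_add[symmetric] add.assoc) simp
    then show ?thesis using w by (simp add: slope_density_def w_def[symmetric])
  qed
  finally show "(LINT s:{0<..}|lborel. of_real s * of_real (Re (c * (of_real s * w) ^ m)) / (of_real s * w + \<sigma>) ^ (m + 4))
     = - slope_density c m t / (of_nat (m + 2) * of_nat (m + 3))" .
qed

text \<open>
  Substituting \<open>y = s t\<close> for fixed \<open>s\<close> (Jacobian \<open>\<bar>s\<bar>\<close>) and exchanging the order of integration reduces
  the integral over the sector to integrals along rays. A ray of slope \<open>t\<close> lies in the sector on the
  right if \<open>t > b\<close> and on the left if \<open>t < a\<close>, and both cases contribute the same density since
  \<open>(-1)\<^sup>m (-1)\<^bsup>m+4\<^esup> = 1\<close>.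
\<close>

lemma sector_integral:
  "(\<integral>z. sector_integrand a b c m z \<partial>plane)
    = - (\<i> / 4) * (slope_primitive c m (cayley a) - slope_primitive c m (cayley b)) / (of_nat (m + 2) * of_nat (m + 3))"
proof -
  let ?F = "sector_integrand a b c m"
  let ?N = "of_nat (m + 2) * of_nat (m + 3) :: complex"
  define G where "G = (\<lambda>s t. \<bar>s\<bar> *\<^sub>R ?F (s, s * t))"
  note F = sector_integrand_integrable[of a b c m]
  have ne0: "AE s in lborel. s \<noteq> (0::real)" by (rule AE_lborel_singleton)
  have inner: "(\<integral>y. ?F (s, y) \<partial>lborel) = (\<integral>t. G s t \<partial>lborel)"
    and inner_norm: "(\<integral>y. norm (?F (s, y)) \<partial>lborel) = (\<integral>t. norm (G s t) \<partial>lborel)" if "s \<noteq> 0" for s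
    using lborel_integral_real_affine[OF that, of "\<lambda>y. ?F (s, y)" 0]
      lborel_integral_real_affine[OF that, of "\<lambda>y. norm (?F (s, y))" 0]
    by (simp_all add: G_def)
  have G_int: "integrable plane (\<lambda>(s, t). G s t)"
  proof (rule lborel_pair.Fubini_integrable)
    show "(\<lambda>(s, t). G s t) \<in> borel_measurable plane"
      unfolding G_def case_prod_beta by measurable
    have "integrable lborel (\<lambda>s. \<integral>y. norm (?F (s, y)) \<partial>lborel)"
      by (rule lborel_pair.integrable_fst'[OF integrable_norm[OF F]])
    moreover have "AE s in lborel. (\<integral>y. norm (?F (s, y)) \<partial>lborel) = (\<integral>t. norm (case (s, t) of (s, t) \<Rightarrow> G s t) \<partial>lborel)"
      using ne0 by eventually_elim (simp add: inner_norm)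
    moreover have "(\<lambda>s. \<integral>t. norm (case (s, t) of (s, t) \<Rightarrow> G s t) \<partial>lborel) \<in> borel_measurable lborel"
      unfolding G_def by measurable
    ultimately show "integrable lborel (\<lambda>s. \<integral>t. norm (case (s, t) of (s, t) \<Rightarrow> G s t) \<partial>lborel)"
      by (subst integrable_cong_AE[symmetric]) auto
    have "AE s in lborel. integrable lborel (\<lambda>y. ?F (s, y))"
      by (rule lborel_pair.AE_integrable_fst'[OF F])
    then show "AE s in lborel. integrable lborel (\<lambda>t. case (s, t) of (s, t) \<Rightarrow> G s t)"
      using ne0
    proof eventually_elim
      case (elim s)
      then show ?case
        using lborel_integrable_real_affine[of "\<lambda>y. ?F (s, y)" s 0] by (simp add: G_def)
    qed
  qed
  have slice: "(\<integral>s. G s t \<partial>lborel) = - (indicator {b<..} t *\<^sub>R slope_density c m t + indicator {..<a} t *\<^sub>R slope_density c m t) / ?N" for t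
  proof -
    let ?w = "1 + \<i> * of_real t"
    define P where "P \<sigma> s = of_real s * of_real (Re (c * (of_real s * ?w) ^ m)) / (of_real s * ?w + \<sigma>) ^ (m + 4)" for \<sigma> and s :: real
    have Pint: "integrable lborel (\<lambda>s. indicator {0<..} s *\<^sub>R P \<sigma> s)"
      and Pval: "(\<integral>s. indicator {0<..} s *\<^sub>R P \<sigma> s \<partial>lborel) = - slope_density c m t / ?N"
      if "\<sigma> = \<i> \<or> \<sigma> = - \<i>" for \<sigma>
      using sector_radial_integral[OF that, of c t m]
      unfolding P_def set_lebesgue_integral_def set_integrable_def by blast+
    have z: "Complex s (s * t) = of_real s * ?w" for s by (simp add: complex_eq_iff)
    have even: "(- z) ^ (m + 4) = (- 1) ^ m * z ^ (m + 4)" for z :: complex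
      by (subst power_minus) (simp add: power_add)
    have neg: "of_real (- s) * of_real (Re (c * (of_real (- (- s)) * ?w) ^ m)) / (of_real (- (- s)) * ?w + \<i>) ^ (m + 4) =
        P (- \<i>) (- s)" for s :: real
    proof -
      have "(of_real (- s) * ?w + - \<i>) ^ (m + 4) = (- 1) ^ m * (of_real s * ?w + \<i>) ^ (m + 4)"
        by (simp flip: even)
      moreover have Rr: "Re (of_real r * z) = r * Re z" for r z by simp
      have "of_real (- s) * ?w = (- 1) * (of_real s * ?w)" by simp
      then have "(of_real (- s) * ?w) ^ m = (- 1) ^ m * (of_real s * ?w) ^ m"
        by (simp only: power_mult_distrib[of "- 1"])
      then have "c * (of_real (- s) * ?w) ^ m = of_real ((- 1) ^ m) * (c * (of_real s * ?w) ^ m)"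
        by simp
      then have "Re (c * (of_real (- s) * ?w) ^ m) = (- 1) ^ m * Re (c * (of_real s * ?w) ^ m)"
        by (simp only: Rr)
      ultimately show ?thesis by (simp add: P_def)
    qed
    have Geq: "G s t = (if b < t then 1 else 0) *\<^sub>R (indicator {0<..} s *\<^sub>R P \<i> s)
       + (if t < a then 1 else 0) *\<^sub>R (indicator {0<..} (- s) *\<^sub>R P (- \<i>) (- s))" for s
    proof -
      consider "s = 0" | "0 < s" | "s < 0" by linarith
      then show ?thesis
      proof cases
        case 1 then show ?thesis by (simp add: G_def)
      next
        case 2
        then have "b * s < s * t \<longleftrightarrow> b < t" by (simp add: mult.commute)
        then show ?thesis using 2
          by (simp add: G_def sector_integrand_def z P_def scaleR_conv_of_real)
      next
        case 3
        then have "a * s < s * t \<longleftrightarrow> t < a" by (simp add: mult.commute)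
        then show ?thesis using 3 neg[of s]
          by (simp add: G_def sector_integrand_def z scaleR_conv_of_real)
      qed
    qed
    have Pneg: "integrable lborel (\<lambda>s. indicator {0<..} (- s) *\<^sub>R P (- \<i>) (- s))"
      "(\<integral>s. indicator {0<..} (- s) *\<^sub>R P (- \<i>) (- s) \<partial>lborel) = - slope_density c m t / ?N"
      using lborel_integrable_real_affine[OF Pint[of "- \<i>"], of "- 1" 0]
        lborel_integral_real_affine[of "- 1" "\<lambda>s. indicator {0<..} s *\<^sub>R P (- \<i>) s" 0] Pval[of "- \<i>"]
      by simp_all
    have "(\<integral>s. G s t \<partial>lborel) = (if b < t then 1 else 0) *\<^sub>R (- slope_density c m t / ?N)
       + (if t < a then 1 else 0) *\<^sub>R (- slope_density c m t / ?N)"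
    proof (rule has_bochner_integral_integral_eq)
      have 1: "has_bochner_integral lborel (\<lambda>s. indicator {0<..} s *\<^sub>R P \<i> s) (- slope_density c m t / ?N)"
        using Pint[of \<i>] Pval[of \<i>] by (simp only: has_bochner_integral_iff simp_thms)
      have 2: "has_bochner_integral lborel (\<lambda>s. indicator {0<..} (- s) *\<^sub>R P (- \<i>) (- s)) (- slope_density c m t / ?N)"
        using Pneg by (simp only: has_bochner_integral_iff)
      show "has_bochner_integral lborel (\<lambda>s. G s t) ((if b < t then 1 else 0) *\<^sub>R (- slope_density c m t / ?N)
       + (if t < a then 1 else 0) *\<^sub>R (- slope_density c m t / ?N))"
        unfolding Geq
        by (intro has_bochner_integral_add has_bochner_integral_scaleR_right 1 2)
    qed
    also have "\<dots> = - (indicator {b<..} t *\<^sub>R slope_density c m t + indicator {..<a} t *\<^sub>R slope_density c m t) / ?N"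
      by (simp add: indicator_def add_divide_distrib diff_divide_distrib)
    finally show ?thesis .
  qed
  have "(\<integral>z. ?F z \<partial>plane) = (\<integral>s. \<integral>y. ?F (s, y) \<partial>lborel \<partial>lborel)"
    by (rule lborel_pair.integral_fst'[OF F, symmetric])
  also have "\<dots> = (\<integral>s. \<integral>t. G s t \<partial>lborel \<partial>lborel)"
    by (rule integral_cong_AE) (use ne0 in \<open>auto simp: inner G_def\<close>)
  also have "\<dots> = (\<integral>t. \<integral>s. G s t \<partial>lborel \<partial>lborel)"
    by (rule lborel_pair.Fubini_integral[OF G_int, symmetric])
  also have "\<dots> = - ((LINT t:{b<..}|lborel. slope_density c m t) + (LINT t:{..<a}|lborel. slope_density c m t)) / ?N"
    unfolding slice set_lebesgue_integral_def
    by (subst integral_divide_zero, subst integral_minus, subst Bochner_Integration.integral_add)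
      (auto intro!: integrable_mult_indicator slope_density_integrable)
  also have "\<dots> = - (\<i> / 4) * (slope_primitive c m (cayley a) - slope_primitive c m (cayley b)) / ?N"
    unfolding slope_integral by simp
  finally show ?thesis .
qed

section \<open>Test functions with a singular kernel\<close>

text \<open>
  Equal to \<open>1\<close> on the ball of radius \<open>\<rho> / 2\<close> and \<open>0\<close> outside that of radius \<open>\<rho>\<close>.
\<close>

definition cutoff :: "real^2 \<Rightarrow> real \<Rightarrow> real^2 \<Rightarrow> real" where
  "cutoff x0 \<rho> x = flat 0 (\<rho>\<^sup>2 - (norm (x - x0))\<^sup>2)
     * inverse (flat 0 (\<rho>\<^sup>2 - (norm (x - x0))\<^sup>2) + flat 0 ((norm (x - x0))\<^sup>2 - (\<rho> / 2)\<^sup>2))"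

lemma celem_smooth_local_coordinate: "celem_smooth (\<lambda>x. \<omega> * (cplx x - c))"
  by (intro celem_smooth_mult celem_smooth_diff celem_smooth_const celem_smooth_cplx)

lemma elem_smooth_norm_sq: "elem_smooth (\<lambda>x::real^2. (norm (x - x0))\<^sup>2)"
  using elem_smooth_cmod_sq[OF celem_smooth_local_coordinate[of 1 "cplx x0"]] by (simp flip: cplx_diff)

lemma cutoff_denominator_pos:
  assumes "0 < \<rho>"
  shows "0 < flat 0 (\<rho>\<^sup>2 - t) + flat 0 (t - (\<rho> / 2)\<^sup>2)"
proof (cases "t < \<rho>\<^sup>2")
  case True
  then show ?thesis using flat_pos[of "\<rho>\<^sup>2 - t" 0] flat_nonneg[of 0 "t - (\<rho> / 2)\<^sup>2"] by linarith
next
  case False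
  have "(\<rho> / 2)\<^sup>2 < \<rho>\<^sup>2" using assms by (intro power_strict_mono) auto
  then show ?thesis using False flat_pos[of "t - (\<rho> / 2)\<^sup>2" 0] flat_nonneg[of 0 "\<rho>\<^sup>2 - t"] by linarith
qed

lemma cutoff_smooth:
  assumes "0 < \<rho>"
  shows "elem_smooth (cutoff x0 \<rho>)"
  unfolding cutoff_def[abs_def]
  using cutoff_denominator_pos[OF assms] by (intro elem_smooth.mult elem_smooth.inverse elem_smooth.add elem_smooth.flat
      elem_smooth_diff elem_smooth.const elem_smooth_norm_sq) (metis less_irrefl)

lemma cutoff_outside:
  assumes "0 < \<rho>" "\<rho> \<le> norm (x - x0)"
  shows "cutoff x0 \<rho> x = 0"
proof -
  have "\<rho>\<^sup>2 \<le> (norm (x - x0))\<^sup>2" using assms by (intro power_mono) auto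
  then show ?thesis by (simp add: cutoff_def flat_eq_0)
qed

lemma cutoff_inside:
  assumes "0 < \<rho>" "norm (x - x0) \<le> \<rho> / 2"
  shows "cutoff x0 \<rho> x = 1"
proof -
  have "(norm (x - x0))\<^sup>2 \<le> (\<rho> / 2)\<^sup>2" using assms by (intro power_mono) auto
  then have "flat 0 ((norm (x - x0))\<^sup>2 - (\<rho> / 2)\<^sup>2) = 0" by (simp add: flat_eq_0)
  then show ?thesis
    using cutoff_denominator_pos[OF assms(1), of "(norm (x - x0))\<^sup>2"] by (simp add: cutoff_def)
qed

lemma cutoff_bounds:
  assumes "0 < \<rho>"
  shows "0 \<le> cutoff x0 \<rho> x" "cutoff x0 \<rho> x \<le> 1"
  using cutoff_denominator_pos[OF assms, of "(norm (x - x0))\<^sup>2"]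
    flat_nonneg[of 0 "\<rho>\<^sup>2 - (norm (x - x0))\<^sup>2"] flat_nonneg[of 0 "(norm (x - x0))\<^sup>2 - (\<rho> / 2)\<^sup>2"]
  by (auto simp: cutoff_def divide_inverse[symmetric])

lemma elem_smooth_test_function:
  assumes \<phi>: "elem_smooth \<phi>" "\<And>x. \<rho> \<le> norm (x - x0) \<Longrightarrow> \<phi> x = 0" and U: "cball x0 \<rho> \<subseteq> U"
  shows "test_function U \<phi>"
proof -
  have "{x. \<phi> x \<noteq> 0} \<subseteq> cball x0 \<rho>"
    using \<phi>(2) by (force simp: dist_norm norm_minus_commute)
  then have sub: "closure {x. \<phi> x \<noteq> 0} \<subseteq> cball x0 \<rho>"
    by (rule closure_minimal) simp
  then have "compact (closure {x. \<phi> x \<noteq> 0})"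
    by (meson bounded_cball bounded_subset closed_closure compact_eq_bounded_closed)
  then show ?thesis
    using sub U elem_smooth_C_k[OF \<phi>(1)] by (auto simp: test_function_def)
qed

text \<open>
  The inverse of \<open>z\<close> is \<open>cnj z / \<bar>z\<bar>\<^sup>2\<close>. Adding to the denominator a smooth function of \<open>\<bar>z\<bar>\<close> which is
  positive for \<open>\<bar>z\<bar> < \<delta>\<close> and vanishes for \<open>\<bar>z\<bar> \<ge> \<delta>\<close> removes the singularity and changes nothing at
  distance at least \<open>\<delta>\<close> from the pole.
\<close>

lemma singular_kernel_test_function:
  assumes \<rho>: "0 < \<rho>" and \<delta>: "0 < \<delta>"
  obtains \<phi> where "elem_smooth \<phi>" "\<And>x. \<rho> \<le> norm (x - x0) \<Longrightarrow> \<phi> x = 0"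
    "\<And>x. \<delta> \<le> cmod (\<omega> * (cplx x - c) + p) \<Longrightarrow>
        \<phi> x = cutoff x0 \<rho> x * Re (k / (\<omega> * (cplx x - c) + p) ^ M)"
proof -
  define z where "z x = \<omega> * (cplx x - c) + p" for x
  define den where "den x = (cmod (z x))\<^sup>2 + flat 0 (\<delta>\<^sup>2 - (cmod (z x))\<^sup>2)" for x
  define V where "V x = k * (cnj (z x) * of_real (inverse (den x))) ^ M" for x
  have z: "celem_smooth z"
    unfolding z_def[abs_def] by (intro celem_smooth_add celem_smooth_local_coordinate celem_smooth_const)
  have den_pos: "0 < den x" for x
  proof (cases "z x = 0")
    case True
    then show ?thesis using flat_pos[of "\<delta>\<^sup>2" 0] \<delta> by (simp add: den_def)
  next
    case False
    then have "0 < (cmod (z x))\<^sup>2" by simp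
    then show ?thesis using flat_nonneg[of 0 "\<delta>\<^sup>2 - (cmod (z x))\<^sup>2"] by (simp only: den_def)
  qed
  have "elem_smooth den"
    unfolding den_def[abs_def]
    by (intro elem_smooth.add elem_smooth.flat elem_smooth_diff elem_smooth.const elem_smooth_cmod_sq z)
  then have "elem_smooth (\<lambda>x. inverse (den x))"
    by (rule elem_smooth.inverse) (use den_pos in \<open>metis less_irrefl\<close>)
  then have "celem_smooth V"
    unfolding V_def[abs_def]
    by (intro celem_smooth_mult celem_smooth_power celem_smooth_cnj celem_smooth_of_real celem_smooth_const z)
  then have ReV: "elem_smooth (\<lambda>x. Re (V x))" by (simp add: celem_smooth_def)
  show thesis
  proof (rule that)
    show "elem_smooth (\<lambda>x. cutoff x0 \<rho> x * Re (V x))"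
      by (rule elem_smooth.mult[OF cutoff_smooth[OF \<rho>] ReV])
    show "cutoff x0 \<rho> x * Re (V x) = 0" if "\<rho> \<le> norm (x - x0)" for x
      using cutoff_outside[OF \<rho> that] by simp
    fix x assume "\<delta> \<le> cmod (\<omega> * (cplx x - c) + p)"
    then have d: "\<delta> \<le> cmod (z x)" by (simp add: z_def)
    then have "\<delta>\<^sup>2 \<le> (cmod (z x))\<^sup>2" using \<delta> by (intro power_mono) auto
    then have "den x = (cmod (z x))\<^sup>2" by (simp add: den_def flat_eq_0)
    moreover have "z x \<noteq> 0" using d \<delta> by auto
    ultimately have "cnj (z x) * of_real (inverse (den x)) = inverse (z x)"
      by (simp only: of_real_inverse complex_norm_square) simp
    then have "V x = k / z x ^ M" by (simp add: V_def power_inverse divide_inverse)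
    then show "cutoff x0 \<rho> x * Re (V x) = cutoff x0 \<rho> x * Re (k / (\<omega> * (cplx x - c) + p) ^ M)"
      by (simp add: z_def)
  qed
qed

lemma elem_smooth_laplacian:
  assumes "elem_smooth (h :: real^2 \<Rightarrow> real)"
  shows "elem_smooth (laplacian h)"
  unfolding laplacian_def[abs_def] sum_2 by (intro elem_smooth.add elem_smooth_partial assms)

lemma elem_smooth_bounded:
  assumes "elem_smooth (h :: real^2 \<Rightarrow> real)"
  obtains B where "\<And>x. x \<in> cball x0 \<rho> \<Longrightarrow> \<bar>h x\<bar> \<le> B"
proof -
  have "bounded (h ` cball x0 \<rho>)"
    by (intro compact_imp_bounded compact_continuous_image elem_smooth_continuous assms compact_cball)
  then obtain B where "\<forall>y\<in>h ` cball x0 \<rho>. norm y \<le> B" unfolding bounded_iff ..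
  then show thesis by (intro that[of B]) auto
qed

lemma kernel_derivative:
  fixes p k :: complex
  assumes "z + p \<noteq> 0"
  shows "((\<lambda>z. k / (z + p) ^ M) has_field_derivative - of_nat M * k / (z + p) ^ (M + 1)) (at z)"
proof -
  have der: "((\<lambda>z. k * inverse (z + p) ^ M) has_field_derivative
     k * (of_nat M * inverse (z + p) ^ (M - 1) * (- (inverse (z + p) * 1 * inverse (z + p))))) (at z)"
    using assms by (auto intro!: derivative_eq_intros)
  have inv: "q / (z + p) ^ n = q * inverse (z + p) ^ n" for q z n
    by (simp add: divide_inverse power_inverse)
  have eqv: "k * (of_nat M * inverse (z + p) ^ (M - 1) * (- (inverse (z + p) * 1 * inverse (z + p))))
     = - of_nat M * k / (z + p) ^ (M + 1)"
    unfolding inv by (cases M) (simp_all add: mult_ac del: of_nat_Suc)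
  show ?thesis using der unfolding eqv unfolding inv .
qed

text \<open>
  Where the cutoff is constant, the product is harmonic. Elsewhere \<open>\<bar>x - x0\<bar> \<ge> \<rho> / 2\<close>, so the distance to
  the pole is bounded below by \<open>\<rho> / (2 \<Lambda>)\<close>, uniformly in \<open>\<epsilon>\<close>.
\<close>

lemma laplacian_kernel_bound:
  assumes \<rho>: "0 < \<rho>" and \<Lambda>: "0 < \<Lambda>" and \<omega>: "cmod \<omega> = 1"
  obtains C where "\<And>\<epsilon> k \<phi> x. 0 < \<epsilon> \<Longrightarrow> norm (x - x0) \<le> \<rho> \<Longrightarrow>
     norm (x - x0) + \<epsilon> \<le> \<Lambda> * cmod (\<omega> * (cplx x - cplx x0) + of_real \<epsilon> * \<i>) \<Longrightarrow>
     (\<And>y. \<epsilon> / (2 * \<Lambda>) \<le> cmod (\<omega> * (cplx y - cplx x0) + of_real \<epsilon> * \<i>) \<Longrightarrow>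
        \<phi> y = cutoff x0 \<rho> y * Re (k / (\<omega> * (cplx y - cplx x0) + of_real \<epsilon> * \<i>) ^ M)) \<Longrightarrow>
     \<bar>laplacian \<phi> x\<bar> \<le> C * cmod k"
proof -
  let ?\<psi> = "cutoff x0 \<rho>"
  have \<psi>: "elem_smooth ?\<psi>" by (rule cutoff_smooth[OF \<rho>])
  obtain B0 where B0: "\<And>x. x \<in> cball x0 \<rho> \<Longrightarrow> \<bar>laplacian ?\<psi> x\<bar> \<le> B0"
    using elem_smooth_bounded[OF elem_smooth_laplacian[OF \<psi>]] by blast
  obtain B1 where B1: "\<And>x. x \<in> cball x0 \<rho> \<Longrightarrow> \<bar>partial_deriv 1 ?\<psi> x\<bar> \<le> B1"
    using elem_smooth_bounded[OF elem_smooth_partial[OF \<psi>]] by blast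
  obtain B2 where B2: "\<And>x. x \<in> cball x0 \<rho> \<Longrightarrow> \<bar>partial_deriv 2 ?\<psi> x\<bar> \<le> B2"
    using elem_smooth_bounded[OF elem_smooth_partial[OF \<psi>]] by blast
  \<comment> \<open>lower bound for the distance to the pole where the cutoff is not constant\<close>
  define d where "d = \<rho> / (2 * \<Lambda>)"
  have d: "0 < d" using \<rho> \<Lambda> by (simp add: d_def)
  have x0: "x0 \<in> cball x0 \<rho>" using \<rho> by simp
  have B: "0 \<le> B0" "0 \<le> B1" "0 \<le> B2"
    using B0[OF x0] B1[OF x0] B2[OF x0] by linarith+
  let ?C = "B0 / d ^ M + 2 * (B1 + B2) * (M / d ^ (M + 1))"
  have C: "0 \<le> ?C" using B d by (intro add_nonneg_nonneg mult_nonneg_nonneg divide_nonneg_nonneg) auto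
  show thesis
  proof (rule that)
    fix \<epsilon> :: real and k :: complex and \<phi> :: "real^2 \<Rightarrow> real" and x :: "real^2"
    let ?Z = "\<lambda>y. \<omega> * (cplx y - cplx x0)" and ?p = "of_real \<epsilon> * \<i>"
    assume \<epsilon>: "0 < \<epsilon>" and x: "norm (x - x0) \<le> \<rho>"
      and cone: "norm (x - x0) + \<epsilon> \<le> \<Lambda> * cmod (?Z x + ?p)"
      and \<phi>: "\<And>y. \<epsilon> / (2 * \<Lambda>) \<le> cmod (?Z y + ?p) \<Longrightarrow> \<phi> y = ?\<psi> y * Re (k / (?Z y + ?p) ^ M)"
    define U where "U = {y. \<epsilon> / (2 * \<Lambda>) < cmod (?Z y + ?p)}"
    have "open U"
      unfolding U_def
      by (intro open_Collect_less continuous_intros linear_continuous_on bounded_linear_cplx)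
    have \<epsilon>2: "0 < \<epsilon> / (2 * \<Lambda>)" using \<epsilon> \<Lambda> by simp
    have "\<epsilon> / (2 * \<Lambda>) < \<epsilon> / \<Lambda>" using \<epsilon> \<Lambda> by (simp add: field_simps)
    also have "\<epsilon> / \<Lambda> \<le> cmod (?Z x + ?p)"
      unfolding pos_divide_le_eq[OF \<Lambda>] mult.commute[of _ \<Lambda>]
      using cone norm_ge_zero[of "x - x0"] by linarith
    finally have xU: "x \<in> U" by (simp add: U_def)
    have nz: "?Z y + ?p \<noteq> 0" if "y \<in> U" for y
      using that \<epsilon>2 by (auto simp: U_def)
    let ?g = "\<lambda>z. k / (z + ?p) ^ M" and ?g1 = "\<lambda>z. - of_nat M * k / (z + ?p) ^ (M + 1)"
      and ?g2 = "\<lambda>z. - of_nat (M + 1) * (- of_nat M * k) / (z + ?p) ^ (M + 1 + 1)"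
    have lap: "laplacian \<phi> x = laplacian ?\<psi> x * Re (?g (?Z x))
       + 2 * (\<Sum>i\<in>UNIV. partial_deriv i ?\<psi> x * Re (?g1 (?Z x) * (\<omega> * cplx (axis i 1))))"
    proof (rule laplacian_cutoff_holomorphic[OF \<psi> \<open>open U\<close> xU, of ?g ?g1 _ _ ?g2])
      fix y assume y: "y \<in> U"
      show "(?g has_field_derivative ?g1 (?Z y)) (at (?Z y))"
        by (rule kernel_derivative[OF nz[OF y]])
      show "(?g1 has_field_derivative ?g2 (?Z y)) (at (?Z y))"
        by (rule kernel_derivative[OF nz[OF y]])
      show "\<phi> y = ?\<psi> y * Re (?g (?Z y))"
        using y by (intro \<phi>) (simp add: U_def)
    qed
    show "\<bar>laplacian \<phi> x\<bar> \<le> ?C * cmod k"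
    proof (cases "norm (x - x0) < \<rho> / 2")
      case True
      have loc: "open (ball x0 (\<rho> / 2))" "x \<in> ball x0 (\<rho> / 2)" "\<And>y. y \<in> ball x0 (\<rho> / 2) \<Longrightarrow> ?\<psi> y = 1"
        using True cutoff_inside[OF \<rho>, of _ x0] by (auto simp: dist_norm norm_minus_commute)
      have c: "partial_deriv i (\<lambda>x. 1) y = 0" for i :: 2 and y
        by (subst partial_derivI[of _ "\<lambda>x. 0"]) auto
      have "partial_deriv i ?\<psi> x = 0" for i
        by (simp only: partial_deriv_local[OF loc] c)
      moreover have "laplacian ?\<psi> x = 0"
        by (simp only: laplacian_local[OF loc]) (simp add: laplacian_def c[abs_def] partial_deriv_zero)
      ultimately have "laplacian \<phi> x = 0" by (simp add: lap)
      then show ?thesis using mult_nonneg_nonneg[OF C norm_ge_zero[of k]] by simp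
    next
      case False
      have xb: "x \<in> cball x0 \<rho>" using x by (simp add: dist_norm norm_minus_commute)
      have "\<rho> / 2 \<le> \<Lambda> * cmod (?Z x + ?p)" using False cone \<epsilon> by linarith
      then have n: "d \<le> cmod (?Z x + ?p)"
        using \<Lambda> by (simp add: d_def field_simps)
      have np: "0 < cmod (?Z x + ?p)" using n d by linarith
      have g: "cmod (?g (?Z x)) \<le> cmod k / d ^ M"
        unfolding norm_divide norm_power using n d np
        by (intro divide_left_mono power_mono mult_pos_pos zero_less_power) auto
      have "cmod (?g1 (?Z x)) = real M * cmod k / cmod (?Z x + ?p) ^ (M + 1)"
        unfolding norm_divide norm_power norm_mult norm_minus_cancel norm_of_nat ..
      also have "\<dots> \<le> real M * cmod k / d ^ (M + 1)"
        using n d np by (intro divide_left_mono power_mono mult_pos_pos zero_less_power) auto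
      finally have g1: "cmod (?g1 (?Z x)) \<le> real M * cmod k / d ^ (M + 1)" .
      have g1': "\<bar>Re (?g1 (?Z x) * (\<omega> * cplx (axis i 1)))\<bar> \<le> real M * cmod k / d ^ (M + 1)" for i
      proof -
        have "cmod (?g1 (?Z x) * (\<omega> * cplx (axis i 1))) = cmod (?g1 (?Z x))"
          by (simp only: norm_mult \<omega> norm_cplx norm_axis_1 mult_1_right)
        then show ?thesis using abs_Re_le_cmod[of "?g1 (?Z x) * (\<omega> * cplx (axis i 1))"] g1 by linarith
      qed
      have tri: "\<bar>r + 2 * (s + t)\<bar> \<le> R + 2 * (S + T)" if "\<bar>r\<bar> \<le> R" "\<bar>s\<bar> \<le> S" "\<bar>t\<bar> \<le> T" for r s t R S T :: real
        using that unfolding abs_le_iff by auto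
      let ?G = "real M * cmod k / d ^ (M + 1)"
      have "\<bar>laplacian ?\<psi> x * Re (?g (?Z x))\<bar> \<le> B0 * (cmod k / d ^ M)"
        unfolding abs_mult using B0[OF xb] order_trans[OF abs_Re_le_cmod g] B
        by (intro mult_mono) auto
      moreover have "\<bar>partial_deriv 1 ?\<psi> x * Re (?g1 (?Z x) * (\<omega> * cplx (axis 1 1)))\<bar> \<le> B1 * ?G"
        unfolding abs_mult[of "partial_deriv 1 ?\<psi> x"] by (intro mult_mono B1[OF xb] g1' B) auto
      moreover have "\<bar>partial_deriv 2 ?\<psi> x * Re (?g1 (?Z x) * (\<omega> * cplx (axis 2 1)))\<bar> \<le> B2 * ?G"
        unfolding abs_mult[of "partial_deriv 2 ?\<psi> x"] by (intro mult_mono B2[OF xb] g1' B) auto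
      ultimately have "\<bar>laplacian \<phi> x\<bar> \<le> B0 * (cmod k / d ^ M) + 2 * (B1 * ?G + B2 * ?G)"
        unfolding lap sum_2 by (rule tri)
      also have "\<dots> = ?C * cmod k" by (simp add: algebra_simps)
      finally show ?thesis .
    qed
  qed
qed

section \<open>Blow-up at a boundary corner\<close>

text \<open>
  The situation at a single boundary point \<open>x0\<close> after all reductions: near \<open>x0\<close> the rotated domain is
  the region above a graph with one-sided slopes \<open>a\<close> and \<open>b\<close>, and \<open>f\<close> has the leading term
  \<open>Re (c z\<^sup>m)\<close> in the rotated complex coordinate.
\<close>

locale boundary_corner =
  fixes D :: "(real^2) set" and u f :: "real^2 \<Rightarrow> real" and x0 :: "real^2" and A :: "real^2^2"
    and r a b \<alpha> K :: real and \<eta> :: "real \<Rightarrow> real" and c :: complex and m :: nat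
  assumes open_D: "open D" and x0: "x0 \<in> ball 0 2"
    and f_cont: "continuous_on (ball 0 2) f"
    and weak: "weak_poisson (ball 0 2) u (\<lambda>x. f x * indicator D x)"
    and u_zero: "AE x in lebesgue. x \<in> ball 0 2 - closure D \<longrightarrow> u x = 0"
    and \<alpha>: "0 < \<alpha>"
    and leading: "\<And>v. x0 + v \<in> ball 0 2 \<Longrightarrow>
        \<bar>f (x0 + v) - Re (c * cplx (A *v v) ^ m)\<bar> \<le> K * norm v powr (real m + \<alpha>)"
    and A: "rotation_matrix A" and r: "0 < r"
    and epigraph: "\<And>x. norm (x - x0) < r \<Longrightarrow> x \<in> D \<longleftrightarrow> \<eta> ((A *v (x - x0)) $ 1) < (A *v (x - x0)) $ 2"
    and \<eta>0: "\<eta> 0 = 0"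
    and left_slope: "((\<lambda>t. \<eta> t / t) \<longlongrightarrow> a) (at_left 0)"
    and right_slope: "((\<lambda>t. \<eta> t / t) \<longlongrightarrow> b) (at_right 0)"
begin

definition Z :: "real^2 \<Rightarrow> complex" where "Z x = cplx (A *v (x - x0))"

lemma orthogonal_A: "orthogonal_matrix A"
  using A by (simp add: rotation_matrix_def)

lemma norm_Z: "cmod (Z x) = norm (x - x0)"
  by (simp add: Z_def orthogonal_matrix_norm[OF orthogonal_A])

lemma lipschitz_at_corner:
  obtains \<delta> L where "0 < \<delta>" "0 \<le> L" "\<And>t. \<bar>t\<bar> < \<delta> \<Longrightarrow> \<bar>\<eta> t\<bar> \<le> L * \<bar>t\<bar>"
proof -
  let ?L = "\<bar>a\<bar> + \<bar>b\<bar> + 1"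
  have "eventually (\<lambda>t. \<bar>\<eta> t / t\<bar> < ?L) (at_left 0)" "eventually (\<lambda>t. \<bar>\<eta> t / t\<bar> < ?L) (at_right 0)"
    by (rule order_tendstoD[OF tendsto_rabs[OF left_slope]] order_tendstoD[OF tendsto_rabs[OF right_slope]]; simp)+
  then have "eventually (\<lambda>t. \<bar>\<eta> t / t\<bar> < ?L) (at 0)"
    by (rule eventually_at_split[THEN iffD2, OF conjI])
  then obtain \<delta> where \<delta>: "0 < \<delta>" "\<And>t. t \<noteq> 0 \<Longrightarrow> \<bar>t\<bar> < \<delta> \<Longrightarrow> \<bar>\<eta> t / t\<bar> < ?L"
    by (auto simp: eventually_at)
  show thesis
  proof (rule that[OF \<delta>(1), of ?L])
    fix t :: real assume t: "\<bar>t\<bar> < \<delta>"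
    show "\<bar>\<eta> t\<bar> \<le> ?L * \<bar>t\<bar>"
    proof (cases "t = 0")
      case True then show ?thesis using \<eta>0 by simp
    next
      case False
      then show ?thesis using \<delta>(2)[OF False t] by (simp add: abs_divide pos_divide_less_eq)
    qed
  qed simp
qed

text \<open>
  Finite one-sided slopes make the graph Lipschitz at the corner, so the closure of the domain stays
  inside a cone around the upward direction.
\<close>

lemma cone_near_corner:
  obtains \<rho> L where "0 < \<rho>" "\<rho> \<le> 1" "\<rho> < r" "cball x0 \<rho> \<subseteq> ball 0 2" "0 \<le> L"
    "\<And>x. x \<in> closure D \<Longrightarrow> norm (x - x0) \<le> \<rho> \<Longrightarrow> - L * \<bar>Re (Z x)\<bar> \<le> Im (Z x)"
proof -
  obtain \<delta> L where \<delta>: "0 < \<delta>" and L: "0 \<le> L" "\<And>t. \<bar>t\<bar> < \<delta> \<Longrightarrow> \<bar>\<eta> t\<bar> \<le> L * \<bar>t\<bar>"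
    using lipschitz_at_corner by blast
  define \<rho>' where "\<rho>' = min \<delta> r"
  define \<rho> where "\<rho> = min 1 (min \<rho>' (2 - norm x0)) / 2"
  have x0': "norm x0 < 2" using x0 by simp
  have \<rho>: "0 < \<rho>" "\<rho> < 1" "\<rho> < \<rho>'" "\<rho> < 2 - norm x0"
    using \<delta> r x0' by (auto simp: \<rho>_def \<rho>'_def)
  let ?Q = "{x. - L * \<bar>Re (Z x)\<bar> \<le> Im (Z x)}"
  have "ball x0 \<rho>' \<inter> D \<subseteq> ?Q"
  proof
    fix x assume x: "x \<in> ball x0 \<rho>' \<inter> D"
    then have n: "norm (x - x0) < \<rho>'" by (simp add: dist_norm norm_minus_commute)
    then have "\<bar>Re (Z x)\<bar> < \<delta>" using abs_Re_le_cmod[of "Z x"] norm_Z[of x] by (simp add: \<rho>'_def)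
    then have "\<bar>\<eta> (Re (Z x))\<bar> \<le> L * \<bar>Re (Z x)\<bar>" by (rule L)
    moreover have "\<eta> (Re (Z x)) < Im (Z x)"
      using epigraph[of x] n x by (simp add: Z_def \<rho>'_def)
    ultimately show "x \<in> ?Q" by auto
  qed
  moreover have "closed ?Q"
  proof -
    have "continuous_on UNIV Z"
      unfolding Z_def
      by (intro continuous_on_compose2[OF linear_continuous_on[OF bounded_linear_cplx]]
          continuous_on_compose2[OF linear_continuous_on[OF matrix_vector_mul_bounded_linear]] continuous_intros) auto
    then show ?thesis by (intro closed_Collect_le continuous_intros)
  qed
  ultimately have "closure (ball x0 \<rho>' \<inter> D) \<subseteq> ?Q"
    by (rule closure_minimal)
  then have Q: "ball x0 \<rho>' \<inter> closure D \<subseteq> ?Q"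
    using open_Int_closure_subset[of "ball x0 \<rho>'" D] by blast
  show thesis
  proof (rule that[of \<rho> L])
    show "cball x0 \<rho> \<subseteq> ball 0 2"
    proof
      fix y assume "y \<in> cball x0 \<rho>"
      then have "norm (y - x0) \<le> \<rho>" by (simp add: dist_norm norm_minus_commute)
      then show "y \<in> ball 0 2" using \<rho>(4) norm_triangle_sub[of y x0] by simp
    qed
    show "- L * \<bar>Re (Z x)\<bar> \<le> Im (Z x)" if "x \<in> closure D" "norm (x - x0) \<le> \<rho>" for x
    proof -
      have "x \<in> ball x0 \<rho>' \<inter> closure D"
        using that \<rho>(3) by (simp add: dist_norm norm_minus_commute)
      then show ?thesis using Q by blast
    qed
  qed (use \<rho> L in \<open>auto simp: \<rho>'_def\<close>)
qed

lemma leading_term_bound: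
  assumes x: "x \<in> ball 0 2" "norm (x - x0) \<le> 1"
  shows "\<bar>f x\<bar> \<le> (cmod c + \<bar>K\<bar>) * cmod (Z x) ^ m"
proof -
  let ?v = "x - x0"
  have "\<bar>f x - Re (c * Z x ^ m)\<bar> \<le> K * norm ?v powr (real m + \<alpha>)"
    using leading[of ?v] x by (simp add: Z_def)
  also have "\<dots> \<le> \<bar>K\<bar> * norm ?v ^ m"
  proof (cases "?v = 0")
    case False
    then have "norm ?v powr (real m + \<alpha>) = norm ?v ^ m * norm ?v powr \<alpha>"
      by (simp add: powr_add powr_realpow)
    also have "\<dots> \<le> norm ?v ^ m * 1"
      using x \<alpha> by (intro mult_left_mono powr_le1) auto
    finally have "norm ?v powr (real m + \<alpha>) \<le> norm ?v ^ m" by simp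
    then have "\<bar>K\<bar> * norm ?v powr (real m + \<alpha>) \<le> \<bar>K\<bar> * norm ?v ^ m" by (intro mult_left_mono) auto
    moreover have "K * norm ?v powr (real m + \<alpha>) \<le> \<bar>K\<bar> * norm ?v powr (real m + \<alpha>)"
      by (intro mult_right_mono) auto
    ultimately show ?thesis by linarith
  qed simp
  finally have 1: "\<bar>f x - Re (c * Z x ^ m)\<bar> \<le> \<bar>K\<bar> * norm ?v ^ m" .
  have "\<bar>Re (c * Z x ^ m)\<bar> \<le> cmod c * norm ?v ^ m"
    using abs_Re_le_cmod[of "c * Z x ^ m"] by (simp add: norm_mult norm_power norm_Z)
  then have "\<bar>f x\<bar> \<le> cmod c * norm ?v ^ m + \<bar>K\<bar> * norm ?v ^ m" using 1 by linarith
  then show ?thesis by (simp add: norm_Z distrib_right)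
qed

text \<open>
  The blow-up coordinates: \<open>pt \<epsilon>\<close> carries \<open>\<epsilon>\<close>-independent planar coordinates back to the
  neighbourhood of \<open>x0\<close>, as \<open>Z (pt \<epsilon> z) = \<epsilon> z\<close> shows.
\<close>

definition pt :: "real \<Rightarrow> real \<times> real \<Rightarrow> real^2" where
  "pt \<epsilon> z = x0 + \<epsilon> *\<^sub>R (transpose A *v vector [fst z, snd z])"

lemma Z_pt: "Z (pt \<epsilon> z) = of_real \<epsilon> * Complex (fst z) (snd z)"
proof -
  have "A *v (\<epsilon> *\<^sub>R (transpose A *v vector [fst z, snd z])) = \<epsilon> *\<^sub>R (vector [fst z, snd z])"
    using orthogonal_A
    by (simp add: matrix_vector_mult_scaleR matrix_vector_mul_assoc orthogonal_matrix_def del: transpose_matrix_vector)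
  then show ?thesis
    by (simp add: Z_def pt_def cplx_scaleR del: transpose_matrix_vector) (simp add: cplx_def vector_2)
qed

lemma norm_pt: "0 \<le> \<epsilon> \<Longrightarrow> norm (pt \<epsilon> z - x0) = \<epsilon> * cmod (Complex (fst z) (snd z))"
  by (simp add: norm_Z[symmetric] Z_pt norm_mult)

lemma integral_pt:
  assumes "g \<in> borel_measurable borel" "0 < \<epsilon>"
  shows "(\<integral>x. g x \<partial>lborel) = (\<integral>z. \<epsilon>\<^sup>2 * g (pt \<epsilon> z) \<partial>plane)"
proof -
  have oA: "orthogonal_matrix (transpose A)" using orthogonal_A by (simp add: orthogonal_matrix_transpose)
  have "(\<lambda>y. g (x0 + \<epsilon> *\<^sub>R (transpose A *v y))) \<in> borel_measurable borel"
    using assms(1) borel_measurable_continuous_onI[OF linear_continuous_on[OF matrix_vector_mul_bounded_linear[of "transpose A"]]]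
    by measurable
  then show ?thesis
    using integral_similarity[OF assms(1) oA assms(2), of x0]
      integral_real2_eq_pair[of "\<lambda>y. g (x0 + \<epsilon> *\<^sub>R (transpose A *v y))"]
    by (simp add: lborel_prod pt_def del: transpose_matrix_vector)
qed

text \<open>
  A smooth function supported near the corner which equals the truncated kernel except close to the pole.
  The factor \<open>\<epsilon>\<^sup>2\<close> makes its pairing with the homogeneous leading term of \<open>f\<close> scale
  invariant.
\<close>

definition test_at :: "complex \<Rightarrow> real \<Rightarrow> real \<Rightarrow> real \<Rightarrow> (real^2 \<Rightarrow> real) \<Rightarrow> bool" where
  "test_at \<kappa> \<rho> \<Lambda> \<epsilon> \<phi> \<longleftrightarrow> elem_smooth \<phi> \<and> (\<forall>x. \<rho> \<le> norm (x - x0) \<longrightarrow> \<phi> x = 0) \<and>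
     (\<forall>x. \<epsilon> / (2 * \<Lambda>) \<le> cmod (Z x + of_real \<epsilon> * \<i>) \<longrightarrow>
        \<phi> x = cutoff x0 \<rho> x * Re (\<kappa> * of_real (\<epsilon>\<^sup>2) / (Z x + of_real \<epsilon> * \<i>) ^ (m + 4)))"

lemma Z_rotation:
  obtains \<omega> where "cmod \<omega> = 1" "\<And>x. Z x = \<omega> * (cplx x - cplx x0)"
proof -
  obtain \<omega> where "cmod \<omega> = 1" "\<And>v. cplx (A *v v) = \<omega> * cplx v"
    using rotation_matrix_cplx[OF A] by blast
  then show thesis by (intro that) (auto simp: Z_def cplx_diff)
qed

lemma test_at_exists:
  assumes "0 < \<rho>" "0 < \<Lambda>" "0 < \<epsilon>"
  shows "\<exists>\<phi>. test_at \<kappa> \<rho> \<Lambda> \<epsilon> \<phi>"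
proof -
  obtain \<omega> where \<omega>: "\<And>x. Z x = \<omega> * (cplx x - cplx x0)" using Z_rotation by blast
  have "0 < \<epsilon> / (2 * \<Lambda>)" using assms by simp
  from singular_kernel_test_function[OF assms(1) this, of x0 \<omega> "cplx x0" "of_real \<epsilon> * \<i>" "\<kappa> * of_real (\<epsilon>\<^sup>2)" "m + 4"]
  show ?thesis unfolding test_at_def \<omega> by metis
qed

text \<open>
  A point of the support of \<open>\<phi>\<close> at which \<open>u\<close> does not vanish is, up to a null set, in the closure of
  \<open>D\<close>, where \<open>\<Delta>\<phi> = O(\<epsilon>\<^sup>2)\<close>, so the pairing is at most
  \<open>O(\<epsilon>\<^sup>2)\<close> times the integral of \<open>\<bar>u\<bar>\<close> over that support.
\<close>

lemma laplacian_pairing_tendsto_0: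
  assumes \<rho>: "0 < \<rho>" "cball x0 \<rho> \<subseteq> ball 0 2" and \<Lambda>: "0 < \<Lambda>"
    and cone: "\<And>x \<epsilon>. x \<in> closure D \<Longrightarrow> norm (x - x0) \<le> \<rho> \<Longrightarrow> 0 < \<epsilon> \<Longrightarrow>
        norm (x - x0) + \<epsilon> \<le> \<Lambda> * cmod (Z x + of_real \<epsilon> * \<i>)"
    and e: "\<And>n::nat. 0 < e n" "e \<longlonglongrightarrow> 0" and \<phi>: "\<And>n. test_at \<kappa> \<rho> \<Lambda> (e n) (\<phi> n)"
  shows "(\<lambda>n. \<integral>x. u x * laplacian (\<phi> n) x \<partial>lebesgue_on (ball 0 2)) \<longlonglongrightarrow> 0"
proof -
  let ?B = "ball 0 2 :: (real^2) set"
  obtain \<omega> where \<omega>: "cmod \<omega> = 1" "\<And>x. Z x = \<omega> * (cplx x - cplx x0)" using Z_rotation by blast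
  obtain C where C: "\<And>\<epsilon> k \<phi> x. 0 < \<epsilon> \<Longrightarrow> norm (x - x0) \<le> \<rho> \<Longrightarrow>
     norm (x - x0) + \<epsilon> \<le> \<Lambda> * cmod (Z x + of_real \<epsilon> * \<i>) \<Longrightarrow>
     (\<And>y. \<epsilon> / (2 * \<Lambda>) \<le> cmod (Z y + of_real \<epsilon> * \<i>) \<Longrightarrow>
        \<phi> y = cutoff x0 \<rho> y * Re (k / (Z y + of_real \<epsilon> * \<i>) ^ (m + 4))) \<Longrightarrow>
     \<bar>laplacian \<phi> x\<bar> \<le> C * cmod k"
    using laplacian_kernel_bound[OF \<rho>(1) \<Lambda> \<omega>(1), of x0 "m + 4"] unfolding \<omega>(2)[symmetric] by blast
  let ?C = "\<bar>C\<bar> * cmod \<kappa>"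
  have u: "L1_loc ?B u" using weak by (auto simp: weak_poisson_def weak_gradient_def)
  define g where "g x = indicator (cball x0 \<rho>) x *\<^sub>R \<bar>u x\<bar>" for x
  have "integrable (lebesgue_on (cball x0 \<rho>)) u"
    using u \<rho>(2) unfolding L1_loc_def by (meson compact_cball)
  then have "integrable (lebesgue_on (cball x0 \<rho>)) (\<lambda>x. \<bar>u x\<bar>)" by (rule integrable_abs)
  then have "integrable lebesgue g"
    unfolding g_def by (subst (asm) integrable_restrict_space) simp_all
  moreover have "indicator ?B x *\<^sub>R g x = g x" for x
  proof (cases "x \<in> cball x0 \<rho>")
    case True
    then have "x \<in> ?B" using \<rho>(2) by (rule rev_subsetD)
    then show ?thesis by (simp only: indicator_simps scaleR_one)
  next
    case False
    then show ?thesis by (simp only: g_def indicator_simps scaleR_zero_left scaleR_zero_right not_False_eq_True)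
  qed
  ultimately have "integrable lebesgue (\<lambda>x. indicator ?B x *\<^sub>R g x)" by (simp only:)
  then have g: "integrable (lebesgue_on ?B) g"
    by (subst integrable_restrict_space) simp_all
  have bound: "norm (\<integral>x. u x * laplacian (\<phi> n) x \<partial>lebesgue_on ?B) \<le> (\<integral>x. g x \<partial>lebesgue_on ?B) * ?C * (e n)\<^sup>2" for n
  proof -
    have "AE x in lebesgue_on ?B. norm (u x * laplacian (\<phi> n) x) \<le> g x * (?C * (e n)\<^sup>2)"
    proof (subst AE_restrict_space_iff)
      show "AE x in lebesgue. x \<in> ?B \<longrightarrow> norm (u x * laplacian (\<phi> n) x) \<le> g x * (?C * (e n)\<^sup>2)"
        using u_zero
      proof eventually_elim
        case (elim x)
        show ?case
        proof
          assume xB: "x \<in> ?B"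
          consider "x \<notin> cball x0 \<rho>" | "x \<notin> closure D" | "x \<in> cball x0 \<rho>" "x \<in> closure D" by blast
          then show "norm (u x * laplacian (\<phi> n) x) \<le> g x * (?C * (e n)\<^sup>2)"
          proof cases
            case 1
            have "laplacian (\<phi> n) x = laplacian (\<lambda>x. 0) x"
              by (rule laplacian_local[of "- cball x0 \<rho>"])
                (use 1 \<phi>[of n] in \<open>auto simp: test_at_def dist_norm norm_minus_commute\<close>)
            then show ?thesis using 1 by (simp add: laplacian_zero g_def)
          next
            case 2
            then have "u x = 0" using elim xB by blast
            then show ?thesis by (simp add: g_def)
          next
            case 3
            then have x: "norm (x - x0) \<le> \<rho>" by (simp add: dist_norm norm_minus_commute)
            have "\<bar>laplacian (\<phi> n) x\<bar> \<le> C * cmod (\<kappa> * of_real ((e n)\<^sup>2))"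
              by (rule C[OF e(1)[of n] x cone[OF 3(2) x e(1)[of n]]]) (use \<phi>[of n] in \<open>simp add: test_at_def\<close>)
            also have "\<dots> \<le> \<bar>C\<bar> * (cmod \<kappa> * (e n)\<^sup>2)"
              unfolding norm_mult norm_of_real by (simp add: mult_right_mono)
            finally have "\<bar>laplacian (\<phi> n) x\<bar> \<le> ?C * (e n)\<^sup>2" by (simp only: mult.assoc)
            then have "\<bar>u x\<bar> * \<bar>laplacian (\<phi> n) x\<bar> \<le> \<bar>u x\<bar> * (?C * (e n)\<^sup>2)"
              by (rule mult_left_mono) simp
            then show ?thesis using 3 by (simp add: abs_mult g_def)
          qed
        qed
      qed
    qed simp
    then have "(\<integral>x. norm (u x * laplacian (\<phi> n) x) \<partial>lebesgue_on ?B) \<le> (\<integral>x. g x * (?C * (e n)\<^sup>2) \<partial>lebesgue_on ?B)"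
      by (intro integral_mono_AE' Bochner_Integration.integrable_mult_left g) auto
    also have "\<dots> = (\<integral>x. g x \<partial>lebesgue_on ?B) * (?C * (e n)\<^sup>2)"
      by (rule integral_mult_left_zero)
    finally show ?thesis
      using integral_norm_bound[of "lebesgue_on ?B" "\<lambda>x. u x * laplacian (\<phi> n) x"] by (simp only: mult.assoc)
  qed
  have "(\<lambda>n. (\<integral>x. g x \<partial>lebesgue_on ?B) * ?C * (e n)\<^sup>2) \<longlonglongrightarrow> (\<integral>x. g x \<partial>lebesgue_on ?B) * ?C * 0\<^sup>2"
    by (intro tendsto_intros e(2))
  then have "(\<lambda>n. (\<integral>x. g x \<partial>lebesgue_on ?B) * ?C * (e n)\<^sup>2) \<longlonglongrightarrow> 0"
    by (simp only: zero_power2 mult_zero_right)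
  then show ?thesis
    by (rule Lim_null_comparison[OF always_eventually[OF allI[OF bound]]])
qed

lemma mem_ball_of_near:
  assumes "cball x0 \<rho> \<subseteq> ball 0 2" "norm (x - x0) \<le> \<rho>"
  shows "x \<in> ball 0 2"
proof -
  have "x \<in> cball x0 \<rho>" using assms(2) by (simp add: dist_norm norm_minus_commute)
  then show ?thesis using assms(1) by (rule rev_subsetD)
qed

text \<open>
  The integrand of \<open>\<integral>\<^sub>D f \<phi>\<close> in blow-up coordinates, including the Jacobian \<open>\<epsilon>\<^sup>2\<close>.
\<close>

definition blow_up :: "(real^2 \<Rightarrow> real) \<Rightarrow> real \<Rightarrow> real \<times> real \<Rightarrow> real" where
  "blow_up \<phi> \<epsilon> z = \<epsilon>\<^sup>2 * (indicator (ball 0 2) (pt \<epsilon> z) * f (pt \<epsilon> z) * (indicator D (pt \<epsilon> z) * \<phi> (pt \<epsilon> z)))"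

lemma blow_up_measurable:
  assumes "elem_smooth \<phi>"
  shows "(\<lambda>x. indicator (ball 0 2) x * f x * (indicator D x * \<phi> x)) \<in> borel_measurable borel"
    and "blow_up \<phi> \<epsilon> \<in> borel_measurable plane"
proof -
  have "(\<lambda>x. indicator (ball 0 2) x *\<^sub>R f x) \<in> borel_measurable borel"
    by (rule borel_measurable_continuous_on_indicator[OF _ f_cont]) simp
  moreover have "(\<lambda>x. indicator D x :: real) \<in> borel_measurable borel"
    using open_D by (intro borel_measurable_indicator) auto
  moreover have "\<phi> \<in> borel_measurable borel"
    by (rule borel_measurable_continuous_onI[OF elem_smooth_continuous[OF assms]])
  ultimately show *: "(\<lambda>x. indicator (ball 0 2) x * f x * (indicator D x * \<phi> x)) \<in> borel_measurable borel"
    by simp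
  have "(\<lambda>z. pt \<epsilon> z) \<in> borel_measurable plane"
  proof -
    have "(\<lambda>y. x0 + \<epsilon> *\<^sub>R (transpose A *v y)) \<in> borel_measurable borel"
      by (intro borel_measurable_continuous_onI continuous_intros linear_continuous_on matrix_vector_mul_bounded_linear)
    from measurable_compose[OF measurable_vector2 this] show ?thesis
      by (simp add: pt_def[abs_def] lborel_prod del: transpose_matrix_vector)
  qed
  from measurable_compose[OF this *] show "blow_up \<phi> \<epsilon> \<in> borel_measurable plane"
    unfolding blow_up_def[abs_def] by simp
qed

lemma pairing_eq_blow_up:
  assumes "elem_smooth \<phi>" "0 < \<epsilon>"
  shows "(\<integral>x. f x * indicator D x * \<phi> x \<partial>lebesgue_on (ball 0 2)) = (\<integral>z. blow_up \<phi> \<epsilon> z \<partial>plane)"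
proof -
  let ?g = "\<lambda>x. indicator (ball 0 2) x * f x * (indicator D x * \<phi> x)"
  have "(\<integral>x. f x * indicator D x * \<phi> x \<partial>lebesgue_on (ball 0 2)) = (\<integral>x. ?g x \<partial>lebesgue)"
    by (subst integral_restrict_space) (simp_all add: mult.assoc)
  also have "\<dots> = (\<integral>x. ?g x \<partial>lborel)"
    using blow_up_measurable(1)[OF assms(1)] by (intro integral_completion) simp
  also have "\<dots> = (\<integral>z. blow_up \<phi> \<epsilon> z \<partial>plane)"
    unfolding blow_up_def by (rule integral_pt[OF blow_up_measurable(1)[OF assms(1)] assms(2)])
  finally show ?thesis .
qed

lemma blow_up_inside:
  assumes \<epsilon>: "0 < \<epsilon>" and \<Lambda>: "0 < \<Lambda>" and \<phi>: "test_at \<kappa> \<rho> \<Lambda> \<epsilon> \<phi>"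
    and x: "pt \<epsilon> z \<in> D" "pt \<epsilon> z \<in> ball 0 2"
    and cone: "norm (pt \<epsilon> z - x0) + \<epsilon> \<le> \<Lambda> * cmod (Z (pt \<epsilon> z) + of_real \<epsilon> * \<i>)"
  shows "blow_up \<phi> \<epsilon> z = cutoff x0 \<rho> (pt \<epsilon> z) * (f (pt \<epsilon> z) / \<epsilon> ^ m)
     * Re (\<kappa> / (Complex (fst z) (snd z) + \<i>) ^ (m + 4))"
proof -
  let ?x = "pt \<epsilon> z" and ?w = "Complex (fst z) (snd z) + \<i>"
  have Zx: "Z ?x + of_real \<epsilon> * \<i> = of_real \<epsilon> * ?w" by (simp add: Z_pt distrib_left)
  have "\<epsilon> / (2 * \<Lambda>) \<le> \<epsilon> / \<Lambda>" using \<epsilon> \<Lambda> by (simp add: field_simps)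
  also have "\<epsilon> / \<Lambda> \<le> cmod (Z ?x + of_real \<epsilon> * \<i>)"
    unfolding pos_divide_le_eq[OF \<Lambda>] mult.commute[of _ \<Lambda>]
    using cone norm_ge_zero[of "?x - x0"] by linarith
  finally have "\<phi> ?x = cutoff x0 \<rho> ?x * Re (\<kappa> * of_real (\<epsilon>\<^sup>2) / (Z ?x + of_real \<epsilon> * \<i>) ^ (m + 4))"
    using \<phi> by (simp add: test_at_def)
  also have "\<kappa> * of_real (\<epsilon>\<^sup>2) / (Z ?x + of_real \<epsilon> * \<i>) ^ (m + 4) = of_real (\<epsilon>\<^sup>2 / \<epsilon> ^ (m + 4)) * (\<kappa> / ?w ^ (m + 4))"
    unfolding Zx power_mult_distrib by simp
  also have "Re (of_real (\<epsilon>\<^sup>2 / \<epsilon> ^ (m + 4)) * (\<kappa> / ?w ^ (m + 4))) = \<epsilon>\<^sup>2 / \<epsilon> ^ (m + 4) * Re (\<kappa> / ?w ^ (m + 4))"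
    by (rule Re_of_real_times)
  finally have "blow_up \<phi> \<epsilon> z = (\<epsilon>\<^sup>2 * (\<epsilon>\<^sup>2 / \<epsilon> ^ (m + 4))) * (cutoff x0 \<rho> ?x * f ?x * Re (\<kappa> / ?w ^ (m + 4)))"
    using x by (simp add: blow_up_def)
  \<comment> \<open>one factor \<open>\<epsilon>\<^sup>2\<close> is the Jacobian, the other the normalisation of the test function\<close>
  also have "\<epsilon>\<^sup>2 * (\<epsilon>\<^sup>2 / \<epsilon> ^ (m + 4)) = 1 / \<epsilon> ^ m"
  proof -
    have "\<epsilon> ^ (m + 4) = \<epsilon> ^ m * (\<epsilon>\<^sup>2 * \<epsilon>\<^sup>2)" by (simp add: power_add flip: power2_eq_square)
    then show ?thesis using \<epsilon> by simp
  qed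
  finally show ?thesis by simp
qed

text \<open>
  On the support, \<open>f / \<epsilon>\<^sup>m\<close> is bounded by a multiple of \<open>\<bar>z\<bar>\<^sup>m\<close> and the kernel bound on the cone applies.
\<close>

lemma blow_up_bound:
  assumes \<rho>: "0 < \<rho>" "\<rho> \<le> 1" "cball x0 \<rho> \<subseteq> ball 0 2" and L: "0 \<le> L"
    and cone: "\<And>x. x \<in> closure D \<Longrightarrow> norm (x - x0) \<le> \<rho> \<Longrightarrow> - L * \<bar>Re (Z x)\<bar> \<le> Im (Z x)"
    and \<epsilon>: "0 < \<epsilon>" and \<phi>: "test_at \<kappa> \<rho> (2 * L + 4) \<epsilon> \<phi>"
  shows "\<bar>blow_up \<phi> \<epsilon> z\<bar> \<le> ((cmod c + \<bar>K\<bar>) * cmod \<kappa> * (2 * L + 4) ^ (m + 4))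
      * (inverse (1 + (fst z)\<^sup>2) * inverse (1 + (snd z)\<^sup>2))" (is "_ \<le> ?C * ?W")
proof -
  let ?x = "pt \<epsilon> z" and ?z = "Complex (fst z) (snd z)" and ?\<Lambda> = "2 * L + 4"
  have W: "0 \<le> ?W" by simp
  have nn: "0 \<le> ?C * ?W" using L by (intro mult_nonneg_nonneg) auto
  show ?thesis
  proof (cases "?x \<in> D \<and> norm (?x - x0) < \<rho>")
    case False
    then have "blow_up \<phi> \<epsilon> z = 0"
      using \<phi> by (auto simp: blow_up_def test_at_def)
    then show ?thesis using nn by simp
  next
    case True
    then have xc: "?x \<in> closure D" using closure_subset by blast
    have xB: "?x \<in> ball 0 2" using True by (intro mem_ball_of_near[OF \<rho>(3)]) simp
    have cone1: "- L * \<bar>Re (Z ?x)\<bar> \<le> Im (Z ?x)" using cone[OF xc] True by simp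
    have nb: "norm (?x - x0) + \<epsilon> \<le> ?\<Lambda> * cmod (Z ?x + of_real \<epsilon> * \<i>)"
      using cone_norm_bound[OF cone1 L \<epsilon>] by (simp add: norm_Z)
    have "- L * \<bar>fst z\<bar> \<le> snd z"
    proof -
      have "\<epsilon> * (- L * \<bar>fst z\<bar>) \<le> \<epsilon> * snd z"
        using cone1 \<epsilon> by (simp add: Z_pt abs_mult algebra_simps)
      then show ?thesis using \<epsilon> by (simp only: mult_le_cancel_left_pos)
    qed
    then have kb: "cmod ?z ^ m / cmod (?z + \<i>) ^ (m + 4) \<le> ?\<Lambda> ^ (m + 4) * ?W"
      by (rule cone_kernel_bound) (rule L)
    have "\<bar>f ?x\<bar> \<le> (cmod c + \<bar>K\<bar>) * cmod (Z ?x) ^ m"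
      using True \<rho> by (intro leading_term_bound xB) auto
    also have "cmod (Z ?x) ^ m = \<epsilon> ^ m * cmod ?z ^ m"
      using \<epsilon> by (simp add: Z_pt norm_mult power_mult_distrib)
    finally have fb: "\<bar>f ?x / \<epsilon> ^ m\<bar> \<le> (cmod c + \<bar>K\<bar>) * cmod ?z ^ m"
      using \<epsilon> by (simp add: abs_divide pos_divide_le_eq mult_ac)
    have "\<bar>blow_up \<phi> \<epsilon> z\<bar> = cutoff x0 \<rho> ?x * \<bar>f ?x / \<epsilon> ^ m\<bar> * \<bar>Re (\<kappa> / (?z + \<i>) ^ (m + 4))\<bar>"
      using blow_up_inside[OF \<epsilon> _ \<phi> _ xB nb] True L cutoff_bounds(1)[OF \<rho>(1)]
      by (simp add: abs_mult)
    also have "\<dots> \<le> 1 * ((cmod c + \<bar>K\<bar>) * cmod ?z ^ m) * (cmod \<kappa> / cmod (?z + \<i>) ^ (m + 4))"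
    proof (intro mult_mono fb cutoff_bounds[OF \<rho>(1)])
      have "\<bar>Re (\<kappa> / (?z + \<i>) ^ (m + 4))\<bar> \<le> cmod (\<kappa> / (?z + \<i>) ^ (m + 4))" by (rule abs_Re_le_cmod)
      then show "\<bar>Re (\<kappa> / (?z + \<i>) ^ (m + 4))\<bar> \<le> cmod \<kappa> / cmod (?z + \<i>) ^ (m + 4)"
        by (simp only: norm_divide norm_power)
    qed auto
    also have "\<dots> = (cmod c + \<bar>K\<bar>) * cmod \<kappa> * (cmod ?z ^ m / cmod (?z + \<i>) ^ (m + 4))"
      by simp
    also have "\<dots> \<le> (cmod c + \<bar>K\<bar>) * cmod \<kappa> * (?\<Lambda> ^ (m + 4) * ?W)"
      by (rule mult_left_mono[OF kb]) simp
    finally show ?thesis by (simp only: mult.assoc)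
  qed
qed

text \<open>
  A point strictly above (below) the boundary lines of the sector is eventually above (below) the
  rescaled graph, and the remainder of \<open>f\<close> contributes a factor
  \<open>\<epsilon>\<^bsup>\<alpha>\<^esup>\<close>.
\<close>

lemma blow_up_tendsto:
  assumes \<rho>: "0 < \<rho>" "\<rho> < r" "cball x0 \<rho> \<subseteq> ball 0 2" and L: "0 \<le> L"
    and cone: "\<And>x. x \<in> closure D \<Longrightarrow> norm (x - x0) \<le> \<rho> \<Longrightarrow> - L * \<bar>Re (Z x)\<bar> \<le> Im (Z x)"
    and e: "\<And>n::nat. 0 < e n" "e \<longlonglongrightarrow> 0" and \<phi>: "\<And>n. test_at \<kappa> \<rho> (2 * L + 4) (e n) (\<phi> n)"
    and z: "s \<noteq> 0" "y \<noteq> (if s < 0 then a else b) * s"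
  shows "(\<lambda>n. blow_up (\<phi> n) (e n) (s, y)) \<longlonglongrightarrow> Re (\<kappa> * sector_integrand a b c m (s, y))"
proof -
  let ?x = "\<lambda>n. pt (e n) (s, y)" and ?z = "Complex s y" and ?\<sigma> = "(if s < 0 then a else b) * s"
  have enz: "e n \<noteq> 0" for n using e(1)[of n] by simp
  have nx: "norm (?x n - x0) = e n * cmod ?z" for n
    using norm_pt[of "e n" "(s, y)"] e(1)[of n] by simp
  have "(\<lambda>n. e n * cmod ?z) \<longlonglongrightarrow> 0 * cmod ?z" by (intro tendsto_intros e(2))
  then have "eventually (\<lambda>n. e n * cmod ?z < \<rho> / 2) sequentially"
    by (rule order_tendstoD) (use \<rho> in simp)
  then have near: "eventually (\<lambda>n. norm (?x n - x0) < \<rho> / 2) sequentially"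
    by (simp only: nx)
  have slope: "(\<lambda>n. \<eta> (e n * s) / e n) \<longlonglongrightarrow> ?\<sigma>"
  proof -
    have l: "(\<lambda>n. e n * s) \<longlonglongrightarrow> 0" using tendsto_mult_right[OF e(2), of s] by simp
    have "(\<lambda>n. \<eta> (e n * s) / (e n * s)) \<longlonglongrightarrow> (if s < 0 then a else b)"
    proof (cases "s < 0")
      case True
      have "filterlim (\<lambda>n. e n * s) (at_left 0) sequentially"
        using l True e(1) enz by (auto simp: filterlim_at mult_pos_neg intro!: always_eventually)
      from filterlim_compose[OF left_slope this] show ?thesis using True by simp
    next
      case False
      then have "filterlim (\<lambda>n. e n * s) (at_right 0) sequentially"
        using l z e(1) enz by (auto simp: filterlim_at intro!: always_eventually)
      from filterlim_compose[OF right_slope this] show ?thesis using False by simp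
    qed
    from tendsto_mult_right[OF this, of s] show ?thesis using z by simp
  qed
  have D_iff: "?x n \<in> D \<longleftrightarrow> \<eta> (e n * s) / e n < y" if "norm (?x n - x0) < \<rho> / 2" for n
  proof -
    have "norm (?x n - x0) < r" using that \<rho> by linarith
    then have "?x n \<in> D \<longleftrightarrow> \<eta> (Re (Z (?x n))) < Im (Z (?x n))" using epigraph by (simp add: Z_def)
    also have "\<dots> \<longleftrightarrow> \<eta> (e n * s) / e n < y"
      using e(1)[of n] by (simp add: Z_pt pos_divide_less_eq mult.commute)
    finally show ?thesis .
  qed
  show ?thesis
  proof (cases "?\<sigma> < y")
    case True
    have "eventually (\<lambda>n. \<eta> (e n * s) / e n < y) sequentially"
      by (rule order_tendstoD(2)[OF slope True])
    with near have "eventually (\<lambda>n. (f (?x n) / e n ^ m) * Re (\<kappa> / (?z + \<i>) ^ (m + 4)) = blow_up (\<phi> n) (e n) (s, y)) sequentially"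
    proof eventually_elim
      case (elim n)
      then have xD: "?x n \<in> D" using D_iff by simp
      have x\<rho>: "norm (?x n - x0) \<le> \<rho>" using elim \<rho> by linarith
      have xB: "?x n \<in> ball 0 2" by (rule mem_ball_of_near[OF \<rho>(3) x\<rho>])
      have c1: "- L * \<bar>Re (Z (?x n))\<bar> \<le> Im (Z (?x n))"
        using cone x\<rho> xD closure_subset by blast
      have nb: "norm (?x n - x0) + e n \<le> (2 * L + 4) * cmod (Z (?x n) + of_real (e n) * \<i>)"
        using cone_norm_bound[OF c1 L e(1)] by (simp add: norm_Z)
      have "cutoff x0 \<rho> (?x n) = 1" using elim by (intro cutoff_inside \<rho>) simp
      then show ?case
        using blow_up_inside[OF e(1) _ \<phi> xD xB nb] L by simp
    qed
    moreover have "(\<lambda>n. f (?x n) / e n ^ m) \<longlonglongrightarrow> Re (c * ?z ^ m)"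
    proof (rule LIM_zero_cancel, rule Lim_null_comparison)
      let ?M = "cmod ?z powr (real m + \<alpha>)"
      show "eventually (\<lambda>n. norm (f (?x n) / e n ^ m - Re (c * ?z ^ m)) \<le> K * ?M * e n powr \<alpha>) sequentially"
        using near
      proof eventually_elim
        case (elim n)
        have "norm (?x n - x0) \<le> \<rho>" using elim \<rho> by linarith
        then have xB: "?x n \<in> ball 0 2" by (rule mem_ball_of_near[OF \<rho>(3)])
        have "\<bar>f (?x n) - Re (c * Z (?x n) ^ m)\<bar> \<le> K * norm (?x n - x0) powr (real m + \<alpha>)"
          using leading[of "?x n - x0"] xB by (simp add: Z_def)
        also have "norm (?x n - x0) powr (real m + \<alpha>) = e n ^ m * (?M * e n powr \<alpha>)"
          unfolding nx using e(1)[of n] by (simp add: powr_mult powr_add powr_realpow)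
        finally have 1: "\<bar>f (?x n) - Re (c * Z (?x n) ^ m)\<bar> \<le> K * (e n ^ m * (?M * e n powr \<alpha>))" .
        have "c * Z (?x n) ^ m = of_real (e n ^ m) * (c * ?z ^ m)"
          by (simp add: Z_pt power_mult_distrib)
        then have "Re (c * Z (?x n) ^ m) = e n ^ m * Re (c * ?z ^ m)"
          by (simp only: Re_of_real_times)
        then have "f (?x n) / e n ^ m - Re (c * ?z ^ m) = (f (?x n) - Re (c * Z (?x n) ^ m)) / e n ^ m"
          using e(1)[of n] by (simp add: diff_divide_distrib)
        then have "norm (f (?x n) / e n ^ m - Re (c * ?z ^ m)) = \<bar>f (?x n) - Re (c * Z (?x n) ^ m)\<bar> / e n ^ m"
          using e(1)[of n] by (simp add: abs_divide)
        also have "\<dots> \<le> K * (e n ^ m * (?M * e n powr \<alpha>)) / e n ^ m"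
          using 1 e(1)[of n] by (intro divide_right_mono) auto
        also have "\<dots> = K * ?M * e n powr \<alpha>" using e(1)[of n] by simp
        finally show ?case .
      qed
      have "(\<lambda>n. e n powr \<alpha>) \<longlonglongrightarrow> 0"
        using e \<alpha> by (intro tendsto_zero_powrI[OF _ tendsto_const]) (auto intro!: always_eventually less_imp_le)
      then show "(\<lambda>n. K * ?M * e n powr \<alpha>) \<longlonglongrightarrow> 0" by (rule tendsto_mult_right_zero)
    qed
    then have "(\<lambda>n. (f (?x n) / e n ^ m) * Re (\<kappa> / (?z + \<i>) ^ (m + 4))) \<longlonglongrightarrow> Re (c * ?z ^ m) * Re (\<kappa> / (?z + \<i>) ^ (m + 4))"
      by (intro tendsto_intros)
    moreover have "Re (c * ?z ^ m) * Re (\<kappa> / (?z + \<i>) ^ (m + 4)) = Re (\<kappa> * sector_integrand a b c m (s, y))"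
    proof -
      have "\<kappa> * sector_integrand a b c m (s, y) = of_real (Re (c * ?z ^ m)) * (\<kappa> / (?z + \<i>) ^ (m + 4))"
        using True by (simp add: sector_integrand_def mult_ac)
      then show ?thesis by (simp only: Re_of_real_times)
    qed
    ultimately show ?thesis by (simp add: Lim_transform_eventually)
  next
    case False
    then have "y < ?\<sigma>" using z by linarith
    then have "eventually (\<lambda>n. y < \<eta> (e n * s) / e n) sequentially"
      by (rule order_tendstoD(1)[OF slope])
    with near have "eventually (\<lambda>n. blow_up (\<phi> n) (e n) (s, y) = 0) sequentially"
    proof eventually_elim
      case (elim n)
      then have "?x n \<notin> D" using D_iff by simp
      then show ?case by (simp add: blow_up_def)
    qed
    moreover have "sector_integrand a b c m (s, y) = 0"
      using False by (simp add: sector_integrand_def)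
    ultimately show ?thesis by (simp add: tendsto_eventually)
  qed
qed

text \<open>
  The two sides of the distributional identity for the rescaled kernels: one tends to \<open>0\<close>, the other to
  the integral over the sector.
\<close>

lemma sector_integral_orthogonal:
  "Re (\<kappa> * (\<integral>z. sector_integrand a b c m z \<partial>plane)) = 0"
proof -
  obtain \<rho> L where \<rho>: "0 < \<rho>" "\<rho> \<le> 1" "\<rho> < r" "cball x0 \<rho> \<subseteq> ball 0 2" and L: "0 \<le> L"
    and cone: "\<And>x. x \<in> closure D \<Longrightarrow> norm (x - x0) \<le> \<rho> \<Longrightarrow> - L * \<bar>Re (Z x)\<bar> \<le> Im (Z x)"
    using cone_near_corner by blast
  let ?\<Lambda> = "2 * L + 4"
  have \<Lambda>: "0 < ?\<Lambda>" using L by simp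
  have cone': "norm (x - x0) + \<epsilon> \<le> ?\<Lambda> * cmod (Z x + of_real \<epsilon> * \<i>)"
    if "x \<in> closure D" "norm (x - x0) \<le> \<rho>" "0 < \<epsilon>" for x \<epsilon>
    using cone_norm_bound[OF cone[OF that(1,2)] L that(3)] by (simp add: norm_Z)
  define e :: "nat \<Rightarrow> real" where "e n = inverse (real (Suc n))" for n
  have e: "0 < e n" "e \<longlonglongrightarrow> 0" for n
    unfolding e_def by (simp, rule LIMSEQ_inverse_real_of_nat)
  have "\<exists>\<phi>. \<forall>n. test_at \<kappa> \<rho> ?\<Lambda> (e n) (\<phi> n)"
    using test_at_exists[OF \<rho>(1) \<Lambda> e(1)] by (intro choice allI)
  then obtain \<phi> where \<phi>: "\<And>n. test_at \<kappa> \<rho> ?\<Lambda> (e n) (\<phi> n)" by blast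
  have smooth: "elem_smooth (\<phi> n)" for n using \<phi>[of n] by (simp add: test_at_def)
  have "test_function (ball 0 2) (\<phi> n)" for n
    by (rule elem_smooth_test_function[OF smooth _ \<rho>(4)]) (use \<phi>[of n] in \<open>simp add: test_at_def\<close>)
  then have "(\<integral>x. u x * laplacian (\<phi> n) x \<partial>lebesgue_on (ball 0 2)) = (\<integral>z. blow_up (\<phi> n) (e n) z \<partial>plane)" for n
    using weak_poisson_laplacian[OF open_ball weak] pairing_eq_blow_up[OF smooth e(1)] by simp
  then have lim0: "(\<lambda>n. \<integral>z. blow_up (\<phi> n) (e n) z \<partial>plane) \<longlonglongrightarrow> 0"
    using laplacian_pairing_tendsto_0[OF \<rho>(1,4) \<Lambda> cone' e \<phi>] by simp
  let ?F = "\<lambda>z. Re (\<kappa> * sector_integrand a b c m z)"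
  let ?C = "(cmod c + \<bar>K\<bar>) * cmod \<kappa> * ?\<Lambda> ^ (m + 4)"
  let ?W = "\<lambda>z. ?C * (inverse (1 + (fst z)\<^sup>2) * inverse (1 + (snd z)\<^sup>2))"
  have "(\<lambda>n. \<integral>z. blow_up (\<phi> n) (e n) z \<partial>plane) \<longlonglongrightarrow> (\<integral>z. ?F z \<partial>plane)"
  proof (rule integral_dominated_convergence[where w = ?W])
    show "?F \<in> borel_measurable plane" by measurable
    show "blow_up (\<phi> n) (e n) \<in> borel_measurable plane" for n
      by (rule blow_up_measurable(2)[OF smooth])
    show "integrable plane ?W"
      by (rule Bochner_Integration.integrable_mult_right, rule integrable_product_dominator)
    show "AE z in plane. norm (blow_up (\<phi> n) (e n) z) \<le> ?W z" for n
      using blow_up_bound[OF \<rho>(1,2,4) L cone e(1) \<phi>] by (intro AE_I2) simp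
    have "AE z in plane. fst z \<noteq> 0 \<and> snd z \<noteq> (if fst z < 0 then a else b) * fst z"
    proof (rule lborel_pair.AE_pair_measure)
      show "{z \<in> space plane. fst z \<noteq> 0 \<and> snd z \<noteq> (if fst z < 0 then a else b) * fst z} \<in> sets plane"
        by measurable
      have "AE s in lborel. s \<noteq> (0::real)" by (rule AE_lborel_singleton)
      then show "AE s in lborel. AE y in lborel. fst (s, y) \<noteq> 0 \<and> snd (s, y) \<noteq> (if fst (s, y) < 0 then a else b) * fst (s, y)"
      proof eventually_elim
        case (elim s)
        have "AE y in lborel. y \<noteq> (if s < 0 then a else b) * s" by (rule AE_lborel_singleton)
        then show ?case using elim by simp
      qed
    qed
    then show "AE z in plane. (\<lambda>n. blow_up (\<phi> n) (e n) z) \<longlonglongrightarrow> ?F z"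
    proof eventually_elim
      case (elim z)
      then show ?case
        using blow_up_tendsto[OF \<rho>(1,3,4) L cone e \<phi>, of "fst z" "snd z"] unfolding prod.collapse by blast
    qed
  qed
  then have "(\<integral>z. ?F z \<partial>plane) = 0"
    using lim0 by (rule LIMSEQ_unique)
  moreover have "(\<integral>z. ?F z \<partial>plane) = Re (\<integral>z. \<kappa> * sector_integrand a b c m z \<partial>plane)"
    by (intro integral_Re Bochner_Integration.integrable_mult_right sector_integrand_integrable)
  ultimately show ?thesis by simp
qed

lemma one_sided_slopes_agree:
  assumes "Re (c * w ^ m) \<noteq> 0"
  shows "a = b"
proof -
  let ?I = "\<integral>z. sector_integrand a b c m z \<partial>plane"
  \<comment> \<open>the free factor \<open>\<kappa>\<close> is chosen to be the conjugate of the integral itself\<close>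
  have "Re (cnj ?I * ?I) = 0" by (rule sector_integral_orthogonal)
  then have "?I = 0" by (simp add: complex_eq_iff sum_squares_eq_zero_iff)
  moreover have "(of_nat (m + 2) * of_nat (m + 3) :: complex) \<noteq> 0"
    by (simp only: of_nat_mult[symmetric] of_nat_eq_0_iff) simp
  ultimately have "- (\<i> / 4) * (slope_primitive c m (cayley a) - slope_primitive c m (cayley b)) = 0"
    unfolding sector_integral by (simp only: divide_eq_0_iff) blast
  then have "slope_primitive c m (cayley a) = slope_primitive c m (cayley b)" by simp
  from slope_primitive_inj[OF this norm_cayley norm_cayley assms] show ?thesis
    by (rule cayley_inj)
qed

end

lemma Hoelder_loc_continuous_on:
  assumes f: "Hoelder_loc \<alpha> U f" and U: "open U" and \<alpha>: "0 < \<alpha>"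
  shows "continuous_on U f"
  unfolding continuous_on_eq_continuous_at[OF U]
proof
  fix x assume "x \<in> U"
  then obtain d where d: "0 < d" "cball x d \<subseteq> U" using U open_contains_cball by blast
  then obtain L where L: "\<And>y z. y \<in> cball x d \<Longrightarrow> z \<in> cball x d \<Longrightarrow> \<bar>f y - f z\<bar> \<le> L * norm (y - z) powr \<alpha>"
    using f unfolding Hoelder_loc_def by (meson compact_cball)
  have "((\<lambda>y. f y - f x) \<longlongrightarrow> 0) (at x)"
  proof (rule Lim_null_comparison)
    have "eventually (\<lambda>y. y \<in> ball x d) (at x)" using d by (intro eventually_at_in_open') auto
    then show "eventually (\<lambda>y. norm (f y - f x) \<le> L * norm (y - x) powr \<alpha>) (at x)"
      by eventually_elim (use L[of _ x] d in auto)
    have "((\<lambda>y. norm (y - x)) \<longlongrightarrow> norm (x - x)) (at x)" by (intro tendsto_intros)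
    then have "((\<lambda>y. norm (y - x) powr \<alpha>) \<longlongrightarrow> 0) (at x)"
      using \<alpha> by (intro tendsto_zero_powrI[OF _ tendsto_const]) auto
    then show "((\<lambda>y. L * norm (y - x) powr \<alpha>) \<longlongrightarrow> 0) (at x)" by (rule tendsto_mult_right_zero)
  qed
  then show "isCont f x" by (simp add: isCont_def LIM_zero_iff)
qed

text \<open>
  The rotation into graph coordinates multiplies \<open>z\<close> by a unimodular \<open>\<omega>\<close>, which replaces the
  coefficient \<open>c\<close> of the leading term by \<open>c cnj \<omega>\<^sup>m\<close>.
\<close>

lemma epigraph_slopes_agree:
  fixes D :: "(real^2) set" and u f H R :: "real^2 \<Rightarrow> real"
  assumes D: "open D" and x0: "x0 \<in> ball 0 2"
    and weak: "weak_poisson (ball 0 2) u (\<lambda>x. f x * indicator D x)"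
    and zero: "AE x in lebesgue. x \<in> ball 0 2 - closure D \<longrightarrow> u x = 0"
    and \<alpha>: "0 < \<alpha>" and f: "Hoelder_loc \<alpha> (ball 0 2) f"
    and f_eq: "\<And>x. x0 + x \<in> ball 0 2 \<Longrightarrow> f (x0 + x) = H x + R x"
    and H: "homogeneous_polynomial m H" "harmonic H" "H v \<noteq> 0"
    and R: "\<And>x. x0 + x \<in> ball 0 2 \<Longrightarrow> \<bar>R x\<bar> \<le> C * norm x powr (real m + \<alpha>)"
    and A: "rotation_matrix A" and r: "0 < r"
    and epi: "\<And>x. norm (x - x0) < r \<Longrightarrow> x \<in> D \<longleftrightarrow> \<eta> ((A *v (x - x0)) $ 1) < (A *v (x - x0)) $ 2"
    and \<eta>: "\<eta> 0 = 0" "((\<lambda>t. \<eta> t / t) \<longlongrightarrow> a) (at_left 0)" "((\<lambda>t. \<eta> t / t) \<longlongrightarrow> b) (at_right 0)"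
  shows "a = b"
proof -
  obtain c where c: "\<And>x. H x = Re (c * cplx x ^ m)"
    using harmonic_homogeneous_polynomial_eq[OF H(1,2)] by blast
  obtain \<omega> where \<omega>: "cmod \<omega> = 1" "\<And>v. cplx (A *v v) = \<omega> * cplx v"
    using rotation_matrix_cplx[OF A] by blast
  let ?c = "c * cnj \<omega> ^ m"
  have "cnj \<omega> * \<omega> = 1" using complex_norm_square[of \<omega>] \<omega>(1) by (simp add: mult.commute)
  then have Hc: "H x = Re (?c * cplx (A *v x) ^ m)" for x
    unfolding c \<omega>(2) mult.assoc power_mult_distrib[symmetric] by (simp add: mult.assoc[symmetric])
  interpret boundary_corner D u f x0 A r a b \<alpha> C \<eta> ?c m
  proof
    show "\<bar>f (x0 + v) - Re (?c * cplx (A *v v) ^ m)\<bar> \<le> C * norm v powr (real m + \<alpha>)"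
      if "x0 + v \<in> ball 0 2" for v
      using f_eq[OF that] R[OF that] by (simp only: Hc[symmetric])
  qed (use D x0 weak zero \<alpha> A r epi \<eta> Hoelder_loc_continuous_on[OF f open_ball \<alpha>] in auto)
  show ?thesis
    by (rule one_sided_slopes_agree[of "cplx (A *v v)"]) (use H(3) Hc in simp)
qed

section \<open>Convex functions of one variable\<close>

text \<open>
  The difference quotients decrease as \<open>h\<close> decreases to \<open>0\<close>, and any difference quotient to the left of
  \<open>x\<close> bounds them below.
\<close>

lemma convex_right_slope_limit:
  fixes g :: "real \<Rightarrow> real"
  assumes g: "convex_on I g" and I: "open I" "x \<in> I"
  obtains b where "((\<lambda>h. (g (x + h) - g x) / h) \<longlongrightarrow> b) (at_right 0)"
proof -
  obtain d where d: "0 < d" "cball x d \<subseteq> I" using I open_contains_cball by blast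
  have inI: "x + h \<in> I" if "\<bar>h\<bar> \<le> d" for h using that d(2) by (auto simp: dist_real_def)
  let ?q = "\<lambda>h. (g (x + h) - g x) / h"
  have q_swap: "(g x - g (x + h)) / (x - (x + h)) = ?q h" for h
    by (subst minus_divide_divide[symmetric]) simp
  have mono: "?q h \<le> ?q k" if "0 < h" "h < k" "k \<le> d" for h k
    using convex_on_slope_le(1)[OF g inI[of 0] inI[of k], of "x + h"] that d
    unfolding q_swap[symmetric] by simp
  have lower: "?q (- d) \<le> ?q h" if "0 < h" "h \<le> d" for h
  proof -
    have "(g (x - d) - g x) / (x - d - x) \<le> (g (x - d) - g (x + h)) / (x - d - (x + h))"
      using convex_on_slope_le(1)[OF g inI[of "- d"] inI[of h], of x] that d by simp
    also have "\<dots> \<le> (g x - g (x + h)) / (x - (x + h))"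
      using convex_on_slope_le(2)[OF g inI[of "- d"] inI[of h], of x] that d by simp
    finally show ?thesis unfolding q_swap by simp
  qed
  let ?S = "?q ` {0<..d}"
  have ne: "?S \<noteq> {}" using d by auto
  have bdd: "bdd_below ?S" using lower by (intro bdd_belowI[of _ "?q (- d)"]) auto
  have "(?q \<longlongrightarrow> Inf ?S) (at_right 0)"
  proof (rule order_tendstoI)
    fix l assume "l < Inf ?S"
    moreover have "eventually (\<lambda>h. h \<in> {0<..<d}) (at_right 0)" by (rule eventually_at_right_real[OF d(1)])
    moreover have "Inf ?S \<le> ?q h" if "h \<in> {0<..<d}" for h
      by (rule cInf_lower[OF _ bdd]) (use that in auto)
    ultimately show "eventually (\<lambda>h. l < ?q h) (at_right 0)"
      by (smt (verit, ccfv_threshold) eventually_mono)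
  next
    fix l assume "Inf ?S < l"
    then obtain k where k: "0 < k" "k \<le> d" "?q k < l"
      using cInf_less_iff[OF ne bdd] by auto
    have "eventually (\<lambda>h. h \<in> {0<..<k}) (at_right 0)" by (rule eventually_at_right_real[OF k(1)])
    then show "eventually (\<lambda>h. ?q h < l) (at_right 0)"
    proof eventually_elim
      case (elim h)
      then have "?q h \<le> ?q k" by (intro mono k) auto
      then show ?case using k(3) by simp
    qed
  qed
  then show thesis by (rule that)
qed

lemma convex_left_slope_limit:
  fixes g :: "real \<Rightarrow> real"
  assumes g: "convex_on I g" and I: "open I" "x \<in> I"
  obtains a where "((\<lambda>h. (g (x + h) - g x) / h) \<longlongrightarrow> a) (at_left 0)"
proof -
  have "convex_on (uminus ` I) (\<lambda>t. g (- t))"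
    unfolding convex_on_def
  proof (intro conjI ballI allI impI)
    show "convex (uminus ` I)" using convex_on_imp_convex[OF g] by (rule convex_negations)
    fix s t u v :: real
    assume "s \<in> uminus ` I" "t \<in> uminus ` I" and u: "0 \<le> u" "0 \<le> v" "u + v = 1"
    then have "- s \<in> I" "- t \<in> I" by auto
    then have "g (u *\<^sub>R (- s) + v *\<^sub>R (- t)) \<le> u * g (- s) + v * g (- t)"
      using g u unfolding convex_on_def by blast
    then show "g (- (u *\<^sub>R s + v *\<^sub>R t)) \<le> u * g (- s) + v * g (- t)" by simp
  qed
  moreover have "open (uminus ` I)" "- x \<in> uminus ` I" using I by (auto intro: open_negations)
  ultimately obtain b where "((\<lambda>h. (g (- (- x + h)) - g (- (- x))) / h) \<longlongrightarrow> b) (at_right 0)"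
    by (rule convex_right_slope_limit)
  then have "((\<lambda>h. - ((g (- (- x + h)) - g (- (- x))) / h)) \<longlongrightarrow> - b) (at_right 0)"
    by (rule tendsto_minus)
  then have "((\<lambda>h. (g (x + h) - g x) / h) \<longlongrightarrow> - b) (at_left 0)"
    by (simp add: filterlim_at_left_to_right)
  then show thesis by (rule that)
qed

text \<open>
  A secant from \<open>x\<close> to a fixed point on the right has slope close to \<open>g' x\<close>. Its slope depends
  continuously on the base point and bounds the derivative there from above; secants to the left give the
  lower bound.
\<close>

lemma convex_derivative_continuous:
  fixes g g' :: "real \<Rightarrow> real"
  assumes g: "convex_on I g" and I: "open I" and d: "\<And>x. x \<in> I \<Longrightarrow> (g has_real_derivative g' x) (at x)"
  shows "continuous_on I g'"
  unfolding continuous_on_eq_continuous_at[OF I]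
proof
  fix x assume x: "x \<in> I"
  obtain e where e: "0 < e" "ball x e \<subseteq> I" using I x open_contains_ball by blast
  have con: "connected I" using convex_on_imp_convex[OF g] by (rule convex_connected)
  have tangent: "g' s * (t - s) \<le> g t - g s" if "s \<in> I" "t \<in> I" for s t
    using convex_on_imp_above_tangent[OF g con _ that(2) has_field_derivative_at_within[OF d[OF that(1)]]] that I
    by (simp add: interior_open)
  have quot: "((\<lambda>s. (g t - g s) / (t - s)) \<longlongrightarrow> (g t - g x) / (t - x)) (at x)" if "t \<noteq> x" for t
    using that DERIV_isCont[OF d[OF x]] unfolding isCont_def by (intro tendsto_intros) auto
  have ev: "((\<lambda>h. (g (x + h) - g x) / h) \<longlongrightarrow> g' x) (at 0)"
    using d[OF x] by (simp add: DERIV_def)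
  have evI: "eventually (\<lambda>s. s \<in> I) (at x)" using I x by (rule eventually_at_in_open')
  show "isCont g' x"
    unfolding isCont_def
  proof (rule order_tendstoI)
    fix l assume "g' x < l"
    then have "eventually (\<lambda>h. (g (x + h) - g x) / h < l) (at_right 0)"
      using order_tendstoD(2)[OF filterlim_mono[OF ev order_refl at_le]] by simp
    moreover have "eventually (\<lambda>h. h \<in> {0<..<e}) (at_right 0)" by (rule eventually_at_right_real[OF e(1)])
    ultimately have "eventually (\<lambda>h. h \<in> {0<..<e} \<and> (g (x + h) - g x) / h < l) (at_right 0)"
      by (rule eventually_conj[rotated])
    then have "\<exists>h. h \<in> {0<..<e} \<and> (g (x + h) - g x) / h < l"
      by (rule eventually_happens'[OF trivial_limit_at_right_real])
    then obtain h where h: "0 < h" "h < e" "(g (x + h) - g x) / h < l" by auto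
    have tI: "x + h \<in> I" using h e by (auto simp: dist_real_def)
    have "eventually (\<lambda>s. (g (x + h) - g s) / (x + h - s) < l) (at x)"
      by (rule order_tendstoD(2)[OF quot]) (use h in auto)
    moreover have "eventually (\<lambda>s. s < x + h) (at x)"
      by (rule order_tendstoD(2)[OF tendsto_ident_at]) (use h in simp)
    ultimately show "eventually (\<lambda>s. g' s < l) (at x)"
      using evI
    proof eventually_elim
      case (elim s)
      then have "g' s \<le> (g (x + h) - g s) / (x + h - s)"
        using tangent[OF elim(3) tI] by (simp add: pos_le_divide_eq)
      then show ?case using elim by simp
    qed
  next
    fix l assume "l < g' x"
    then have "eventually (\<lambda>h. l < (g (x + h) - g x) / h) (at_left 0)"
      using order_tendstoD(1)[OF filterlim_mono[OF ev order_refl at_le]] by simp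
    moreover have "eventually (\<lambda>h. h \<in> {- e<..<0}) (at_left 0)" by (rule eventually_at_left_real) (use e in simp)
    ultimately have "eventually (\<lambda>h. h \<in> {- e<..<0} \<and> l < (g (x + h) - g x) / h) (at_left 0)"
      by (rule eventually_conj[rotated])
    then have "\<exists>h. h \<in> {- e<..<0} \<and> l < (g (x + h) - g x) / h"
      by (rule eventually_happens'[OF trivial_limit_at_left_real])
    then obtain h where h: "h < 0" "- e < h" "l < (g (x + h) - g x) / h" by auto
    have tI: "x + h \<in> I" using h e by (auto simp: dist_real_def)
    have "eventually (\<lambda>s. l < (g (x + h) - g s) / (x + h - s)) (at x)"
      by (rule order_tendstoD(1)[OF quot]) (use h in auto)
    moreover have "eventually (\<lambda>s. x + h < s) (at x)"
      by (rule order_tendstoD(1)[OF tendsto_ident_at]) (use h in simp)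
    ultimately show "eventually (\<lambda>s. l < g' s) (at x)"
      using evI
    proof eventually_elim
      case (elim s)
      then have "(g (x + h) - g s) / (x + h - s) \<le> g' s"
        using tangent[OF elim(3) tI] by (simp add: neg_divide_le_eq)
      then show ?case using elim by simp
    qed
  qed
qed

section \<open>Domains above a graph\<close>

lemma epigraph_near_iff:
  fixes A :: "real^2^2"
  assumes A: "rotation_matrix A"
  shows "((\<lambda>x. A *v (x - x0)) ` D) \<inter> ball 0 r = {y. y $ 2 > \<eta> (y $ 1)} \<inter> ball 0 r
    \<longleftrightarrow> (\<forall>x. norm (x - x0) < r \<longrightarrow> (x \<in> D \<longleftrightarrow> \<eta> ((A *v (x - x0)) $ 1) < (A *v (x - x0)) $ 2))"
    (is "?L = ?R \<longleftrightarrow> ?P")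
proof -
  have o: "orthogonal_matrix A" using A by (simp add: rotation_matrix_def)
  note n = orthogonal_matrix_norm[OF o]
  have inv: "A *v (x0 + transpose A *v y - x0) = y" for y
    using o by (simp add: orthogonal_matrix_def matrix_vector_mul_assoc del: transpose_matrix_vector)
  have inj: "A *v (x - x0) = A *v (x' - x0) \<Longrightarrow> x = x'" for x x'
    using n[of "(x - x0) - (x' - x0)"] by (simp add: matrix_vector_mult_diff_distrib)
  have img: "A *v (x - x0) \<in> (\<lambda>x. A *v (x - x0)) ` D \<longleftrightarrow> x \<in> D" for x
    using inj by blast
  show ?thesis
  proof
    assume eq: "?L = ?R"
    show ?P
    proof (intro allI impI)
      fix x assume "norm (x - x0) < r"
      then have "A *v (x - x0) \<in> ball 0 r" by (simp add: n)
      then show "x \<in> D \<longleftrightarrow> \<eta> ((A *v (x - x0)) $ 1) < (A *v (x - x0)) $ 2"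
        using eq img[of x] by blast
    qed
  next
    assume P: ?P
    have "y \<in> ?L \<longleftrightarrow> y \<in> ?R" for y
    proof -
      define x where "x = x0 + transpose A *v y"
      have y: "y = A *v (x - x0)" using inv[of y] by (simp only: x_def)
      show ?thesis
      proof (cases "norm (x - x0) < r")
        case True
        then have "y \<in> ball 0 r" by (simp add: y n)
        then show ?thesis using P True img[of x] unfolding y by blast
      next
        case False
        then have "y \<notin> ball 0 r" by (simp add: y n)
        then show ?thesis by blast
      qed
    qed
    then show "?L = ?R" by blast
  qed
qed

text \<open>
  The boundary point is not in \<open>D\<close>, so the graph does not lie below it; by continuity a graph strictly
  above it would separate it from \<open>D\<close>.
\<close>

lemma graph_through_boundary_point:
  fixes A :: "real^2^2"
  assumes D: "open D" "x0 \<in> frontier D" and A: "rotation_matrix A" and r: "0 < r"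
    and epi: "\<And>x. norm (x - x0) < r \<Longrightarrow> x \<in> D \<longleftrightarrow> \<eta> ((A *v (x - x0)) $ 1) < (A *v (x - x0)) $ 2"
    and cont: "continuous (at 0 within {- d..d}) \<eta>" and d: "0 < d"
  shows "\<eta> 0 = 0"
proof (rule antisym)
  have o: "orthogonal_matrix A" using A by (simp add: rotation_matrix_def)
  have "x0 \<notin> D" using D by (auto simp: frontier_def interior_open)
  then show "0 \<le> \<eta> 0" using epi[of x0] r by simp
  show "\<eta> 0 \<le> 0"
  proof (rule ccontr)
    assume "\<not> \<eta> 0 \<le> 0"
    then have pos: "\<eta> 0 / 2 < \<eta> 0" "0 < \<eta> 0" by auto
    have "eventually (\<lambda>t. \<eta> 0 / 2 < \<eta> t) (at 0 within {- d..d})"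
      using cont pos unfolding continuous_within by (intro order_tendstoD(1))
    then obtain e where e: "0 < e" "\<And>t. t \<in> {- d..d} \<Longrightarrow> t \<noteq> 0 \<Longrightarrow> \<bar>t\<bar> < e \<Longrightarrow> \<eta> 0 / 2 < \<eta> t"
      by (auto simp: eventually_at)
    define k where "k = min (min r d) (min e (\<eta> 0 / 2))"
    have k: "0 < k" using r d e pos by (simp add: k_def)
    obtain y where y: "y \<in> D" "dist y x0 < k"
      using D(2) k unfolding frontier_def Diff_iff closure_approachable by blast
    let ?v = "A *v (y - x0)"
    have n: "norm ?v < k" using y(2) by (simp add: orthogonal_matrix_norm[OF o] dist_norm)
    have c: "\<bar>?v $ 1\<bar> < k" "\<bar>?v $ 2\<bar> < k"
      using component_le_norm_cart[of ?v 1] component_le_norm_cart[of ?v 2] n by linarith+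
    have "\<eta> (?v $ 1) < ?v $ 2"
      using epi[of y] y by (simp add: k_def dist_norm)
    moreover have "\<eta> 0 / 2 < \<eta> (?v $ 1)"
    proof (cases "?v $ 1 = 0")
      case False
      have "\<bar>?v $ 1\<bar> < e" "\<bar>?v $ 1\<bar> < d" using c(1) by (simp_all add: k_def)
      then show ?thesis by (intro e(2) False) auto
    qed (use pos in simp)
    moreover have "\<bar>?v $ 2\<bar> < \<eta> 0 / 2" using c(2) by (simp add: k_def)
    ultimately show False by linarith
  qed
qed

lemma C1_on_glue:
  assumes l: "C1_on {- r..0} \<eta>" and g: "C1_on {0..r} \<eta>" and r: "0 < r"
    and eq: "\<And>a b. ((\<lambda>t. (\<eta> t - \<eta> 0) / t) \<longlongrightarrow> a) (at_left 0) \<Longrightarrow> ((\<lambda>t. (\<eta> t - \<eta> 0) / t) \<longlongrightarrow> b) (at_right 0) \<Longrightarrow> a = b"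
  shows "C1_on {- r..r} \<eta>"
proof -
  obtain p where p: "continuous_on {- r..0} p" "\<And>t. t \<in> {- r..0} \<Longrightarrow> (\<eta> has_real_derivative p t) (at t within {- r..0})"
    using l unfolding C1_on_def by blast
  obtain q where q: "continuous_on {0..r} q" "\<And>t. t \<in> {0..r} \<Longrightarrow> (\<eta> has_real_derivative q t) (at t within {0..r})"
    using g unfolding C1_on_def by blast
  have "((\<lambda>t. (\<eta> t - \<eta> 0) / t) \<longlongrightarrow> p 0) (at_left 0)" "((\<lambda>t. (\<eta> t - \<eta> 0) / t) \<longlongrightarrow> q 0) (at_right 0)"
    using p(2)[of 0] q(2)[of 0] r
    by (simp_all add: has_field_derivative_iff at_within_Icc_at_left at_within_Icc_at_right)
  then have pq: "p 0 = q 0" by (rule eq)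
  have un: "{- r..r} = {- r..0} \<union> {0..r}" using r by auto
  define w where "w t = (if t \<le> 0 then p t else q t)" for t
  have "continuous_on {- r..r} w"
    unfolding un w_def by (rule continuous_on_cases) (use p q pq in auto)
  moreover have "(\<eta> has_real_derivative w t) (at t within {- r..r})" if "t \<in> {- r..r}" for t
  proof -
    have "((\<lambda>y. (\<eta> y - \<eta> t) / (y - t)) \<longlongrightarrow> w t) (at t within {- r..0})"
    proof (cases "t \<le> 0")
      case True
      then show ?thesis using p(2)[of t] that by (simp add: has_field_derivative_iff w_def)
    next
      case False
      then have "at t within {- r..0} = bot" by (subst at_within_eq_bot_iff) auto
      then show ?thesis by simp
    qed
    moreover have "((\<lambda>y. (\<eta> y - \<eta> t) / (y - t)) \<longlongrightarrow> w t) (at t within {0..r})"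
    proof (cases "0 \<le> t")
      case True
      then show ?thesis using q(2)[of t] that pq by (auto simp: has_field_derivative_iff w_def)
    next
      case False
      then have "at t within {0..r} = bot" by (subst at_within_eq_bot_iff) auto
      then show ?thesis by simp
    qed
    ultimately show ?thesis
      unfolding has_field_derivative_iff un Lim_within_Un by blast
  qed
  ultimately show ?thesis unfolding C1_on_def by blast
qed

text \<open>
  Rotate so that an interior point lies straight above the origin at height \<open>T\<close>. Over a short interval
  every vertical line meets a ball around that point, hence meets the domain in an interval which contains
  height \<open>T\<close>, and its lower end is a convex function of the abscissa.
\<close>

lemma convex_set_local_epigraph:
  fixes D :: "(real^2) set"
  assumes D: "open D" "convex D" "0 \<in> frontier D"
  obtains A :: "real^2^2" and r \<delta> :: real and \<eta> where "rotation_matrix A" "0 < r" "0 < \<delta>" "convex_on {- \<delta><..<\<delta>} \<eta>"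
    "\<And>x. norm x < r \<Longrightarrow> x \<in> D \<longleftrightarrow> \<eta> ((A *v x) $ 1) < (A *v x) $ 2"
proof -
  have 0: "0 \<notin> D" using D by (auto simp: frontier_def interior_open)
  have "D \<noteq> {}" using D(3) by auto
  then obtain p where p: "p \<in> D" by blast
  define T where "T = norm p"
  have T: "0 < T" using p 0 by (auto simp: T_def)
  define vec where "vec s t = (vector [s, t] :: real^2)" for s t
  have vec: "vec s t $ 1 = s" "vec s t $ 2 = t" for s t by (simp_all add: vec_def vector_2)
  have vec_eq: "y = vec (y $ 1) (y $ 2)" for y by (simp add: vec_eq_iff forall_2 vec)
  have "norm (vec 0 T) = T" using T by (simp add: norm_vec_def L2_set_def sum_2 vec)
  then have "norm p = norm (vec 0 T)" by (simp only: T_def)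
  then obtain h where h: "orthogonal_transformation h" "det (matrix h) = 1" "h p = vec 0 T"
    using rotation_exists[of p "vec 0 T"] by auto
  define A where "A = matrix h"
  have hA: "h = (*v) A" using h(1) by (simp add: A_def matrix_vector_mul orthogonal_transformation_linear)
  have A: "rotation_matrix A"
    using h by (simp add: A_def rotation_matrix_def orthogonal_transformation_matrix)
  have o: "orthogonal_matrix A" using A by (simp add: rotation_matrix_def)
  define E where "E = (\<lambda>y. transpose A *v y) -` D"
  have E_iff: "A *v x \<in> E \<longleftrightarrow> x \<in> D" for x
    using o by (simp add: E_def orthogonal_matrix_def matrix_vector_mul_assoc del: transpose_matrix_vector)
  have E_open: "open E"
    unfolding E_def by (intro open_vimage D(1) linear_continuous_on matrix_vector_mul_bounded_linear)
  have E_convex: "convex E"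
    unfolding E_def by (intro convex_linear_vimage D(2) matrix_vector_mul_linear)
  have E0: "0 \<notin> E" using 0 by (simp add: E_def)
  have comb: "vec (u * s + v * s') (u * t + v * t') \<in> E"
    if "vec s t \<in> E" "vec s' t' \<in> E" "0 \<le> u" "0 \<le> v" "u + v = 1" for s t s' t' u v
  proof -
    have "u *\<^sub>R vec s t + v *\<^sub>R vec s' t' \<in> E" using E_convex that unfolding convex_def by blast
    moreover have "u *\<^sub>R vec s t + v *\<^sub>R vec s' t' = vec (u * s + v * s') (u * t + v * t')"
      by (simp add: vec_eq_iff forall_2 vec)
    ultimately show ?thesis by simp
  qed
  have top: "vec 0 T \<in> E" using E_iff[of p] p h(3) by (simp add: hA)
  then obtain \<delta> where \<delta>: "0 < \<delta>" "ball (vec 0 T) \<delta> \<subseteq> E" using E_open open_contains_ball by blast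
  have topE: "vec s T \<in> E" if "\<bar>s\<bar> < \<delta>" for s
  proof -
    have "dist (vec 0 T) (vec s T) = \<bar>s\<bar>" by (simp add: dist_norm norm_vec_def L2_set_def sum_2 vec)
    then show ?thesis using that \<delta>(2) by auto
  qed
  have between: "vec s t \<in> E" if "vec s t1 \<in> E" "vec s t2 \<in> E" "t1 \<le> t" "t \<le> t2" for s t t1 t2
  proof (cases "t1 = t2")
    case True then show ?thesis using that by simp
  next
    case False
    then have lt: "t1 < t2" using that by simp
    let ?u = "(t2 - t) / (t2 - t1)" and ?v = "(t - t1) / (t2 - t1)"
    have uv: "0 \<le> ?u" "0 \<le> ?v" "?u + ?v = 1" using that lt by (auto simp: add_divide_distrib[symmetric])
    have "?u * t1 + ?v * t2 = ((t2 - t) * t1 + (t - t1) * t2) / (t2 - t1)" by (simp add: add_divide_distrib)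
    also have "(t2 - t) * t1 + (t - t1) * t2 = t * (t2 - t1)" by (simp add: algebra_simps)
    finally have "?u * t1 + ?v * t2 = t" using lt by simp
    moreover have "?u * s + ?v * s = s" using uv(3) by (metis distrib_right mult_1)
    ultimately show ?thesis using comb[OF that(1,2) uv] by simp
  qed
  have lower: "- T < t" if "vec s t \<in> E" "\<bar>s\<bar> < \<delta>" for s t
  proof (rule ccontr)
    assume nt: "\<not> - T < t"
    \<comment> \<open>the midpoint with the point above \<open>- s\<close> lies on the vertical axis, at or below the origin\<close>
    have "vec (1 / 2 * s + 1 / 2 * (- s)) (1 / 2 * t + 1 / 2 * T) \<in> E"
      by (rule comb[OF that(1) topE]) (use that in auto)
    then have "vec 0 ((t + T) / 2) \<in> E" by (simp add: add_divide_distrib)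
    then have "vec 0 0 \<in> E" by (rule between[OF _ top]) (use nt T in auto)
    moreover have "vec 0 0 = 0" by (simp add: vec_eq_iff forall_2 vec)
    ultimately show False using E0 by simp
  qed
  define \<eta> where "\<eta> s = Inf {t. vec s t \<in> E}" for s
  have bdd: "bdd_below {t. vec s t \<in> E}" if "\<bar>s\<bar> < \<delta>" for s
    using lower that by (intro bdd_belowI[of _ "- T"]) (auto intro: less_imp_le)
  have ne: "{t. vec s t \<in> E} \<noteq> {}" if "\<bar>s\<bar> < \<delta>" for s using topE[OF that] by blast
  have E_epi: "vec s t \<in> E \<longleftrightarrow> \<eta> s < t" if s: "\<bar>s\<bar> < \<delta>" and t: "t \<le> T" for s t
  proof
    assume "vec s t \<in> E"
    then obtain k where k: "0 < k" "ball (vec s t) k \<subseteq> E" using E_open open_contains_ball by blast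
    have "dist (vec s t) (vec s (t - k / 2)) = k / 2" using k(1) by (simp add: dist_norm norm_vec_def L2_set_def sum_2 vec)
    then have "vec s (t - k / 2) \<in> E" using k by auto
    then have "\<eta> s \<le> t - k / 2" unfolding \<eta>_def by (intro cInf_lower bdd s) simp
    then show "\<eta> s < t" using k(1) by simp
  next
    assume "\<eta> s < t"
    then obtain t' where "vec s t' \<in> E" "t' < t"
      using cInf_less_iff[OF ne[OF s] bdd[OF s]] unfolding \<eta>_def by blast
    then show "vec s t \<in> E" using between[OF _ topE[OF s]] t by simp
  qed
  have \<eta>_convex: "convex_on {- \<delta><..<\<delta>} \<eta>"
    unfolding convex_on_def
  proof (intro conjI ballI allI impI)
    fix s s' u v :: real
    assume s: "s \<in> {- \<delta><..<\<delta>}" "s' \<in> {- \<delta><..<\<delta>}" and u: "0 \<le> u" "0 \<le> v" "u + v = 1"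
    have cs: "u * s + v * s' \<in> {- \<delta><..<\<delta>}"
      using convexD[OF convex_real_interval(8) s u] by simp
    show "\<eta> (u *\<^sub>R s + v *\<^sub>R s') \<le> u * \<eta> s + v * \<eta> s'"
    proof (rule field_le_epsilon)
      fix e :: real assume e: "0 < e"
      obtain t where t: "vec s t \<in> E" "t < \<eta> s + e"
        using cInf_less_iff[OF ne bdd, of s "\<eta> s + e"] s e unfolding \<eta>_def by (auto simp: abs_less_iff)
      obtain t' where t': "vec s' t' \<in> E" "t' < \<eta> s' + e"
        using cInf_less_iff[OF ne bdd, of s' "\<eta> s' + e"] s e unfolding \<eta>_def by (auto simp: abs_less_iff)
      have "\<eta> (u * s + v * s') \<le> u * t + v * t'"
        unfolding \<eta>_def by (intro cInf_lower bdd) (use comb[OF t(1) t'(1) u] cs in \<open>auto simp: abs_less_iff\<close>)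
      also have "\<dots> \<le> u * (\<eta> s + e) + v * (\<eta> s' + e)"
        using t t' u by (intro add_mono mult_left_mono) auto
      also have "\<dots> = u * \<eta> s + v * \<eta> s' + (u + v) * e" by (simp add: algebra_simps)
      finally show "\<eta> (u *\<^sub>R s + v *\<^sub>R s') \<le> u * \<eta> s + v * \<eta> s' + e" using u(3) by simp
    qed
  qed simp
  show thesis
  proof (rule that[OF A _ \<delta>(1) \<eta>_convex])
    show "0 < min \<delta> T" using \<delta> T by simp
    fix x :: "real^2" assume x: "norm x < min \<delta> T"
    let ?y = "A *v x"
    have "norm ?y < min \<delta> T" using x by (simp add: orthogonal_matrix_norm[OF o])
    then have "\<bar>?y $ 1\<bar> < \<delta>" "?y $ 2 \<le> T"
      using component_le_norm_cart[of ?y 1] component_le_norm_cart[of ?y 2] by auto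
    then have "vec (?y $ 1) (?y $ 2) \<in> E \<longleftrightarrow> \<eta> (?y $ 1) < ?y $ 2" by (rule E_epi)
    then show "x \<in> D \<longleftrightarrow> \<eta> (?y $ 1) < ?y $ 2"
      using vec_eq[of ?y] E_iff[of x] by simp
  qed
qed

section \<open>The regularity theorem\<close>

text \<open>
  Only the boundary point \<open>0\<close> can be a corner of the given graph, and the slopes agree there.
\<close>

lemma piecewise_C1_imp_C1_near:
  fixes D :: "(real^2) set" and u f H R :: "real^2 \<Rightarrow> real"
  assumes D: "open D" "0 \<in> frontier D"
    and weak: "weak_poisson (ball 0 2) u (\<lambda>x. f x * indicator D x)"
    and zero: "AE x in lebesgue. x \<in> ball 0 2 - closure D \<longrightarrow> u x = 0"
    and \<alpha>: "0 < \<alpha>" and f: "Hoelder_loc \<alpha> (ball 0 2) f"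
    and f_eq: "\<forall>x\<in>ball 0 2. f x = H x + R x"
    and H: "homogeneous_polynomial m H" "harmonic H" "\<exists>x. H x \<noteq> 0"
    and R: "\<forall>x\<in>ball 0 2. \<bar>R x\<bar> \<le> C * norm x powr (real m + \<alpha>)"
    and pw: "piecewise_C1_boundary D"
  shows "C1_boundary_near D 0"
proof -
  obtain r \<eta> A where r: "0 < r" and cont: "continuous_on {- r..r} \<eta>"
    and C1: "C1_on {- r..0} \<eta>" "C1_on {0..r} \<eta>" and A: "rotation_matrix A"
    and set: "((\<lambda>x. A *v (x - 0)) ` D) \<inter> ball 0 r = {y. y $ 2 > \<eta> (y $ 1)} \<inter> ball 0 r"
    using pw D(2) unfolding piecewise_C1_boundary_def epigraph_near_def by blast
  obtain v where v: "H v \<noteq> 0" using H(3) by blast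
  have epi: "x \<in> D \<longleftrightarrow> \<eta> ((A *v (x - 0)) $ 1) < (A *v (x - 0)) $ 2" if "norm (x - 0) < r" for x
    using set that unfolding epigraph_near_iff[OF A] by blast
  have "continuous (at 0 within {- r..r}) \<eta>"
    using cont r by (simp add: continuous_on_eq_continuous_within)
  from graph_through_boundary_point[OF D A r epi this r] have \<eta>0: "\<eta> 0 = 0" .
  have "C1_on {- r..r} \<eta>"
  proof (rule C1_on_glue[OF C1 r])
    fix a b
    assume lim: "((\<lambda>t. (\<eta> t - \<eta> 0) / t) \<longlongrightarrow> a) (at_left 0)" "((\<lambda>t. (\<eta> t - \<eta> 0) / t) \<longlongrightarrow> b) (at_right 0)"
    show "a = b"
      by (rule epigraph_slopes_agree[OF D(1) _ weak zero \<alpha> f _ H(1,2) v _ A r epi \<eta>0, where R = R and C = C])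
        (use f_eq R lim \<eta>0 in simp_all)
  qed
  then show ?thesis
    using r A set unfolding C1_boundary_near_def epigraph_near_def by blast
qed

text \<open>
  The slopes are compared at every boundary point near \<open>0\<close>, in the fixed graph coordinates of \<open>0\<close>
  translated to that point; this makes the convex graph differentiable, hence \<open>C\<^sup>1\<close>.
\<close>

lemma convex_imp_C1_near:
  fixes D :: "(real^2) set" and u f :: "real^2 \<Rightarrow> real"
  assumes D: "open D" "convex D" "0 \<in> frontier D"
    and weak: "weak_poisson (ball 0 2) u (\<lambda>x. f x * indicator D x)"
    and zero: "AE x in lebesgue. x \<in> ball 0 2 - closure D \<longrightarrow> u x = 0"
    and \<alpha>: "0 < \<alpha>" and f: "Hoelder_loc \<alpha> (ball 0 2) f"
    and \<epsilon>: "0 < \<epsilon>"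
    and expansion: "\<And>z. z \<in> frontier D \<inter> ball 0 \<epsilon> \<Longrightarrow>
        \<exists>(m::nat) (H :: real^2 \<Rightarrow> real) (R :: real^2 \<Rightarrow> real) (C::real).
          (\<forall>x. z + x \<in> ball 0 2 \<longrightarrow> f (z + x) = H x + R x) \<and>
          homogeneous_polynomial m H \<and> harmonic H \<and> (\<exists>x. H x \<noteq> 0) \<and>
          (\<forall>x. z + x \<in> ball 0 2 \<longrightarrow> \<bar>R x\<bar> \<le> C * norm x powr (real m + \<alpha>))"
  shows "C1_boundary_near D 0"
proof -
  obtain A :: "real^2^2" and r \<delta> :: real and \<eta> where A: "rotation_matrix A" and r: "0 < r" and \<delta>: "0 < \<delta>"
    and cvx: "convex_on {- \<delta><..<\<delta>} \<eta>"
    and epi: "\<And>x. norm x < r \<Longrightarrow> x \<in> D \<longleftrightarrow> \<eta> ((A *v x) $ 1) < (A *v x) $ 2"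
    using convex_set_local_epigraph[OF D] by blast
  have o: "orthogonal_matrix A" using A by (simp add: rotation_matrix_def)
  have cont: "continuous_on {- \<delta><..<\<delta>} \<eta>"
    by (rule convex_on_continuous[OF _ cvx]) simp
  have epi0: "x \<in> D \<longleftrightarrow> \<eta> ((A *v (x - 0)) $ 1) < (A *v (x - 0)) $ 2" if "norm (x - 0) < r" for x
    using epi[of x] that by simp
  have isCont: "isCont \<eta> t" if "t \<in> {- \<delta><..<\<delta>}" for t
    using cont that by (simp add: continuous_on_eq_continuous_at)
  have \<eta>0: "\<eta> 0 = 0"
    by (rule graph_through_boundary_point[OF D(1,3) A r epi0 _ \<delta>])
      (use isCont[of 0] \<delta> in \<open>auto intro: continuous_at_imp_continuous_at_within\<close>)
  \<comment> \<open>the boundary points of \<open>D\<close> near \<open>0\<close>\<close>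
  define z where "z t = transpose A *v (vector [t, \<eta> t])" for t
  have Az: "A *v z t = vector [t, \<eta> t]" for t
    using o by (simp add: z_def orthogonal_matrix_def matrix_vector_mul_assoc del: transpose_matrix_vector)
  have nz: "norm (z t) \<le> \<bar>t\<bar> + \<bar>\<eta> t\<bar>" for t
  proof -
    have "norm (z t) = norm (vector [t, \<eta> t] :: real^2)"
      using orthogonal_matrix_norm[OF o, of "z t"] by (simp add: Az)
    also have "\<dots> \<le> \<bar>t\<bar> + \<bar>\<eta> t\<bar>"
      using norm_le_l1_cart[of "vector [t, \<eta> t] :: real^2"] by (simp add: sum_2 vector_2(1,2))
    finally show ?thesis .
  qed
  define k where "k = min (min r \<epsilon>) 2"
  have k: "0 < k" using r \<epsilon> by (simp add: k_def)
  have "((\<lambda>t. \<bar>t\<bar> + \<bar>\<eta> t\<bar>) \<longlongrightarrow> \<bar>0\<bar> + \<bar>\<eta> 0\<bar>) (at 0)"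
    using isCont[of 0] \<delta> unfolding isCont_def by (intro tendsto_intros) simp
  then have "eventually (\<lambda>t. \<bar>t\<bar> + \<bar>\<eta> t\<bar> < k) (at 0)"
    by (rule order_tendstoD) (use \<eta>0 k in simp)
  then obtain d where d: "0 < d" "\<And>t. t \<noteq> 0 \<Longrightarrow> \<bar>t\<bar> < d \<Longrightarrow> \<bar>t\<bar> + \<bar>\<eta> t\<bar> < k"
    by (auto simp: eventually_at)
  define e where "e = min d \<delta>"
  have e: "0 < e" using d \<delta> by (simp add: e_def)
  have nzk: "norm (z t) < k" if "\<bar>t\<bar> < e" for t
    using nz[of t] d(2)[of t] that k \<eta>0 by (cases "t = 0") (auto simp: e_def)
  have diff: "\<exists>a. (\<eta> has_real_derivative a) (at t)" if t: "\<bar>t\<bar> < e" for t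
  proof -
    have tI: "t \<in> {- \<delta><..<\<delta>}" using t by (auto simp: e_def)
    have zr: "norm (z t) < r" "norm (z t) < \<epsilon>" "norm (z t) < 2" using nzk[OF t] by (auto simp: k_def)
    have zD: "z t \<notin> D" using epi[OF zr(1)] by (simp add: Az vector_2(1,2))
    have "z t \<in> closure D"
      unfolding closure_approachable
    proof (intro allI impI)
      fix h :: real assume h: "0 < h"
      define h' where "h' = min h (r - norm (z t)) / 2"
      have h': "0 < h'" "h' < h" "h' < r - norm (z t)" using h zr by (auto simp: h'_def)
      define y where "y = z t + h' *\<^sub>R (transpose A *v vector [0, 1])"
      have Ay: "A *v y = vector [t, \<eta> t] + h' *\<^sub>R vector [0, 1]"
        using o by (simp add: y_def Az matrix_vector_right_distrib matrix_vector_mult_scaleR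
            orthogonal_matrix_def matrix_vector_mul_assoc del: transpose_matrix_vector)
      have "norm (y - z t) = norm (A *v (y - z t))" by (rule orthogonal_matrix_norm[OF o, symmetric])
      also have "A *v (y - z t) = h' *\<^sub>R (vector [0, 1] :: real^2)"
        by (simp add: matrix_vector_mult_diff_distrib Ay Az)
      also have "norm \<dots> = h'" using h' by (simp add: norm_vec_def L2_set_def sum_2 vector_2(1,2))
      finally have n: "norm (y - z t) = h'" .
      have "norm y < r" using norm_triangle_sub[of y "z t"] n h' by linarith
      then have "y \<in> D" using epi[of y] h' by (simp add: Ay vector_2(1,2))
      then show "\<exists>y\<in>D. dist y (z t) < h" using n h' by (auto simp: dist_norm)
    qed
    then have zf: "z t \<in> frontier D \<inter> ball 0 \<epsilon>"
      using zD D(1) zr by (simp add: frontier_def interior_open)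
    obtain m H R C v where ex: "\<And>x. z t + x \<in> ball 0 2 \<Longrightarrow> f (z t + x) = H x + R x"
        "homogeneous_polynomial m H" "harmonic H" "H v \<noteq> 0"
        "\<And>x. z t + x \<in> ball 0 2 \<Longrightarrow> \<bar>R x\<bar> \<le> C * norm x powr (real m + \<alpha>)"
      using expansion[OF zf] by blast
    obtain b where b: "((\<lambda>h. (\<eta> (t + h) - \<eta> t) / h) \<longlongrightarrow> b) (at_right 0)"
      by (rule convex_right_slope_limit[OF cvx _ tI]) auto
    obtain a where a: "((\<lambda>h. (\<eta> (t + h) - \<eta> t) / h) \<longlongrightarrow> a) (at_left 0)"
      by (rule convex_left_slope_limit[OF cvx _ tI]) auto
    have ab: "a = b"
    proof (rule epigraph_slopes_agree[OF D(1) _ weak zero \<alpha> f ex A, where \<eta> = "\<lambda>s. \<eta> (t + s) - \<eta> t" and r = "r - norm (z t)"])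
      show "z t \<in> ball 0 2" "0 < r - norm (z t)" "\<eta> (t + 0) - \<eta> t = 0" using zr by simp_all
      fix x assume x: "norm (x - z t) < r - norm (z t)"
      have "norm x < r" using x norm_triangle_sub[of x "z t"] by linarith
      moreover have "A *v x = A *v (x - z t) + vector [t, \<eta> t]"
        by (simp add: matrix_vector_mult_diff_distrib Az)
      ultimately show "x \<in> D \<longleftrightarrow> \<eta> (t + (A *v (x - z t)) $ 1) - \<eta> t < (A *v (x - z t)) $ 2"
        using epi[of x] by (simp only: vector_add_component vector_2(1,2)) (simp add: add.commute less_diff_eq diff_less_eq)
    qed (use a b in simp_all)
    have "((\<lambda>h. (\<eta> (t + h) - \<eta> t) / h) \<longlongrightarrow> a) (at 0)"
      using a b unfolding ab by (rule filterlim_split_at_real)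
    then show ?thesis by (auto simp: DERIV_def)
  qed
  then obtain \<eta>' where \<eta>': "\<And>t. \<bar>t\<bar> < e \<Longrightarrow> (\<eta> has_real_derivative \<eta>' t) (at t)" by metis
  have "continuous_on {- e<..<e} \<eta>'"
  proof (rule convex_derivative_continuous)
    show "convex_on {- e<..<e} \<eta>"
      by (rule convex_on_subset[OF cvx]) (auto simp: e_def)
  qed (use \<eta>' in auto)
  define q where "q = min (e / 2) r"
  have q: "0 < q" "q < e" "q \<le> r" using e r by (auto simp: q_def)
  have "C1_on {- q..q} \<eta>"
    unfolding C1_on_def
  proof (intro exI[of _ \<eta>'] conjI ballI)
    show "continuous_on {- q..q} \<eta>'"
      by (rule continuous_on_subset[OF \<open>continuous_on {- e<..<e} \<eta>'\<close>]) (use q in auto)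
    show "(\<eta> has_real_derivative \<eta>' t) (at t within {- q..q})" if "t \<in> {- q..q}" for t
      by (rule has_field_derivative_at_within[OF \<eta>']) (use that q in auto)
  qed
  moreover have "epigraph_near D 0 q \<eta>"
    unfolding epigraph_near_def
  proof (intro exI[of _ A] conjI A)
    show "((\<lambda>x. A *v (x - 0)) ` D) \<inter> ball 0 q = {y. y $ 2 > \<eta> (y $ 1)} \<inter> ball 0 q"
      unfolding epigraph_near_iff[OF A] using epi0 q by auto
  qed
  ultimately show ?thesis
    using q(1) unfolding C1_boundary_near_def by blast
qed

theorem theorem1p9:
  fixes D :: "(real^2) set" and u f H R :: "real^2 \<Rightarrow> real"
    and \<alpha> C :: real and m :: nat
  assumes "open D" and "0 \<in> frontier D"
    and "H1_loc (ball 0 2) u"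
    and "weak_poisson (ball 0 2) u (\<lambda>x. f x * indicator D x)"
    and "AE x in lebesgue. x \<in> ball 0 2 - closure D \<longrightarrow> u x = 0"
    and "0 < \<alpha>" and "\<alpha> < 1"
    and "Hoelder_loc \<alpha> (ball 0 2) f"
    and "\<forall>x\<in>ball 0 2. f x = H x + R x"
    and "homogeneous_polynomial m H" and "harmonic H" and "\<exists>x. H x \<noteq> 0"
    and "\<forall>x\<in>ball 0 2. \<bar>R x\<bar> \<le> C * norm x powr (real m + \<alpha>)"
  shows "(piecewise_C1_boundary D \<longrightarrow> C1_boundary_near D 0) \<and>
    (convex D \<and>
     (\<exists>\<epsilon>>0. \<forall>z\<in>frontier D \<inter> ball 0 \<epsilon>.
        \<exists>(m\<^sub>z::nat) (H\<^sub>z :: real^2 \<Rightarrow> real) (R\<^sub>z :: real^2 \<Rightarrow> real) (C\<^sub>z::real).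
          (\<forall>x. z + x \<in> ball 0 2 \<longrightarrow> f (z + x) = H\<^sub>z x + R\<^sub>z x) \<and>
          homogeneous_polynomial m\<^sub>z H\<^sub>z \<and> harmonic H\<^sub>z \<and> (\<exists>x. H\<^sub>z x \<noteq> 0) \<and>
          (\<forall>x. z + x \<in> ball 0 2 \<longrightarrow> \<bar>R\<^sub>z x\<bar> \<le> C\<^sub>z * norm x powr (real m\<^sub>z + \<alpha>)))
     \<longrightarrow> C1_boundary_near D 0)"
proof (intro conjI impI, goal_cases)
  case 1
  with assms(1,2,4,5,6,8-13) show ?case
    by (rule piecewise_C1_imp_C1_near)
next
  case 2
  then obtain \<epsilon> where "convex D" "0 < \<epsilon>" and ex: "\<And>z. z \<in> frontier D \<inter> ball 0 \<epsilon> \<Longrightarrow>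
        \<exists>(m::nat) (H :: real^2 \<Rightarrow> real) (R :: real^2 \<Rightarrow> real) (C::real).
          (\<forall>x. z + x \<in> ball 0 2 \<longrightarrow> f (z + x) = H x + R x) \<and>
          homogeneous_polynomial m H \<and> harmonic H \<and> (\<exists>x. H x \<noteq> 0) \<and>
          (\<forall>x. z + x \<in> ball 0 2 \<longrightarrow> \<bar>R x\<bar> \<le> C * norm x powr (real m + \<alpha>))"
    by blast
  show ?case
    by (rule convex_imp_C1_near[OF assms(1) \<open>convex D\<close> assms(2,4,5,6,8) \<open>0 < \<epsilon>\<close> ex])
qed

end
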